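(* There is an algorithm that, given a positive integer $d$ and two proper $S_d$-graphs $G$ and $H$ on $n$ vertices (no representations given), decides whether $G$ and $H$ are isomorphic in time $f(d)\cdot n^{\mathcal{O}(1)}$ for some computable function $f$.
   Context: A subdivision of a graph $H$ is obtained by repeatedly replacing an edge by a path of length two through a new vertex. An $H$-representation of a graph $G$ assigns to each vertex of $G$ a connected subgraph of a subdivision $H'$ of $H$ so that two vertices are adjacent iff their subgraphs share a vertex; $G$ is an $H$-graph if it has one. It is a proper $H$-graph if it has an $H$-representation in which the representing subgraphs are pairwise incomparable by inclusion (none is a subgraph of another). $S_d$ is the star $K_{1,d}$ with $d$ rays. *)

theory Defs
  imports "Graph_Theory.Graph_Theory"
begin

section \<open>Proper H-graphs\<close>

text \<open>
  A finite simple graph is a \<^locale>\<open>pair_graph\<close>: a finite, loopless and symmetric set of arcs.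
  Host vertices are natural numbers, so that a fresh vertex is available for every
  subdivision step.  The requirement \<^term>\<open>pair_graph (M v)\<close> makes the representing
  objects undirected subgraphs; \<^const>\<open>connected\<close> entails that they are nonempty.
\<close>

definition is_representation ::
    "nat pair_pre_digraph \<Rightarrow> 'a pair_pre_digraph \<Rightarrow> ('a \<Rightarrow> nat pair_pre_digraph) \<Rightarrow> bool" where
  "is_representation H G M \<longleftrightarrow> (\<exists>H'. subdivision_pair H H' \<and>
     (\<forall>v \<in> pverts G. pair_graph (M v) \<and> connected (with_proj (M v)) \<and>
        subgraph (with_proj (M v)) (with_proj H')) \<and>
     (\<forall>u \<in> pverts G. \<forall>v \<in> pverts G. u \<noteq> v \<longrightarrow>
        ((u, v) \<in> parcs G \<longleftrightarrow> pverts (M u) \<inter> pverts (M v) \<noteq> {})))"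

definition H_graph :: "nat pair_pre_digraph \<Rightarrow> 'a pair_pre_digraph \<Rightarrow> bool" where
  "H_graph H G \<longleftrightarrow> pair_graph G \<and> (\<exists>M. is_representation H G M)"

definition proper_H_graph :: "nat pair_pre_digraph \<Rightarrow> 'a pair_pre_digraph \<Rightarrow> bool" where
  "proper_H_graph H G \<longleftrightarrow> pair_graph G \<and> (\<exists>M. is_representation H G M \<and>
     (\<forall>u \<in> pverts G. \<forall>v \<in> pverts G. u \<noteq> v \<longrightarrow>
        \<not> subgraph (with_proj (M u)) (with_proj (M v))))"

definition star :: "nat \<Rightarrow> nat pair_pre_digraph" where
  "star d = \<lparr>pverts = {0..d}, parcs = {0} \<times> {1..d} \<union> {1..d} \<times> {0}\<rparr>"

lemma star_complete_bipartite: "K\<^bsub>1,d\<^esub> (with_proj (star d))"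
  unfolding complete_bipartite_digraph_pair_def
  by (intro conjI exI[of _ "{0}"] exI[of _ "{1..d}"]) (auto simp: star_def)


section \<open>Random access machines\<close>

text \<open>
  The model of computation is a deterministic random access machine with structured control
  flow and the uniform cost measure.  A state consists of registers and an indirectly
  addressed memory, both holding natural numbers.  The only arithmetic operations are addition
  and truncated subtraction.  In particular there is no unit-cost multiplication, so numbers
  grow by at most one bit per step and running times are polynomially related to those of
  Turing machines.
\<close>

type_synonym state = "(nat \<Rightarrow> nat) \<times> (nat \<Rightarrow> nat)"

datatype com =
    SKIP
  | LIT nat nat   \<comment> \<open>\<open>r\<^sub>i := k\<close>\<close>
  | ADD nat nat nat   \<comment> \<open>\<open>r\<^sub>i := r\<^sub>j + r\<^sub>k\<close>\<close>
  | SUB nat nat nat   \<comment> \<open>\<open>r\<^sub>i := r\<^sub>j - r\<^sub>k\<close>\<close>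
  | LOAD nat nat   \<comment> \<open>\<open>r\<^sub>i := mem[r\<^sub>j]\<close>\<close>
  | STORE nat nat   \<comment> \<open>\<open>mem[r\<^sub>i] := r\<^sub>j\<close>\<close>
  | SEQ com com
  | COND nat com com   \<comment> \<open>if \<open>r\<^sub>i \<noteq> 0\<close>\<close>
  | WHILE nat com   \<comment> \<open>while \<open>r\<^sub>i \<noteq> 0\<close>\<close>

text \<open>\<open>exec c s t s'\<close>: program \<open>c\<close>, started in \<open>s\<close>, halts in \<open>s'\<close> after \<open>t\<close> steps.\<close>

inductive exec :: "com \<Rightarrow> state \<Rightarrow> nat \<Rightarrow> state \<Rightarrow> bool" where
  skip: "exec SKIP s 1 s"
| lit: "exec (LIT i k) (r, m) 1 (r(i := k), m)"
| add: "exec (ADD i j k) (r, m) 1 (r(i := r j + r k), m)"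
| sub: "exec (SUB i j k) (r, m) 1 (r(i := r j - r k), m)"
| load: "exec (LOAD i j) (r, m) 1 (r(i := m (r j)), m)"
| store: "exec (STORE i j) (r, m) 1 (r, m(r i := r j))"
| seq: "exec c\<^sub>1 s t\<^sub>1 s\<^sub>1 \<Longrightarrow> exec c\<^sub>2 s\<^sub>1 t\<^sub>2 s\<^sub>2 \<Longrightarrow> exec (SEQ c\<^sub>1 c\<^sub>2) s (t\<^sub>1 + t\<^sub>2) s\<^sub>2"
| cond_true: "fst s i \<noteq> 0 \<Longrightarrow> exec c\<^sub>1 s t s' \<Longrightarrow> exec (COND i c\<^sub>1 c\<^sub>2) s (1 + t) s'"
| cond_false: "fst s i = 0 \<Longrightarrow> exec c\<^sub>2 s t s' \<Longrightarrow> exec (COND i c\<^sub>1 c\<^sub>2) s (1 + t) s'"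
| while_true: "fst s i \<noteq> 0 \<Longrightarrow> exec c s t\<^sub>1 s\<^sub>1 \<Longrightarrow> exec (WHILE i c) s\<^sub>1 t\<^sub>2 s\<^sub>2 \<Longrightarrow>
    exec (WHILE i c) s (1 + t\<^sub>1 + t\<^sub>2) s\<^sub>2"
| while_false: "fst s i = 0 \<Longrightarrow> exec (WHILE i c) s 1 s"

inductive_cases skipE: "exec SKIP s t s'"
inductive_cases litE: "exec (LIT i k) s t s'"
inductive_cases addE: "exec (ADD i j k) s t s'"
inductive_cases subE: "exec (SUB i j k) s t s'"
inductive_cases loadE: "exec (LOAD i j) s t s'"
inductive_cases storeE: "exec (STORE i j) s t s'"
inductive_cases seqE: "exec (SEQ c\<^sub>1 c\<^sub>2) s t s'"
inductive_cases condE: "exec (COND i c\<^sub>1 c\<^sub>2) s t s'"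
inductive_cases whileE: "exec (WHILE i c) s t s'"

text \<open>
  Execution is deterministic, so a statement that some halting run has a certain
  running time and output is a statement about the unique run.
\<close>

lemma exec_deterministic:
  "exec c s t s' \<Longrightarrow> exec c s u s'' \<Longrightarrow> u = t \<and> s'' = s'"
proof (induction arbitrary: u s'' rule: exec.induct)
  case (seq c\<^sub>1 s t\<^sub>1 s\<^sub>1 c\<^sub>2 t\<^sub>2 s\<^sub>2)
  from seq.prems show ?case by (rule seqE) (metis seq.IH)
next
  case (cond_true s i c\<^sub>1 t s' c\<^sub>2)
  from cond_true.prems show ?case
    by (rule condE) (metis cond_true.IH plus_1_eq_Suc, metis cond_true.hyps(1))
next
  case (cond_false s i c\<^sub>2 t s' c\<^sub>1)
  from cond_false.prems show ?case
    by (rule condE) (metis cond_false.hyps(1) less_irrefl, metis cond_false.IH plus_1_eq_Suc)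
next
  case (while_true s i c t\<^sub>1 s\<^sub>1 t\<^sub>2 s\<^sub>2)
  from while_true.prems show ?case
    by (rule whileE) (metis while_true.IH add.assoc plus_1_eq_Suc, metis while_true.hyps(1))
next
  case (while_false s i c)
  from while_false.prems show ?case
    by (rule whileE) (use while_false.hyps in simp_all)
qed (elim skipE litE addE subE loadE storeE; simp)+

definition computable :: "(nat \<Rightarrow> nat) \<Rightarrow> bool" where
  "computable f \<longleftrightarrow> (\<exists>c. \<forall>x. \<exists>t s'. exec c ((\<lambda>_. 0)(0 := x), \<lambda>_. 0) t s' \<and> fst s' 0 = f x)"

text \<open>The answer is the content of register \<open>0\<close>: \<open>1\<close> for yes and \<open>0\<close> for no.\<close>

definition decides_within :: "com \<Rightarrow> state \<Rightarrow> nat \<Rightarrow> bool \<Rightarrow> bool" where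
  "decides_within c s b P \<longleftrightarrow>
     (\<exists>t s'. exec c s t s' \<and> t \<le> b \<and> fst s' 0 = (if P then 1 else 0))"

text \<open>
  The input: \<open>d\<close> in register \<open>0\<close>, \<open>n\<close> in register \<open>1\<close>, and the adjacency matrices of two
  graphs with vertex set \<open>{0..<n}\<close>, row by row and one after the other, in memory
  cells \<open>0, ..., 2 * n * n - 1\<close>.
\<close>

definition graph_pair_input ::
    "nat \<Rightarrow> nat \<Rightarrow> nat pair_pre_digraph \<Rightarrow> nat pair_pre_digraph \<Rightarrow> state" where
  "graph_pair_input d n G H =
     ((\<lambda>_. 0)(0 := d, 1 := n),
      \<lambda>a. if a < n * n then of_bool ((a div n, a mod n) \<in> parcs G)
          else if a < 2 * n * n then of_bool (((a - n * n) div n, (a - n * n) mod n) \<in> parcs H)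
          else 0)"

end

theory Submission
  imports Defs
begin

text \<open>
  A component of a proper \<open>S\<^sub>d\<close>-graph has a maximal clique \<open>K\<close> such that the other vertices are
  intervals on at most \<open>d\<close> rays.  Properness forces every interval to end behind all vertices of
  \<open>K\<close>.  Hence, within a ray, the vertices at a fixed distance from \<open>K\<close> form a clique, and their
  neighbourhoods in the previous layer and in the next one are chains.  So the ray, the distance, and
  the numbers of neighbours in the adjacent layers (for vertices of \<open>K\<close>: on each ray) determine a
  vertex up to twins, and an isomorphism is any bijection that preserves these data.

  The algorithm tries all maximal cliques, of which there are at most \<open>n\<close> since proper
  \<open>S\<^sub>d\<close>-graphs are chordal, and all \<open>d\<^sup>d\<close> ways to match the rays.  It checks explicitly that the data
  define an isomorphism, so it needs no representation and its positive answers are always right.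
  Isomorphism of arbitrary graphs is reduced to connected ones by counting vertices in isomorphic
  components of the disjoint union.
\<close>

section \<open>Programming the machine\<close>

text \<open>A few numbers per vertex suffice because nested finite sets of equal size coincide:
  where neighbourhoods form a chain, their sizes determine them. The obstacle is that all data must
  be read off the bare graph. The vertices at the center of the star cannot be recognised, and a
  component may miss the center altogether. So the common point is moved along a ray until its
  clique is inclusion-maximal; such cliques are found as closed later neighbourhoods in an
  elimination of simplicial vertices. A ray is recognised by its layer next to the clique, since
  these layers are cliques without edges between them. Only the correspondence of ray numbers in the
  two graphs has to be guessed: the guess is a number below \<open>d ^ d\<close>, read digit by
  digit in base \<open>d\<close>. Counting vertices instead of components works because isomorphic
  components have equal size. On the machine all loops have the same length \<open>cB\<close>, which
  exceeds the number of vertices of the disjoint union as well as \<open>d ^ d\<close>. Times are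
  polynomial in \<open>cB\<close>, and \<open>cB\<close> is \<open>2 * n\<close> plus a term in
  \<open>d\<close> alone.\<close>

definition runs :: "com \<Rightarrow> state \<Rightarrow> nat \<Rightarrow> (state \<Rightarrow> bool) \<Rightarrow> bool" where
  "runs c s T Q \<longleftrightarrow> (\<exists>t s'. exec c s t s' \<and> t \<le> T \<and> Q s')"

section \<open>Rules for execution within a time bound\<close>

lemma runs_mono:
  "runs c s T Q \<Longrightarrow> T \<le> T' \<Longrightarrow> (\<And>s'. Q s' \<Longrightarrow> Q' s') \<Longrightarrow> runs c s T' Q'"
  unfolding runs_def by (meson le_trans)

lemma runs_basic:
  "Q (r(i := k), m) \<Longrightarrow> runs (LIT i k) (r, m) (Suc 0) Q"
  "Q (r(i := r j + r k), m) \<Longrightarrow> runs (ADD i j k) (r, m) (Suc 0) Q"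
  "Q (r(i := r j - r k), m) \<Longrightarrow> runs (SUB i j k) (r, m) (Suc 0) Q"
  "Q (r(i := m (r j)), m) \<Longrightarrow> runs (LOAD i j) (r, m) (Suc 0) Q"
  "Q (r, m(r i := r j)) \<Longrightarrow> runs (STORE i j) (r, m) (Suc 0) Q"
  unfolding runs_def by (metis One_nat_def exec.intros(2-6) order_refl)+

lemma runs_seq:
  assumes "runs c\<^sub>1 s T\<^sub>1 P" "\<And>s'. P s' \<Longrightarrow> runs c\<^sub>2 s' T\<^sub>2 Q"
  shows "runs (SEQ c\<^sub>1 c\<^sub>2) s (T\<^sub>1 + T\<^sub>2) Q"
  using assms unfolding runs_def by (meson add_mono exec.seq)

lemma runs_seq_to:
  "runs a s (Suc 0) (\<lambda>s'. s' = s\<^sub>1) \<Longrightarrow> runs c s\<^sub>1 T Q \<Longrightarrow> runs (SEQ a c) s (Suc T) Q"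
  using runs_seq[of a s "Suc 0" "\<lambda>s'. s' = s\<^sub>1" c T Q] by simp

lemma runs_then:
  "runs c (r(i := k), m) T Q \<Longrightarrow> runs (SEQ (LIT i k) c) (r, m) (Suc T) Q"
  "runs c (r(i := r j + r k), m) T Q \<Longrightarrow> runs (SEQ (ADD i j k) c) (r, m) (Suc T) Q"
  "runs c (r(i := r j - r k), m) T Q \<Longrightarrow> runs (SEQ (SUB i j k) c) (r, m) (Suc T) Q"
  by (rule runs_seq_to[rotated], assumption, rule runs_basic, rule refl)+

lemma runs_cond:
  assumes "fst s i \<noteq> 0 \<Longrightarrow> runs c\<^sub>1 s T Q" "fst s i = 0 \<Longrightarrow> runs c\<^sub>2 s T Q"
  shows "runs (COND i c\<^sub>1 c\<^sub>2) s (1 + T) Q"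
  using assms unfolding runs_def by (meson add_left_mono exec.cond_true exec.cond_false)

text \<open>The invariant is indexed by the number of completed rounds, which yields termination and
  the time bound together. The last \<open>+ 1\<close> pays for the final test.\<close>

lemma runs_while:
  assumes step: "\<And>j s. j < b \<Longrightarrow> I j s \<Longrightarrow> fst s i \<noteq> 0 \<and> runs c s T (I (Suc j))"
    and start: "I 0 s"
    and stop: "\<And>s. I b s \<Longrightarrow> fst s i = 0"
  shows "runs (WHILE i c) s (b * (T + 1) + 1) (I b)"
proof -
  have "runs (WHILE i c) s ((b - j) * (T + 1) + 1) (I b)" if "I j s" "j \<le> b" for j s
    using that
  proof (induction "b - j" arbitrary: j s)
    case 0
    then have "j = b" by simp
    then show ?case using 0 stop unfolding runs_def
      by (metis exec.while_false le_add2)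
  next
    case (Suc n)
    then have j: "j < b" by simp
    from step[OF j Suc.prems(1)] obtain t1 s1 where
      1: "fst s i \<noteq> 0" "exec c s t1 s1" "t1 \<le> T" "I (Suc j) s1"
      unfolding runs_def by blast
    have "runs (WHILE i c) s1 ((b - Suc j) * (T + 1) + 1) (I b)"
      using Suc.hyps(1)[of "Suc j" s1] Suc.hyps(2) j 1(4) by simp
    then obtain t2 s2 where
      2: "exec (WHILE i c) s1 t2 s2" "t2 \<le> (b - Suc j) * (T + 1) + 1" "I b s2"
      unfolding runs_def by blast
    have "exec (WHILE i c) s (1 + t1 + t2) s2" using 1 2 exec.while_true by blast
    moreover have "b - j = Suc (b - Suc j)" using j by simp
    then have "1 + t1 + t2 \<le> (b - j) * (T + 1) + 1" using 1(3) 2(2) by simp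
    ultimately show ?case using 2(3) unfolding runs_def by blast
  qed
  from this[OF start] show ?thesis by simp
qed

section \<open>Polynomial growth\<close>

definition poly_bounded :: "(nat \<Rightarrow> nat) \<Rightarrow> bool" where
  "poly_bounded T \<longleftrightarrow> (\<exists>K q. \<forall>b. T b \<le> K * (b + 1) ^ q)"

lemma poly_bounded_const: "poly_bounded (\<lambda>b. k)"
  unfolding poly_bounded_def by (intro exI[of _ k] exI[of _ 0]) simp

lemma poly_bounded_id: "poly_bounded (\<lambda>b. b)"
  unfolding poly_bounded_def by (intro exI[of _ 1] exI[of _ 1]) simp

lemma poly_bounded_add:
  assumes "poly_bounded T" "poly_bounded U" shows "poly_bounded (\<lambda>b. T b + U b)"
proof -
  from assms obtain K q K' q' where
    *: "T b \<le> K * (b + 1) ^ q" "U b \<le> K' * (b + 1) ^ q'" for b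
    unfolding poly_bounded_def by metis
  have "T b + U b \<le> (K + K') * (b + 1) ^ (q + q')" for b
  proof -
    have "K * (b + 1) ^ q \<le> K * (b + 1) ^ (q + q')" "K' * (b + 1) ^ q' \<le> K' * (b + 1) ^ (q + q')"
      by (intro mult_left_mono power_increasing; simp)+
    with *[of b] show ?thesis unfolding distrib_right by linarith
  qed
  then show ?thesis unfolding poly_bounded_def by blast
qed

lemma poly_bounded_mult:
  assumes "poly_bounded T" "poly_bounded U" shows "poly_bounded (\<lambda>b. T b * U b)"
proof -
  from assms obtain K q K' q' where
    *: "T b \<le> K * (b + 1) ^ q" "U b \<le> K' * (b + 1) ^ q'" for b
    unfolding poly_bounded_def by metis
  have "T b * U b \<le> (K * K') * (b + 1) ^ (q + q')" for b
    using mult_mono[OF *[of b]] by (simp add: power_add algebra_simps)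
  then show ?thesis unfolding poly_bounded_def by blast
qed

lemma poly_bounded_Suc: "poly_bounded T \<Longrightarrow> poly_bounded (\<lambda>b. Suc (T b))"
  using poly_bounded_add[OF _ poly_bounded_const[of 1]] by simp

lemmas poly_bounded_intros = poly_bounded_Suc
  poly_bounded_const poly_bounded_id poly_bounded_add poly_bounded_mult

section \<open>Configurations and their representation in memory\<close>

text \<open>
  Abstract configurations: register 0 holds \<open>cd\<close>, register 1 holds \<open>cn\<close>, and register 2 holds
  a bound \<open>cB\<close> which is the number of iterations of every loop.  The raw input occupies
  the first \<open>cB * cB\<close> memory cells; behind it there is a sequence of two-dimensional arrays.
\<close>

record cfg =
  cd :: nat
  cn :: nat
  cB :: nat
  inp :: "nat \<Rightarrow> nat"
  arr :: "nat \<Rightarrow> nat \<Rightarrow> nat \<Rightarrow> nat"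

definition adr :: "nat \<Rightarrow> nat \<Rightarrow> nat \<Rightarrow> nat \<Rightarrow> nat" where
  "adr B k x y = B * (B * (k + 1) + x) + y"

lemma mixed_radix_inj:
  fixes B :: nat assumes "B * u + y = B * u' + y'" "y < B" "y' < B" shows "u = u' \<and> y = y'"
proof -
  have "(B * u + y) div B = (B * u' + y') div B" "(B * u + y) mod B = (B * u' + y') mod B"
    using assms(1) by simp_all
  with assms(2,3) show ?thesis by simp
qed

lemma adr_inj:
  "x < B \<Longrightarrow> y < B \<Longrightarrow> x' < B \<Longrightarrow> y' < B \<Longrightarrow> adr B k x y = adr B k' x' y' \<longleftrightarrow>
    k = k' \<and> x = x' \<and> y = y'"
  unfolding adr_def using mixed_radix_inj by (metis add_right_cancel)

lemma adr_ge: "B * B \<le> adr B k x y"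
proof -
  have "B * B \<le> B * (B * (k + 1) + x)" by (intro mult_left_mono) auto
  then show ?thesis unfolding adr_def by linarith
qed

definition rep :: "cfg \<Rightarrow> state \<Rightarrow> bool" where
  "rep \<sigma> s \<longleftrightarrow> fst s 0 = cd \<sigma> \<and> fst s 1 = cn \<sigma> \<and> fst s 2 = cB \<sigma> \<and>
     (\<forall>a < cB \<sigma> * cB \<sigma>. snd s a = inp \<sigma> a) \<and>
     (\<forall>k. \<forall>x < cB \<sigma>. \<forall>y < cB \<sigma>. snd s (adr (cB \<sigma>) k x y) = arr \<sigma> k x y)"

lemma rep_regs: "rep \<sigma> (s, m) \<Longrightarrow> 3 \<le> k \<Longrightarrow> \<forall>j<k. s' j = s j \<Longrightarrow> rep \<sigma> (s', m)"
  unfolding rep_def by simp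

abbreviation (input) "env s \<rho> \<equiv> \<lambda>j :: nat. s (\<rho> j)"

abbreviation (input) "yields s m k a \<equiv> \<lambda>(s', m'). m' = m \<and> s' k = a \<and> (\<forall>j<k. s' j = s j)"

text \<open>Registers serve as a stack with top \<open>k\<close>: the value is left in register
  \<open>k\<close>, everything below it and the whole memory are kept, and everything above it is
  scratch space.\<close>

definition evals :: "com \<Rightarrow> (nat \<Rightarrow> nat) \<Rightarrow> nat \<Rightarrow> (nat \<Rightarrow> nat) \<Rightarrow> (cfg \<Rightarrow> (nat \<Rightarrow> nat) \<Rightarrow> nat) \<Rightarrow> bool" where
  "evals c T k \<rho> F \<longleftrightarrow> poly_bounded T \<and>
     (\<forall>\<sigma> s m. rep \<sigma> (s, m) \<longrightarrow> runs c (s, m) (T (cB \<sigma>)) (yields s m k (F \<sigma> (env s \<rho>))))"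

text \<open>
  \<open>imp F\<close>: the number \<open>F \<sigma> r\<close> is computable in time polynomial in \<open>cB \<sigma>\<close>, where \<open>r\<close> is an
  environment of local variables; variable \<open>j\<close> lives in register \<open>\<rho> j\<close>, and the registers from
  \<open>k\<close> on are free.  Since \<open>F\<close> is an arbitrary HOL function, an algorithm is an ordinary HOL term,
  and resolution with the rules below finds its program.
\<close>

definition imp :: "(cfg \<Rightarrow> (nat \<Rightarrow> nat) \<Rightarrow> nat) \<Rightarrow> bool" where
  "imp F \<longleftrightarrow> (\<forall>\<rho> k. 3 \<le> k \<longrightarrow> (\<forall>j. \<rho> j < k) \<longrightarrow> (\<exists>c T. evals c T k \<rho> F))"

lemma imp_intro: "(\<And>\<rho> k. 3 \<le> k \<Longrightarrow> (\<And>j. \<rho> j < k) \<Longrightarrow> \<exists>c T. evals c T k \<rho> F) \<Longrightarrow> imp F"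
  unfolding imp_def by blast

lemma imp_elim:
  assumes "imp F" "3 \<le> k" "\<And>j. \<rho> j < k"
  obtains c T where "evals c T k \<rho> F"
  using assms unfolding imp_def by meson

lemma evals_intro:
  assumes "\<And>\<sigma> s m. rep \<sigma> (s, m) \<Longrightarrow> runs c (s, m) (T (cB \<sigma>)) (yields s m k (F \<sigma> (env s \<rho>)))"
    and "poly_bounded T"
  shows "\<exists>c T. evals c T k \<rho> F"
  using assms unfolding evals_def by blast

lemma evals_poly: "evals c T k \<rho> F \<Longrightarrow> poly_bounded T"
  by (simp add: evals_def)

lemma evals_runs:
  "evals c T k \<rho> F \<Longrightarrow> rep \<sigma> (s, m) \<Longrightarrow> runs c (s, m) (T (cB \<sigma>)) (yields s m k (F \<sigma> (env s \<rho>)))"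
  by (simp add: evals_def)

lemma evals_then:
  assumes c: "evals c T k \<rho> F" and r: "rep \<sigma> (s, m)" and k: "3 \<le> k" "\<And>j. \<rho> j < k"
    and rest: "\<And>s'. rep \<sigma> (s', m) \<Longrightarrow> s' k = F \<sigma> (env s \<rho>) \<Longrightarrow> \<forall>j<k. s' j = s j \<Longrightarrow>
      env s' \<rho> = env s \<rho> \<Longrightarrow> runs c' (s', m) T' Q"
  shows "runs (SEQ c c') (s, m) (T (cB \<sigma>) + T') Q"
proof (rule runs_seq[OF evals_runs[OF c r]])
  fix s' assume "yields s m k (F \<sigma> (env s \<rho>)) s'"
  then obtain s1 where s1: "s' = (s1, m)" "s1 k = F \<sigma> (env s \<rho>)" "\<forall>j<k. s1 j = s j" by (cases s') auto
  show "runs c' s' T' Q"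
    unfolding s1(1) by (rule rest) (use s1 rep_regs[OF r k(1)] k(2) in auto)
qed

section \<open>Programs for expressions\<close>

lemma imp_rename: "imp F \<Longrightarrow> imp (\<lambda>\<sigma> r. F \<sigma> (\<lambda>j. r (\<pi> j)))"
  unfolding imp_def evals_def by (intro allI impI) simp

lemma imp_const: "imp (\<lambda>\<sigma> r. a)"
proof (rule imp_intro)
  fix \<rho> :: "nat \<Rightarrow> nat" and k
  show "\<exists>c T. evals c T k \<rho> (\<lambda>\<sigma> r. a)"
    by (rule evals_intro[where c = "LIT k a"], rule runs_basic) (simp_all add: poly_bounded_const)
qed

text \<open>There is no move instruction; a register is copied by adding it to a cleared one.
  Clearing register \<open>k\<close> does no harm because \<open>i < k\<close>.\<close>

lemma imp_copy:
  assumes "\<And>\<rho> k. 3 \<le> k \<Longrightarrow> (\<And>j. \<rho> j < k) \<Longrightarrow>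
    \<exists>i<k. \<forall>\<sigma> s m. rep \<sigma> (s, m) \<longrightarrow> s i = F \<sigma> (env s \<rho>)"
  shows "imp F"
proof (rule imp_intro)
  fix \<rho> :: "nat \<Rightarrow> nat" and k :: nat
  assume k: "3 \<le> k" "\<And>j. \<rho> j < k"
  from assms[OF k(1), of \<rho>] k(2) obtain i where i: "i < k"
    "\<And>\<sigma> s m. rep \<sigma> (s, m) \<Longrightarrow> s i = F \<sigma> (env s \<rho>)" by blast
  have "runs (SEQ (LIT k 0) (ADD k k i)) (s, m) (Suc (Suc 0)) (yields s m k (F \<sigma> (env s \<rho>)))"
    if "rep \<sigma> (s, m)" for \<sigma> s m
    using i(1) i(2)[OF that] by (intro runs_then runs_basic) simp
  then show "\<exists>c T. evals c T k \<rho> F" by (rule evals_intro[where T = "\<lambda>_. Suc (Suc 0)"]) (assumption, rule poly_bounded_const)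
qed

lemma imp_var: "imp (\<lambda>\<sigma> r. r i)"
proof (rule imp_copy)
  fix \<rho> :: "nat \<Rightarrow> nat" and k :: nat
  assume "\<And>j. \<rho> j < k"
  then show "\<exists>i'<k. \<forall>\<sigma> s m. rep \<sigma> (s, m) \<longrightarrow> s i' = s (\<rho> i)" by (intro exI[of _ "\<rho> i"]) simp
qed

lemma imp_params: "imp (\<lambda>\<sigma> r. cd \<sigma>)" "imp (\<lambda>\<sigma> r. cn \<sigma>)" "imp (\<lambda>\<sigma> r. cB \<sigma>)"
proof -
  show "imp (\<lambda>\<sigma> r. cd \<sigma>)" by (rule imp_copy, rule exI[of _ 0]) (simp add: rep_def)
  show "imp (\<lambda>\<sigma> r. cn \<sigma>)" by (rule imp_copy, rule exI[of _ 1]) (simp add: rep_def)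
  show "imp (\<lambda>\<sigma> r. cB \<sigma>)" by (rule imp_copy, rule exI[of _ 2]) (simp add: rep_def)
qed

lemma imp_binop:
  assumes "imp X" "imp Y"
    and op: "\<And>i j l r m Q. Q (r(i := f (r j) (r l)), m) \<Longrightarrow> runs (opc i j l) (r, m) (Suc 0) Q"
  shows "imp (\<lambda>\<sigma> r. f (X \<sigma> r) (Y \<sigma> r))"
proof (rule imp_intro)
  fix \<rho> :: "nat \<Rightarrow> nat" and k :: nat
  assume k: "3 \<le> k" and \<rho>: "\<And>j. \<rho> j < k"
  obtain c1 T1 where 1: "evals c1 T1 k \<rho> X"
    by (rule imp_elim[OF assms(1) k, of \<rho>]) (use \<rho> in auto)
  obtain c2 T2 where 2: "evals c2 T2 (Suc k) \<rho> Y"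
    by (rule imp_elim[OF assms(2), of "Suc k" \<rho>]) (use k \<rho> in \<open>auto intro: less_SucI\<close>)
  show "\<exists>c T. evals c T k \<rho> (\<lambda>\<sigma> r. f (X \<sigma> r) (Y \<sigma> r))"
  proof (rule evals_intro)
    show "poly_bounded (\<lambda>b. T1 b + (T2 b + Suc 0))"
      by (intro poly_bounded_intros evals_poly[OF 1] evals_poly[OF 2])
    fix \<sigma> s m assume "rep \<sigma> (s, m)"
    then show "runs (SEQ c1 (SEQ c2 (opc k k (Suc k)))) (s, m) (T1 (cB \<sigma>) + (T2 (cB \<sigma>) + Suc 0))
       (yields s m k (f (X \<sigma> (env s \<rho>)) (Y \<sigma> (env s \<rho>))))"
    proof (rule evals_then[OF 1 _ k \<rho>])
      fix s1 assume "rep \<sigma> (s1, m)" and s1: "s1 k = X \<sigma> (env s \<rho>)" "\<forall>j<k. s1 j = s j" "env s1 \<rho> = env s \<rho>"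
      then show "runs (SEQ c2 (opc k k (Suc k))) (s1, m) (T2 (cB \<sigma>) + Suc 0)
          (yields s m k (f (X \<sigma> (env s \<rho>)) (Y \<sigma> (env s \<rho>))))"
        using k \<rho> by (elim evals_then[OF 2]) (auto simp: s1 less_SucI intro!: op)
    qed
  qed
qed

lemma imp_add: "imp X \<Longrightarrow> imp Y \<Longrightarrow> imp (\<lambda>\<sigma> r. X \<sigma> r + Y \<sigma> r)"
  by (rule imp_binop[where opc = ADD]) (auto intro: runs_basic)

lemma imp_diff: "imp X \<Longrightarrow> imp Y \<Longrightarrow> imp (\<lambda>\<sigma> r. X \<sigma> r - Y \<sigma> r)"
  by (rule imp_binop[where opc = SUB]) (auto intro: runs_basic)

lemma imp_if_nz:
  assumes "imp X" "imp Y" "imp Z"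
  shows "imp (\<lambda>\<sigma> r. if X \<sigma> r \<noteq> 0 then Y \<sigma> r else Z \<sigma> r)" (is "imp ?F")
proof (rule imp_intro)
  fix \<rho> :: "nat \<Rightarrow> nat" and k :: nat
  assume k: "3 \<le> k" and \<rho>: "\<And>j. \<rho> j < k"
  obtain c1 T1 where 1: "evals c1 T1 k \<rho> X"
    by (rule imp_elim[OF assms(1) k, of \<rho>]) (use \<rho> in auto)
  obtain c2 T2 where 2: "evals c2 T2 k \<rho> Y"
    by (rule imp_elim[OF assms(2) k, of \<rho>]) (use \<rho> in auto)
  obtain c3 T3 where 3: "evals c3 T3 k \<rho> Z"
    by (rule imp_elim[OF assms(3) k, of \<rho>]) (use \<rho> in auto)
  show "\<exists>c T. evals c T k \<rho> ?F"
  proof (rule evals_intro)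
    show "poly_bounded (\<lambda>b. T1 b + (1 + (T2 b + T3 b)))"
      by (intro poly_bounded_intros evals_poly[OF 1] evals_poly[OF 2] evals_poly[OF 3])
    fix \<sigma> s m assume "rep \<sigma> (s, m)"
    then show "runs (SEQ c1 (COND k c2 c3)) (s, m) (T1 (cB \<sigma>) + (1 + (T2 (cB \<sigma>) + T3 (cB \<sigma>))))
       (yields s m k (?F \<sigma> (env s \<rho>)))"
    proof (rule evals_then[OF 1 _ k \<rho>])
      fix s1 assume r1: "rep \<sigma> (s1, m)" and s1: "s1 k = X \<sigma> (env s \<rho>)" "\<forall>j<k. s1 j = s j" "env s1 \<rho> = env s \<rho>"
      show "runs (COND k c2 c3) (s1, m) (1 + (T2 (cB \<sigma>) + T3 (cB \<sigma>))) (yields s m k (?F \<sigma> (env s \<rho>)))"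
        by (rule runs_cond; rule runs_mono, (rule evals_runs[OF 2 r1] | rule evals_runs[OF 3 r1]))
          (auto simp: s1)
    qed
  qed
qed

lemma imp_of_bool_neq0: "imp X \<Longrightarrow> imp (\<lambda>\<sigma> r. of_bool (X \<sigma> r \<noteq> 0))"
  using imp_if_nz[of X "\<lambda>_ _. 1" "\<lambda>_ _. 0"] imp_const
  by (simp add: of_bool_def)

lemma imp_cong:
  assumes "imp G" "\<And>\<sigma> r. F \<sigma> r = G \<sigma> r" shows "imp F"
proof -
  have "F = G" using assms(2) by (intro ext)
  with assms(1) show ?thesis by (simp only:)
qed

lemma imp_not: "imp (\<lambda>\<sigma> r. of_bool (P \<sigma> r)) \<Longrightarrow> imp (\<lambda>\<sigma> r. of_bool (\<not> P \<sigma> r))"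
  by (rule imp_cong[OF imp_diff[OF imp_const[of 1], of "\<lambda>\<sigma> r. of_bool (P \<sigma> r)"]]) simp_all

lemma imp_less: "imp X \<Longrightarrow> imp Y \<Longrightarrow> imp (\<lambda>\<sigma> r. of_bool (X \<sigma> r < Y \<sigma> r))"
  by (rule imp_cong[OF imp_of_bool_neq0[OF imp_diff[of Y X]]]) simp_all

lemma imp_le: "imp X \<Longrightarrow> imp Y \<Longrightarrow> imp (\<lambda>\<sigma> r. of_bool (X \<sigma> r \<le> Y \<sigma> r))"
  by (rule imp_cong[OF imp_not[OF imp_less[of Y X]]]) (simp_all add: not_less)

lemma imp_if:
  "imp (\<lambda>\<sigma> r. of_bool (P \<sigma> r)) \<Longrightarrow> imp Y \<Longrightarrow> imp Z \<Longrightarrow>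
    imp (\<lambda>\<sigma> r. if P \<sigma> r then Y \<sigma> r else Z \<sigma> r)"
  using imp_if_nz[of "\<lambda>\<sigma> r. of_bool (P \<sigma> r)" Y Z] by simp

lemma imp_and:
  assumes "imp (\<lambda>\<sigma> r. of_bool (P \<sigma> r))" "imp (\<lambda>\<sigma> r. of_bool (Q \<sigma> r))"
  shows "imp (\<lambda>\<sigma> r. of_bool (P \<sigma> r \<and> Q \<sigma> r))"
  by (rule imp_cong[OF imp_if[OF assms imp_const[of 0]]]) simp

lemma imp_or:
  assumes "imp (\<lambda>\<sigma> r. of_bool (P \<sigma> r))" "imp (\<lambda>\<sigma> r. of_bool (Q \<sigma> r))"
  shows "imp (\<lambda>\<sigma> r. of_bool (P \<sigma> r \<or> Q \<sigma> r))"
  by (rule imp_cong[OF imp_not[OF imp_and[OF imp_not[OF assms(1)] imp_not[OF assms(2)]]]]) simp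

lemma imp_imp:
  assumes "imp (\<lambda>\<sigma> r. of_bool (P \<sigma> r))" "imp (\<lambda>\<sigma> r. of_bool (Q \<sigma> r))"
  shows "imp (\<lambda>\<sigma> r. of_bool (P \<sigma> r \<longrightarrow> Q \<sigma> r))"
  by (rule imp_cong[OF imp_or[OF imp_not[OF assms(1)] assms(2)]]) simp

lemma imp_eq: "imp X \<Longrightarrow> imp Y \<Longrightarrow> imp (\<lambda>\<sigma> r. of_bool (X \<sigma> r = Y \<sigma> r))"
  by (rule imp_cong[OF imp_and[OF imp_le[of X Y] imp_le[of Y X]]]) auto

primrec loop :: "(nat \<Rightarrow> 'a \<Rightarrow> 'a) \<Rightarrow> 'a \<Rightarrow> nat \<Rightarrow> 'a" where
  "loop f a 0 = a"
| "loop f a (Suc n) = f n (loop f a n)"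

text \<open>Bound variables are put in front of the environment: variable 0 is the loop index and
  variable 1 the accumulator. Register \<open>k\<close> holds the accumulator, \<open>k+1\<close>
  the index, \<open>k+2\<close> the remaining rounds and \<open>k+3\<close> the constant 1; the body
  leaves its value in \<open>k+4\<close>.\<close>

lemma imp_loop:
  assumes "imp X" and "imp (\<lambda>\<sigma> r. F \<sigma> (\<lambda>j. r (Suc (Suc j))) (r 0) (r (Suc 0)))"
  shows "imp (\<lambda>\<sigma> r. loop (\<lambda>i a. F \<sigma> r i a) (X \<sigma> r) (cB \<sigma>))"
proof (rule imp_intro)
  fix \<rho> :: "nat \<Rightarrow> nat" and k :: nat
  assume k: "3 \<le> k" and \<rho>: "\<And>j. \<rho> j < k"
  obtain c1 T1 where 1: "evals c1 T1 k \<rho> X"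
    by (rule imp_elim[OF assms(1) k, of \<rho>]) (use \<rho> in auto)
  define \<rho>' where "\<rho>' j = (case j of 0 \<Rightarrow> k + 1 | Suc 0 \<Rightarrow> k | Suc (Suc j) \<Rightarrow> \<rho> j)" for j
  have \<rho>': "\<rho>' j < k + 4" for j
    unfolding \<rho>'_def using \<rho> by (auto split: nat.split intro: trans_less_add1)
  obtain c2 T2 where "evals c2 T2 (k + 4) \<rho>' (\<lambda>\<sigma> r. F \<sigma> (\<lambda>j. r (Suc (Suc j))) (r 0) (r (Suc 0)))"
    by (rule imp_elim[OF assms(2), of "k + 4" \<rho>']) (use k \<rho>' in auto)
  then have 2: "poly_bounded T2" "\<And>\<sigma> s m. rep \<sigma> (s, m) \<Longrightarrow> runs c2 (s, m) (T2 (cB \<sigma>))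
        (yields s m (k + 4) (F \<sigma> (env s \<rho>) (s (k + 1)) (s k)))"
    by (simp_all add: evals_def \<rho>'_def)
  define body where "body = SEQ c2 (SEQ (LIT k 0) (SEQ (ADD k k (k+4)) (SEQ (LIT (k+3) 1)
     (SEQ (ADD (k+1) (k+1) (k+3)) (SUB (k+2) (k+2) (k+3))))))"
  define prog where "prog = SEQ c1 (SEQ (LIT (k+1) 0) (SEQ (LIT (k+2) 0) (SEQ (ADD (k+2) (k+2) 2)
     (WHILE (k+2) body))))"
  show "\<exists>c T. evals c T k \<rho> (\<lambda>\<sigma> r. loop (\<lambda>i a. F \<sigma> r i a) (X \<sigma> r) (cB \<sigma>))"
  proof (rule evals_intro)
    show "poly_bounded (\<lambda>b. T1 b + Suc (Suc (Suc (b * (T2 b + 5 + 1) + 1))))"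
      by (intro poly_bounded_intros evals_poly[OF 1] 2)
    fix \<sigma> s m assume r: "rep \<sigma> (s, m)"
    define L where "L j = loop (\<lambda>i a. F \<sigma> (env s \<rho>) i a) (X \<sigma> (env s \<rho>)) j" for j
    define B where "B = cB \<sigma>"
    define I where "I j s' \<longleftrightarrow> snd s' = m \<and> (\<forall>j<k. fst s' j = s j) \<and> fst s' k = L j \<and>
      fst s' (k+1) = j \<and> fst s' (k+2) = B - j" for j s'
    have step: "fst s' (k+2) \<noteq> 0 \<and> runs body s' (T2 B + 5) (I (Suc j))" if jB: "j < B" and Ij: "I j s'" for j s'
    proof
      show "fst s' (k+2) \<noteq> 0" using jB Ij unfolding I_def by simp
      obtain s1 where s1: "s' = (s1, m)" using Ij by (cases s') (auto simp: I_def)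
      have i: "\<forall>j<k. s1 j = s j" "s1 k = L j" "s1 (k+1) = j" "s1 (k+2) = B - j"
        using Ij unfolding I_def s1 by auto
      have r1: "rep \<sigma> (s1, m)" using rep_regs[OF r k i(1)] .
      have eq: "env s1 \<rho> = env s \<rho>" using i(1) \<rho> by auto
      have "runs body s' (T2 B + Suc (Suc (Suc (Suc (Suc 0))))) (I (Suc j))"
        unfolding body_def s1(1)
      proof (rule runs_seq[OF 2(2)[OF r1, folded B_def]])
        fix s'' assume "yields s1 m (k + 4) (F \<sigma> (env s1 \<rho>) (s1 (k + 1)) (s1 k)) s''"
        then obtain s2 where s2: "s'' = (s2, m)" "s2 (k + 4) = L (Suc j)" "\<forall>j<k+4. s2 j = s1 j"
          unfolding L_def using eq i by (cases s'') (auto simp: L_def)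
        show "runs (SEQ (LIT k 0) (SEQ (ADD k k (k+4)) (SEQ (LIT (k+3) 1)
          (SEQ (ADD (k+1) (k+1) (k+3)) (SUB (k+2) (k+2) (k+3)))))) s''
          (Suc (Suc (Suc (Suc (Suc 0))))) (I (Suc j))"
          unfolding s2(1) by (intro runs_then runs_basic) (use s2 i in \<open>auto simp: I_def\<close>)
      qed
      then show "runs body s' (T2 B + 5) (I (Suc j))" by (rule runs_mono) auto
    qed
    show "runs prog (s, m) (T1 (cB \<sigma>) + Suc (Suc (Suc (cB \<sigma> * (T2 (cB \<sigma>) + 5 + 1) + 1))))
      (yields s m k (loop (\<lambda>i a. F \<sigma> (env s \<rho>) i a) (X \<sigma> (env s \<rho>)) (cB \<sigma>)))"
      unfolding prog_def B_def[symmetric] L_def[symmetric]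
    proof (rule evals_then[OF 1 r k \<rho>, folded B_def])
      fix s1 assume s1: "s1 k = X \<sigma> (env s \<rho>)" "\<forall>j<k. s1 j = s j"
      have b: "s1 2 = B" using r s1(2) k unfolding rep_def B_def by simp
      define s2 where "s2 = (s1(k+1 := 0, k+2 := 0))(k+2 := (s1(k+1 := 0, k+2 := 0)) (k+2) +
              (s1(k+1 := 0, k+2 := 0)) 2)"
      have i0: "I 0 (s2, m)" unfolding I_def using s1 b k by (auto simp: s2_def L_def)
      have w: "runs (WHILE (k+2) body) (s2, m) (B * (T2 B + 5 + 1) + 1) (I B)"
        using step i0 by (rule runs_while) (auto simp: I_def)
      show "runs (SEQ (LIT (k+1) 0) (SEQ (LIT (k+2) 0) (SEQ (ADD (k+2) (k+2) 2)
         (WHILE (k+2) body)))) (s1, m) (Suc (Suc (Suc (B * (T2 B + 5 + 1) + 1))))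
         (yields s m k (L B))"
      proof (intro runs_then)
        show "runs (WHILE (k+2) body) ((s1(k+1 := 0, k+2 := 0))(k+2 := (s1(k+1 := 0, k+2 := 0)) (k+2) +
              (s1(k+1 := 0, k+2 := 0)) 2), m) (B * (T2 B + 5 + 1) + 1)
            (yields s m k (L B))"
          by (rule runs_mono[OF w[unfolded s2_def]]) (auto simp: I_def split: prod.split)
      qed
    qed
  qed
qed

text \<open>Multiplication is iterated addition. As every loop has length \<open>cB\<close>, the
  first factor is cut off there; this is the origin of the minima in the definitions of the
  algorithm.\<close>

lemma imp_mult:
  assumes "imp X" "imp Y" shows "imp (\<lambda>\<sigma> r. min (X \<sigma> r) (cB \<sigma>) * Y \<sigma> r)"
proof -
  have *: "loop (\<lambda>i a. if i < x then a + y else a) 0 b = min x b * y" for x y b :: nat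
    by (induction b) (auto simp: min_def less_Suc_eq_le le_Suc_eq)
  have "imp (\<lambda>\<sigma> r. loop (\<lambda>i a. if i < X \<sigma> r then a + Y \<sigma> r else a) 0 (cB \<sigma>))"
    by (intro imp_loop imp_const imp_if imp_less imp_var imp_add
        imp_rename[OF assms(1), of "\<lambda>j. Suc (Suc j)"] imp_rename[OF assms(2), of "\<lambda>j. Suc (Suc j)"])
  then show ?thesis by (simp add: *)
qed

lemma imp_pow:
  assumes "imp X" "imp Y" shows "imp (\<lambda>\<sigma> r. min (X \<sigma> r) (cB \<sigma>) ^ min (Y \<sigma> r) (cB \<sigma>))"
proof -
  have *: "loop (\<lambda>i a. if i < y then x * a else a) 1 b = x ^ min y b" for x y b :: nat
    by (induction b) (auto simp: min_def less_Suc_eq_le le_Suc_eq)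
  \<comment> \<open>The accumulator is the second factor, the one that \<open>imp_mult\<close> does
    not cut off.\<close>
  have "imp (\<lambda>\<sigma> r. loop (\<lambda>i a. if i < Y \<sigma> r then min (X \<sigma> r) (cB \<sigma>) * a else a) 1 (cB \<sigma>))"
    by (intro imp_loop imp_const imp_if imp_less imp_var imp_mult
        imp_rename[OF assms(1), of "\<lambda>j. Suc (Suc j)"] imp_rename[OF assms(2), of "\<lambda>j. Suc (Suc j)"])
  then show ?thesis unfolding * .
qed

lemma imp_sum:
  assumes "imp (\<lambda>\<sigma> r. f \<sigma> (\<lambda>j. r (Suc j)) (r 0))"
  shows "imp (\<lambda>\<sigma> r. \<Sum>i<cB \<sigma>. f \<sigma> r i)"
proof -
  have *: "loop (\<lambda>i a. a + g i) 0 b = (\<Sum>i<b. g i)" for g :: "nat \<Rightarrow> nat" and b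
    by (induction b) auto
  have "imp (\<lambda>\<sigma> r. f \<sigma> (\<lambda>j. r (Suc (Suc j))) (r 0))"
    using imp_rename[OF assms, of "\<lambda>j. case j of 0 \<Rightarrow> 0 | Suc j \<Rightarrow> Suc (Suc j)"] by simp
  then have "imp (\<lambda>\<sigma> r. loop (\<lambda>i a. a + f \<sigma> r i) 0 (cB \<sigma>))"
    by (intro imp_loop imp_const imp_add imp_var)
  then show ?thesis by (simp add: *)
qed

lemma imp_card:
  assumes "imp (\<lambda>\<sigma> r. of_bool (P \<sigma> (\<lambda>j. r (Suc j)) (r 0)))"
  shows "imp (\<lambda>\<sigma> r. card {i. i < cB \<sigma> \<and> P \<sigma> r i})"
proof (rule imp_cong[OF imp_sum])
  show "imp (\<lambda>\<sigma> r. of_bool (P \<sigma> (\<lambda>j. r (Suc j)) (r 0)))" by fact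
  fix \<sigma> :: cfg and r :: "nat \<Rightarrow> nat"
  have "{i. i < cB \<sigma> \<and> P \<sigma> r i} = {..<cB \<sigma>} \<inter> {i. P \<sigma> r i}" by auto
  then show "card {i. i < cB \<sigma> \<and> P \<sigma> r i} = (\<Sum>i<cB \<sigma>. of_bool (P \<sigma> r i))" by simp
qed

lemma imp_ex:
  assumes "imp (\<lambda>\<sigma> r. of_bool (P \<sigma> (\<lambda>j. r (Suc j)) (r 0)))"
  shows "imp (\<lambda>\<sigma> r. of_bool (\<exists>i<cB \<sigma>. P \<sigma> r i))"
  by (rule imp_cong[OF imp_of_bool_neq0[OF imp_card[of P]]]) (use assms in auto)

lemma imp_all:
  assumes "imp (\<lambda>\<sigma> r. of_bool (P \<sigma> (\<lambda>j. r (Suc j)) (r 0)))"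
  shows "imp (\<lambda>\<sigma> r. of_bool (\<forall>i<cB \<sigma>. P \<sigma> r i))"
  by (rule imp_cong[OF imp_not[OF imp_ex[of "\<lambda>\<sigma> r i. \<not> P \<sigma> r i", OF imp_not[OF assms]]]]) auto

text \<open>\<open>rep\<close> describes only cells within the bounds, so the load is guarded and
  the value outside is 0. The address is computed in any case; only the access depends on the
  test.\<close>

lemma imp_memory:
  assumes "imp (\<lambda>\<sigma> r. of_bool (P \<sigma> r))" "imp A"
    and Z: "\<And>\<sigma> s m r. rep \<sigma> (s, m) \<Longrightarrow> P \<sigma> r \<Longrightarrow> m (A \<sigma> r) = Z \<sigma> r"
  shows "imp (\<lambda>\<sigma> r. if P \<sigma> r then Z \<sigma> r else 0)" (is "imp ?F")
proof (rule imp_intro)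
  fix \<rho> :: "nat \<Rightarrow> nat" and k :: nat
  assume k: "3 \<le> k" and \<rho>: "\<And>j. \<rho> j < k"
  obtain c1 T1 where 1: "evals c1 T1 k \<rho> A"
    by (rule imp_elim[OF assms(2) k, of \<rho>]) (use \<rho> in auto)
  obtain c2 T2 where 2: "evals c2 T2 (Suc k) \<rho> (\<lambda>\<sigma> r. of_bool (P \<sigma> r))"
    by (rule imp_elim[OF assms(1), of "Suc k" \<rho>]) (use k \<rho> in \<open>auto intro: less_SucI\<close>)
  show "\<exists>c T. evals c T k \<rho> ?F"
  proof (rule evals_intro)
    show "poly_bounded (\<lambda>b. T1 b + (T2 b + (1 + Suc 0)))"
      by (intro poly_bounded_intros evals_poly[OF 1] evals_poly[OF 2])
    fix \<sigma> s m assume r: "rep \<sigma> (s, m)"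
    show "runs (SEQ c1 (SEQ c2 (COND (Suc k) (LOAD k k) (LIT k 0)))) (s, m)
        (T1 (cB \<sigma>) + (T2 (cB \<sigma>) + (1 + Suc 0))) (yields s m k (?F \<sigma> (env s \<rho>)))"
    proof (rule evals_then[OF 1 r k \<rho>])
      fix s1 assume r1: "rep \<sigma> (s1, m)" and s1: "s1 k = A \<sigma> (env s \<rho>)" "\<forall>j<k. s1 j = s j" "env s1 \<rho> = env s \<rho>"
      show "runs (SEQ c2 (COND (Suc k) (LOAD k k) (LIT k 0))) (s1, m) (T2 (cB \<sigma>) + (1 + Suc 0))
          (yields s m k (?F \<sigma> (env s \<rho>)))"
      proof (rule evals_then[OF 2 r1])
        fix s2 assume s2: "s2 (Suc k) = of_bool (P \<sigma> (env s1 \<rho>))" "\<forall>j<Suc k. s2 j = s1 j"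
        show "runs (COND (Suc k) (LOAD k k) (LIT k 0)) (s2, m) (1 + Suc 0) (yields s m k (?F \<sigma> (env s \<rho>)))"
          by (rule runs_cond; rule runs_basic) (use s1 s2[unfolded s1(3)] Z[OF r] in auto)
      qed (use k \<rho> in \<open>auto intro: less_SucI\<close>)
    qed
  qed
qed

definition get :: "cfg \<Rightarrow> nat \<Rightarrow> nat \<Rightarrow> nat \<Rightarrow> nat" where
  "get \<sigma> k x y = (if x < cB \<sigma> \<and> y < cB \<sigma> then arr \<sigma> k x y else 0)"

definition input :: "cfg \<Rightarrow> nat \<Rightarrow> nat" where
  "input \<sigma> a = (if a < cB \<sigma> * cB \<sigma> then inp \<sigma> a else 0)"

lemma imp_mult_cB: "imp X \<Longrightarrow> imp (\<lambda>\<sigma> r. cB \<sigma> * X \<sigma> r)"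
  using imp_mult[OF imp_params(3)] by simp

lemma imp_adr: "imp X \<Longrightarrow> imp Y \<Longrightarrow> imp (\<lambda>\<sigma> r. adr (cB \<sigma>) k (X \<sigma> r) (Y \<sigma> r))"
  unfolding adr_def by (intro imp_add imp_mult_cB imp_const)

lemma imp_get: "imp X \<Longrightarrow> imp Y \<Longrightarrow> imp (\<lambda>\<sigma> r. get \<sigma> k (X \<sigma> r) (Y \<sigma> r))"
  unfolding get_def
  by (rule imp_memory[where A = "\<lambda>\<sigma> r. adr (cB \<sigma>) k (X \<sigma> r) (Y \<sigma> r)"])
    (auto simp: rep_def intro!: imp_and imp_less imp_params imp_adr)

lemma imp_input: "imp X \<Longrightarrow> imp (\<lambda>\<sigma> r. input \<sigma> (X \<sigma> r))"
  unfolding input_def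
  by (rule imp_memory[where A = X])
    (auto simp: rep_def intro!: imp_less imp_mult_cB imp_params)

section \<open>Programs that change the arrays\<close>

abbreviation (input) "reaches s k \<tau> \<equiv> \<lambda>(s', m'). rep \<tau> (s', m') \<and> (\<forall>j<k. s' j = s j)"

definition executes :: "com \<Rightarrow> (nat \<Rightarrow> nat) \<Rightarrow> nat \<Rightarrow> (nat \<Rightarrow> nat) \<Rightarrow> (cfg \<Rightarrow> (nat \<Rightarrow> nat) \<Rightarrow> cfg) \<Rightarrow> bool" where
  "executes c T k \<rho> f \<longleftrightarrow> poly_bounded T \<and>
     (\<forall>\<sigma> s m. rep \<sigma> (s, m) \<longrightarrow> runs c (s, m) (T (cB \<sigma>)) (reaches s k (f \<sigma> (env s \<rho>))))"

definition stm :: "(cfg \<Rightarrow> (nat \<Rightarrow> nat) \<Rightarrow> cfg) \<Rightarrow> bool" where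
  "stm f \<longleftrightarrow> (\<forall>\<rho> k. 3 \<le> k \<longrightarrow> (\<forall>j. \<rho> j < k) \<longrightarrow> (\<exists>c T. executes c T k \<rho> f))"

lemma stm_intro: "(\<And>\<rho> k. 3 \<le> k \<Longrightarrow> (\<And>j. \<rho> j < k) \<Longrightarrow> \<exists>c T. executes c T k \<rho> f) \<Longrightarrow> stm f"
  unfolding stm_def by blast

lemma stm_elim:
  assumes "stm f" "3 \<le> k" "\<And>j. \<rho> j < k"
  obtains c T where "executes c T k \<rho> f"
  using assms unfolding stm_def by meson

lemma executes_intro:
  assumes "\<And>\<sigma> s m. rep \<sigma> (s, m) \<Longrightarrow> runs c (s, m) (T (cB \<sigma>)) (reaches s k (f \<sigma> (env s \<rho>)))"
    and "poly_bounded T"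
  shows "\<exists>c T. executes c T k \<rho> f"
  using assms unfolding executes_def by blast

lemma executes_poly: "executes c T k \<rho> f \<Longrightarrow> poly_bounded T"
  by (simp add: executes_def)

lemma executes_runs:
  "executes c T k \<rho> f \<Longrightarrow> rep \<sigma> (s, m) \<Longrightarrow> runs c (s, m) (T (cB \<sigma>)) (reaches s k (f \<sigma> (env s \<rho>)))"
  by (simp add: executes_def)

lemma stm_seq:
  assumes "stm f" "stm g" shows "stm (\<lambda>\<sigma> r. g (f \<sigma> r) r)"
proof (rule stm_intro)
  fix \<rho> :: "nat \<Rightarrow> nat" and k :: nat
  assume k: "3 \<le> k" and \<rho>: "\<And>j. \<rho> j < k"
  obtain c1 T1 where 1: "executes c1 T1 k \<rho> f"
    by (rule stm_elim[OF assms(1) k, of \<rho>]) (use \<rho> in auto)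
  obtain c2 T2 where 2: "executes c2 T2 k \<rho> g"
    by (rule stm_elim[OF assms(2) k, of \<rho>]) (use \<rho> in auto)
  have "runs (SEQ c1 c2) (s, m) (T1 (cB \<sigma>) + T2 (cB \<sigma>))
      (reaches s k (g (f \<sigma> (env s \<rho>)) (env s \<rho>)))"
    if r: "rep \<sigma> (s, m)" for \<sigma> s m
  proof (rule runs_seq[OF executes_runs[OF 1 r]])
    fix s' assume "case s' of (s', m') \<Rightarrow> rep (f \<sigma> (env s \<rho>)) (s', m') \<and> (\<forall>j<k. s' j = s j)"
    then obtain s1 m1 where 3: "s' = (s1, m1)" "rep (f \<sigma> (env s \<rho>)) (s1, m1)" "\<forall>j<k. s1 j = s j"
      by (cases s') auto
    have eq: "env s1 \<rho> = env s \<rho>" using 3(3) \<rho> by auto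
    \<comment> \<open>Register 2 lies below \<open>k\<close> and is kept, so \<open>cB\<close> is
      unchanged and both time bounds are taken at the same argument.\<close>
    have "s1 2 = s 2" using 3(3) k by auto
    then have "cB (f \<sigma> (env s \<rho>)) = cB \<sigma>" using 3(2) r by (simp add: rep_def)
    then show "runs c2 s' (T2 (cB \<sigma>))
       (reaches s k (g (f \<sigma> (env s \<rho>)) (env s \<rho>)))"
      using executes_runs[OF 2 3(2)] unfolding eq 3(1) by (auto elim!: runs_mono simp: 3(3))
  qed
  then show "\<exists>c T. executes c T k \<rho> (\<lambda>\<sigma> r. g (f \<sigma> r) r)"
    by (rule executes_intro[where T = "\<lambda>b. T1 b + T2 b"])
      (assumption, intro poly_bounded_intros executes_poly[OF 1] executes_poly[OF 2])
qed

lemma stm_loop: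
  assumes "stm (\<lambda>\<sigma> r. f (r 0) \<sigma> (\<lambda>j. r (Suc j)))"
  shows "stm (\<lambda>\<sigma> r. loop (\<lambda>i \<sigma>'. f i \<sigma>' r) \<sigma> (cB \<sigma>))"
proof (rule stm_intro)
  fix \<rho> :: "nat \<Rightarrow> nat" and k :: nat
  assume k: "3 \<le> k" and \<rho>: "\<And>j. \<rho> j < k"
  define \<rho>' where "\<rho>' j = (case j of 0 \<Rightarrow> k | Suc j \<Rightarrow> \<rho> j)" for j
  have \<rho>': "\<rho>' j < k + 3" for j
    unfolding \<rho>'_def using \<rho> by (auto split: nat.split intro: trans_less_add1)
  obtain c2 T2 where "executes c2 T2 (k + 3) \<rho>' (\<lambda>\<sigma> r. f (r 0) \<sigma> (\<lambda>j. r (Suc j)))"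
    by (rule stm_elim[OF assms, of "k + 3" \<rho>']) (use k \<rho>' in auto)
  then have 2: "poly_bounded T2" "\<And>\<sigma> s m. rep \<sigma> (s, m) \<Longrightarrow> runs c2 (s, m) (T2 (cB \<sigma>))
        (reaches s (k+3) (f (s k) \<sigma> (env s \<rho>)))"
    by (simp_all add: executes_def \<rho>'_def)
  define body where "body = SEQ c2 (SEQ (LIT (k+2) 1) (SEQ (ADD k k (k+2)) (SUB (k+1) (k+1) (k+2))))"
  define prog where "prog = SEQ (LIT k 0) (SEQ (LIT (k+1) 0) (SEQ (ADD (k+1) (k+1) 2) (WHILE (k+1) body)))"
  have "runs prog (s, m) (Suc (Suc (Suc (cB \<sigma> * (T2 (cB \<sigma>) + 3 + 1) + 1))))
      (reaches s k (loop (\<lambda>i \<sigma>'. f i \<sigma>' (env s \<rho>)) \<sigma> (cB \<sigma>)))"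
    if r: "rep \<sigma> (s, m)" for \<sigma> s m
  proof -
    define L where "L j = loop (\<lambda>i \<sigma>'. f i \<sigma>' (env s \<rho>)) \<sigma> j" for j
    define B where "B = cB \<sigma>"
    have s2B: "s 2 = B" using r by (simp add: rep_def B_def)
    define I where "I j s' \<longleftrightarrow> rep (L j) s' \<and> (\<forall>j<k. fst s' j = s j) \<and>
      fst s' k = j \<and> fst s' (k+1) = B - j" for j s'
    have step: "fst s' (k+1) \<noteq> 0 \<and> runs body s' (T2 B + 3) (I (Suc j))" if jB: "j < B" and Ij: "I j s'" for j s'
    proof
      show "fst s' (k+1) \<noteq> 0" using jB Ij unfolding I_def by simp
      obtain s1 m1 where s1: "s' = (s1, m1)" by (cases s')
      have i: "\<forall>j<k. s1 j = s j" "s1 k = j" "s1 (k+1) = B - j" "rep (L j) (s1, m1)"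
        using Ij unfolding I_def s1 by auto
      have eq: "env s1 \<rho> = env s \<rho>" using i(1) \<rho> by auto
      have "s1 2 = s 2" using i(1) k by auto
      then have cB: "cB (L j) = B" using i(4) s2B by (simp add: rep_def)
      have "runs body s' (T2 B + Suc (Suc (Suc 0))) (I (Suc j))"
        unfolding body_def s1
      proof (rule runs_seq[OF 2(2)[OF i(4), unfolded cB]])
        fix s'' assume "case s'' of (s', m') \<Rightarrow>
          rep (f (s1 k) (L j) (env s1 \<rho>)) (s', m') \<and> (\<forall>j<k+3. s' j = s1 j)"
        then obtain s2 m2 where s2: "s'' = (s2, m2)" "rep (L (Suc j)) (s2, m2)" "\<forall>j<k+3. s2 j = s1 j"
          unfolding L_def using eq i by (cases s'') (auto simp: L_def)
        define s3 where "s3 = s2(k+2 := 1, k := Suc j, k + 1 := B - Suc j)"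
        have "rep (L (Suc j)) (s3, m2)"
          using s2(2) k by (rule rep_regs) (auto simp: s3_def)
        then have I: "I (Suc j) (s3, m2)" unfolding I_def using s2 i by (auto simp: s3_def)
        have s3: "s3 = (s2(k+2 := 1, k := (s2(k+2 := 1)) k + (s2(k+2 := 1)) (k + 2)))
          (k + 1 := (s2(k+2 := 1, k := (s2(k+2 := 1)) k + (s2(k+2 := 1)) (k + 2))) (k + 1) -
            (s2(k+2 := 1, k := (s2(k+2 := 1)) k + (s2(k+2 := 1)) (k + 2))) (k + 2))"
          unfolding s3_def using s2(3) i by auto
        show "runs (SEQ (LIT (k+2) 1) (SEQ (ADD k k (k+2)) (SUB (k+1) (k+1) (k+2)))) s''
          (Suc (Suc (Suc 0))) (I (Suc j))"
          unfolding s2(1) by (intro runs_then runs_basic) (use I in \<open>simp only: s3\<close>)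
      qed
      then show "runs body s' (T2 B + 3) (I (Suc j))" by (rule runs_mono) auto
    qed
    define s2 where "s2 = (s(k := 0, k+1 := 0))(k+1 := (s(k := 0, k+1 := 0)) (k+1) + (s(k := 0, k+1 := 0)) 2)"
    have "rep \<sigma> (s2, m)" using r k by (rule rep_regs) (auto simp: s2_def)
    then have i0: "I 0 (s2, m)" unfolding I_def using s2B k by (auto simp: s2_def L_def)
    have w: "runs (WHILE (k+1) body) (s2, m) (B * (T2 B + 3 + 1) + 1) (I B)"
      using step i0 by (rule runs_while) (auto simp: I_def)
    show ?thesis
      unfolding prog_def B_def[symmetric] L_def[symmetric]
      by (intro runs_then runs_mono[OF w[unfolded s2_def]]) (auto simp: I_def)
  qed
  then show "\<exists>c T. executes c T k \<rho> (\<lambda>\<sigma> r. loop (\<lambda>i \<sigma>'. f i \<sigma>' r) \<sigma> (cB \<sigma>))"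
    by (rule executes_intro[where T = "\<lambda>b. Suc (Suc (Suc (b * (T2 b + 3 + 1) + 1)))"])
      (assumption, intro poly_bounded_intros 2(1))
qed

text \<open>A state can represent several configurations: entries of \<open>arr\<close> with an
  index from \<open>cB\<close> on are stored nowhere. The rule replaces a configuration by another
  one that differs only there.\<close>

lemma stm_weaken:
  assumes f: "stm f" and g: "\<And>\<sigma> r s m. rep (f \<sigma> r) (s, m) \<Longrightarrow> rep (g \<sigma> r) (s, m)"
  shows "stm g"
proof (rule stm_intro)
  fix \<rho> :: "nat \<Rightarrow> nat" and k :: nat
  assume k: "3 \<le> k" and \<rho>: "\<And>j. \<rho> j < k"
  obtain c T where 1: "executes c T k \<rho> f"
    by (rule stm_elim[OF f k, of \<rho>]) (use \<rho> in auto)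
  have "runs c (s, m) (T (cB \<sigma>)) (reaches s k (g \<sigma> (env s \<rho>)))" if "rep \<sigma> (s, m)" for \<sigma> s m
    by (rule runs_mono[OF executes_runs[OF 1 that]]) (auto intro: g)
  then show "\<exists>c T. executes c T k \<rho> g" by (rule executes_intro[where T = T]) (assumption, rule executes_poly[OF 1])
qed

lemma stm_skip: "stm (\<lambda>\<sigma> r. \<sigma>)"
proof (rule stm_intro)
  fix \<rho> :: "nat \<Rightarrow> nat" and k :: nat
  have *: "runs SKIP s (Suc 0) (\<lambda>s'. s' = s)" for s
    unfolding runs_def by (metis One_nat_def exec.skip order_refl)
  have "runs SKIP (s, m) (Suc 0) (reaches s k \<sigma>)" if "rep \<sigma> (s, m)" for \<sigma> s m
    using that by (intro runs_mono[OF *]) auto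
  then show "\<exists>c T. executes c T k \<rho> (\<lambda>\<sigma> r. \<sigma>)" by (rule executes_intro[where T = "\<lambda>_. Suc 0"]) (assumption, rule poly_bounded_const)
qed

definition upd :: "cfg \<Rightarrow> nat \<Rightarrow> (nat \<Rightarrow> nat \<Rightarrow> nat) \<Rightarrow> cfg" where
  "upd \<sigma> k h = \<sigma>\<lparr>arr := (arr \<sigma>)(k := h)\<rparr>"

lemma upd_simps [simp]:
  "cd (upd \<sigma> k h) = cd \<sigma>" "cn (upd \<sigma> k h) = cn \<sigma>" "cB (upd \<sigma> k h) = cB \<sigma>"
  "inp (upd \<sigma> k h) = inp \<sigma>" "input (upd \<sigma> k h) = input \<sigma>"
  "arr (upd \<sigma> k h) k = h" "k' \<noteq> k \<Longrightarrow> arr (upd \<sigma> k h) k' = arr \<sigma> k'"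
  "k' \<noteq> k \<Longrightarrow> get (upd \<sigma> k h) k' = get \<sigma> k'"
  "upd (upd \<sigma> k h) k h' = upd \<sigma> k h'" "upd \<sigma> k (arr \<sigma> k) = \<sigma>"
  "x < cB \<sigma> \<Longrightarrow> y < cB \<sigma> \<Longrightarrow> get (upd \<sigma> k h) k x y = h x y"
  unfolding upd_def get_def input_def by (auto simp: fun_eq_iff)

lemma rep_upd:
  "rep (upd \<sigma> k h) (s, m) \<longleftrightarrow> s 0 = cd \<sigma> \<and> s 1 = cn \<sigma> \<and> s 2 = cB \<sigma> \<and>
     (\<forall>a < cB \<sigma> * cB \<sigma>. m a = inp \<sigma> a) \<and>
     (\<forall>k'. \<forall>x < cB \<sigma>. \<forall>y < cB \<sigma>. m (adr (cB \<sigma>) k' x y) = (if k' = k then h x y else arr \<sigma> k' x y))"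
  unfolding rep_def upd_def by auto

lemma stm_store:
  assumes "imp X" "imp Y" "imp Z"
  shows "stm (\<lambda>\<sigma> r. if X \<sigma> r < cB \<sigma> \<and> Y \<sigma> r < cB \<sigma>
    then upd \<sigma> k\<^sub>0 ((arr \<sigma> k\<^sub>0)(X \<sigma> r := (arr \<sigma> k\<^sub>0 (X \<sigma> r))(Y \<sigma> r := Z \<sigma> r))) else \<sigma>)" (is "stm ?f")
proof (rule stm_intro)
  fix \<rho> :: "nat \<Rightarrow> nat" and k :: nat
  assume k: "3 \<le> k" and \<rho>: "\<And>j. \<rho> j < k"
  define A where "A \<sigma> r = adr (cB \<sigma>) k\<^sub>0 (X \<sigma> r) (Y \<sigma> r)" for \<sigma> r
  define P where "P \<sigma> r \<longleftrightarrow> X \<sigma> r < cB \<sigma> \<and> Y \<sigma> r < cB \<sigma>" for \<sigma> r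
  have A: "imp A" and P: "imp (\<lambda>\<sigma> r. of_bool (P \<sigma> r))"
    unfolding A_def P_def by (intro imp_adr imp_and imp_less imp_params assms)+
  have \<rho>': "3 \<le> Suc k" "\<rho> j < Suc k" "3 \<le> Suc (Suc k)" "\<rho> j < Suc (Suc k)" for j
    using k \<rho> by (auto intro: less_SucI)
  obtain c1 T1 where 1: "evals c1 T1 k \<rho> Z"
    by (rule imp_elim[OF assms(3) k, of \<rho>]) (use \<rho> in auto)
  obtain c2 T2 where 2: "evals c2 T2 (Suc k) \<rho> A"
    by (rule imp_elim[OF A \<rho>'(1), of \<rho>]) (use \<rho>' in auto)
  obtain c3 T3 where 3: "evals c3 T3 (Suc (Suc k)) \<rho> (\<lambda>\<sigma> r. of_bool (P \<sigma> r))"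
    by (rule imp_elim[OF P \<rho>'(3), of \<rho>]) (use \<rho>' in auto)
  have "runs (SEQ c1 (SEQ c2 (SEQ c3 (COND (Suc (Suc k)) (STORE (Suc k) k) (LIT k 0))))) (s, m)
      (T1 (cB \<sigma>) + (T2 (cB \<sigma>) + (T3 (cB \<sigma>) + (1 + Suc 0)))) (reaches s k (?f \<sigma> (env s \<rho>)))"
    if r: "rep \<sigma> (s, m)" for \<sigma> s m
  proof (rule evals_then[OF 1 r k \<rho>], rule evals_then[OF 2 _ \<rho>'(1,2)], assumption,
      rule evals_then[OF 3 _ \<rho>'(3,4)], assumption)
    fix s1 s2 s3 :: "nat \<Rightarrow> nat"
    assume s1: "s1 k = Z \<sigma> (env s \<rho>)" "\<forall>j<k. s1 j = s j" "env s1 \<rho> = env s \<rho>"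
      and s2: "s2 (Suc k) = A \<sigma> (env s1 \<rho>)" "\<forall>j<Suc k. s2 j = s1 j" "env s2 \<rho> = env s1 \<rho>"
      and r3: "rep \<sigma> (s3, m)"
      and s3: "s3 (Suc (Suc k)) = of_bool (P \<sigma> (env s2 \<rho>))" "\<forall>j<Suc (Suc k). s3 j = s2 j"
    have s3k: "s3 k = Z \<sigma> (env s \<rho>)" "s3 (Suc k) = A \<sigma> (env s \<rho>)" "\<forall>j<k. s3 j = s j"
      "s3 (Suc (Suc k)) = of_bool (P \<sigma> (env s \<rho>))"
      using s1(1,2) s2(1,2) s3 unfolding s2(3) s1(3) by auto
    show "runs (COND (Suc (Suc k)) (STORE (Suc k) k) (LIT k 0)) (s3, m) (1 + Suc 0)
      (reaches s k (?f \<sigma> (env s \<rho>)))"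
    proof (rule runs_cond; rule runs_basic)
      assume "fst (s3, m) (Suc (Suc k)) \<noteq> 0"
      then have p: "P \<sigma> (env s \<rho>)" using s3k(4) by (cases "P \<sigma> (env s \<rho>)") auto
      \<comment> \<open>All array cells lie behind the raw input, so the write leaves the input
        intact.\<close>
      have "a \<noteq> A \<sigma> (env s \<rho>)" if "a < cB \<sigma> * cB \<sigma>" for a
        using that adr_ge[of "cB \<sigma>"] by (auto simp: A_def dest: leD)
      with p show "reaches s k (?f \<sigma> (env s \<rho>)) (s3, m(s3 (Suc k) := s3 k))"
        using r3[unfolded rep_def] s3k(1-3) by (auto simp: rep_upd P_def A_def adr_inj)
    next
      assume "fst (s3, m) (Suc (Suc k)) = 0"
      then have p: "\<not> P \<sigma> (env s \<rho>)" using s3k(4) by (cases "P \<sigma> (env s \<rho>)") auto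
      have "rep \<sigma> (s3(k := 0), m)" using k by (intro rep_regs[OF r3]) auto
      with p show "reaches s k (?f \<sigma> (env s \<rho>)) (s3(k := 0), m)"
        using s3k(3) by (auto simp: P_def)
    qed
  qed
  then show "\<exists>c T. executes c T k \<rho> ?f"
    by (rule executes_intro[where T = "\<lambda>b. T1 b + (T2 b + (T3 b + (1 + Suc 0)))"])
      (assumption, intro poly_bounded_intros evals_poly[OF 1] evals_poly[OF 2] evals_poly[OF 3])
qed

text \<open>
  The loop writes the array cell by cell; since \<open>e\<close> does not read the array, the effect is
  a simultaneous assignment.
\<close>

lemma stm_fill:
  assumes e: "imp (\<lambda>\<sigma> r. e \<sigma> (\<lambda>j. r (Suc (Suc j))) (r (Suc 0)) (r 0))"
    and indep: "\<And>\<sigma> h r x y. e (upd \<sigma> k\<^sub>0 h) r x y = e \<sigma> r x y"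
  shows "stm (\<lambda>\<sigma> r. upd \<sigma> k\<^sub>0 (e \<sigma> r))"
proof -
  define st where "st x y \<sigma> r = (if x < cB \<sigma> \<and> y < cB \<sigma>
    then upd \<sigma> k\<^sub>0 ((arr \<sigma> k\<^sub>0)(x := (arr \<sigma> k\<^sub>0 x)(y := e \<sigma> r x y))) else \<sigma>)" for x y \<sigma> r
  have "stm (\<lambda>\<sigma> r. st (r (Suc 0)) (r 0) \<sigma> (\<lambda>j. r (Suc (Suc j))))"
    unfolding st_def by (intro stm_store imp_var e)
  then have "stm (\<lambda>\<sigma> r. loop (\<lambda>y \<sigma>'. st (r 0) y \<sigma>' (\<lambda>j. r (Suc j))) \<sigma> (cB \<sigma>))"
    by (intro stm_loop)
  then have loops: "stm (\<lambda>\<sigma> r. loop (\<lambda>x \<sigma>'. loop (\<lambda>y \<sigma>''. st x y \<sigma>'' r) \<sigma>' (cB \<sigma>')) \<sigma> (cB \<sigma>))"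
    by (rule stm_loop)
  have inner: "loop (\<lambda>y \<sigma>''. st x y \<sigma>'' r) (upd \<sigma> k\<^sub>0 h) b =
      upd \<sigma> k\<^sub>0 (h(x := (\<lambda>y. if y < b then e \<sigma> r x y else h x y)))"
    if "x < cB \<sigma>" "b \<le> cB \<sigma>" for x b h \<sigma> r
    using that(2)
  proof (induction b)
    case (Suc b)
    then show ?case using that(1)
      by (auto simp: st_def indep fun_eq_iff less_Suc_eq intro!: arg_cong[where f = "upd \<sigma> k\<^sub>0"])
  qed simp
  have outer: "loop (\<lambda>x \<sigma>'. loop (\<lambda>y \<sigma>''. st x y \<sigma>'' r) \<sigma>' (cB \<sigma>')) \<sigma> b =
      upd \<sigma> k\<^sub>0 (\<lambda>x y. if x < b \<and> y < cB \<sigma> then e \<sigma> r x y else arr \<sigma> k\<^sub>0 x y)"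
    if "b \<le> cB \<sigma>" for b \<sigma> r
    using that
  proof (induction b)
    case (Suc b)
    then show ?case
      by (auto simp: inner less_Suc_eq fun_eq_iff intro!: arg_cong[where f = "upd \<sigma> k\<^sub>0"])
  qed simp
  have "rep (upd \<sigma> k\<^sub>0 (e \<sigma> r)) (s, m)"
    if "rep (loop (\<lambda>x \<sigma>'. loop (\<lambda>y \<sigma>''. st x y \<sigma>'' r) \<sigma>' (cB \<sigma>')) \<sigma> (cB \<sigma>)) (s, m)" for \<sigma> r s m
    using that by (simp add: outer rep_upd)
  with loops show ?thesis by (rule stm_weaken)
qed

section \<open>The loop bound and complete programs\<close>

text \<open>The tower stands for any bound on \<open>d ^ d\<close>, the number of ways to match the rays, that the
  machine can compute by repeated doubling.\<close>

definition bnd :: "nat \<Rightarrow> nat \<Rightarrow> nat" where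
  "bnd d n = n + n + 2 ^ 4 ^ (d + 1)"

text \<open>Register 4 is doubled twice in each of \<open>d + 1\<close> rounds and then counts the
  doublings of register 6. The number of steps is of the order of \<open>4 ^ (d + 1)\<close>, which
  the computed bound exceeds, so this prologue costs only time linear in its own result.\<close>

definition set_bnd :: com where
  "set_bnd = SEQ (LIT 3 1) (SEQ (LIT 4 1) (SEQ (ADD 5 0 3)
    (SEQ (WHILE 5 (SEQ (ADD 4 4 4) (SEQ (ADD 4 4 4) (SUB 5 5 3))))
    (SEQ (LIT 6 1)
    (SEQ (WHILE 4 (SEQ (ADD 6 6 6) (SUB 4 4 3)))
    (SEQ (ADD 2 1 1) (ADD 2 2 6)))))))"

lemma runs_set_bnd:
  "runs set_bnd (r, m) (20 * (bnd (r 0) (r 1) + 1))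
    (\<lambda>(r', m'). m' = m \<and> r' 0 = r 0 \<and> r' 1 = r 1 \<and> r' 2 = bnd (r 0) (r 1))"
proof -
  define D where "D = r 0 + 1"
  define I where "I j s \<longleftrightarrow> snd s = m \<and> fst s 0 = r 0 \<and> fst s 1 = r 1 \<and> fst s 3 = 1 \<and>
    fst s 4 = 4 ^ j \<and> fst s 5 = D - j" for j and s :: state
  define J where "J j s \<longleftrightarrow> snd s = m \<and> fst s 0 = r 0 \<and> fst s 1 = r 1 \<and> fst s 3 = 1 \<and>
    fst s 4 = 4 ^ D - j \<and> fst s 6 = 2 ^ j" for j and s :: state
  have w1: "runs (WHILE 5 (SEQ (ADD 4 4 4) (SEQ (ADD 4 4 4) (SUB 5 5 3)))) s
    (D * (Suc (Suc (Suc 0)) + 1) + 1) (I D)" if "I 0 s" for s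
  proof (rule runs_while[where I = I])
    fix j s assume "j < D" "I j s"
    then show "fst s 5 \<noteq> 0 \<and> runs (SEQ (ADD 4 4 4) (SEQ (ADD 4 4 4) (SUB 5 5 3))) s
      (Suc (Suc (Suc 0))) (I (Suc j))"
      by (cases s) (auto simp: I_def intro!: runs_then runs_basic)
  qed (use that in \<open>simp_all add: I_def\<close>)
  have w2: "runs (WHILE 4 (SEQ (ADD 6 6 6) (SUB 4 4 3))) s
    (4 ^ D * (Suc (Suc 0) + 1) + 1) (J (4 ^ D))" if "J 0 s" for s
  proof (rule runs_while[where I = J])
    fix j s assume "j < 4 ^ D" "J j s"
    then show "fst s 4 \<noteq> 0 \<and> runs (SEQ (ADD 6 6 6) (SUB 4 4 3)) s (Suc (Suc 0)) (J (Suc j))"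
      by (cases s) (auto simp: J_def intro!: runs_then runs_basic)
  qed (use that in \<open>simp_all add: J_def\<close>)
  have "runs set_bnd (r, m) (Suc (Suc (Suc ((D * (Suc (Suc (Suc 0)) + 1) + 1) +
      Suc ((4 ^ D * (Suc (Suc 0) + 1) + 1) + Suc (Suc 0))))))
    (\<lambda>(r', m'). m' = m \<and> r' 0 = r 0 \<and> r' 1 = r 1 \<and> r' 2 = bnd (r 0) (r 1))"
    unfolding set_bnd_def
  proof (intro runs_then, rule runs_seq[OF w1])
    show "I 0 (r(3 := 1, 4 := 1, 5 := (r(3 := 1, 4 := 1)) 0 + (r(3 := 1, 4 := 1)) 3), m)"
      by (simp add: I_def D_def)
    fix s assume i: "I D s"
    obtain s1 where s1: "s = (s1, m)" using i by (cases s) (auto simp: I_def)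
    show "runs (SEQ (LIT 6 1) (SEQ (WHILE 4 (SEQ (ADD 6 6 6) (SUB 4 4 3))) (SEQ (ADD 2 1 1) (ADD 2 2 6)))) s
      (Suc ((4 ^ D * (Suc (Suc 0) + 1) + 1) + Suc (Suc 0)))
      (\<lambda>(r', m'). m' = m \<and> r' 0 = r 0 \<and> r' 1 = r 1 \<and> r' 2 = bnd (r 0) (r 1))"
      unfolding s1
    proof (intro runs_then, rule runs_seq[OF w2])
      show "J 0 (s1(6 := 1), m)" using i by (simp add: I_def J_def s1)
      fix s assume j: "J (4 ^ D) s"
      obtain s2 where s2: "s = (s2, m)" using j by (cases s) (auto simp: J_def)
      show "runs (SEQ (ADD 2 1 1) (ADD 2 2 6)) s (Suc (Suc 0))
        (\<lambda>(r', m'). m' = m \<and> r' 0 = r 0 \<and> r' 1 = r 1 \<and> r' 2 = bnd (r 0) (r 1))"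
        unfolding s2 by (intro runs_then runs_basic) (use j in \<open>simp add: J_def s2 bnd_def D_def\<close>)
    qed
  qed
  moreover have "D < 4 ^ D" "(4::nat) ^ D < 2 ^ 4 ^ D"
    using less_exp[of "4 ^ D"] less_exp[of D] power_mono[of 2 "4::nat" D] by linarith+
  then have "D \<le> bnd (r 0) (r 1)" "4 ^ D \<le> bnd (r 0) (r 1)" unfolding bnd_def D_def by linarith+
  ultimately show ?thesis by (elim runs_mono) simp_all
qed

definition start :: "state \<Rightarrow> cfg" where
  "start = (\<lambda>(r, m). \<lparr>cd = r 0, cn = r 1, cB = bnd (r 0) (r 1), inp = m,
     arr = \<lambda>k x y. m (adr (bnd (r 0) (r 1)) k x y)\<rparr>)"

lemma runs_imp:
  assumes "stm f" "imp F"
  shows "\<exists>c K q. \<forall>r m. runs c (r, m) (K * (bnd (r 0) (r 1) + 1) ^ q)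
    (\<lambda>s'. fst s' 0 = F (f (start (r, m)) (\<lambda>_. r 0)) (\<lambda>_. r 0))"
proof -
  obtain c1 T1 where 1: "executes c1 T1 3 (\<lambda>_. 0) f" by (rule stm_elim[OF assms(1), of 3 "\<lambda>_. 0"]) auto
  obtain c2 T2 where 2: "evals c2 T2 3 (\<lambda>_. 0) F" by (rule imp_elim[OF assms(2), of 3 "\<lambda>_. 0"]) auto
  define c where "c = SEQ set_bnd (SEQ c1 (SEQ c2 (SEQ (LIT 0 0) (ADD 0 0 3))))"
  define T where "T b = 20 * (b + 1) + (T1 b + (T2 b + Suc (Suc 0)))" for b
  have "poly_bounded T" unfolding T_def by (intro poly_bounded_intros executes_poly[OF 1] evals_poly[OF 2])
  then obtain K q where T: "\<And>b. T b \<le> K * (b + 1) ^ q" unfolding poly_bounded_def by blast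
  have "runs c (r, m) (T (bnd (r 0) (r 1))) (\<lambda>s'. fst s' 0 = F (f (start (r, m)) (\<lambda>_. r 0)) (\<lambda>_. r 0))"
    for r m
    unfolding c_def T_def
  proof (rule runs_seq[OF runs_set_bnd])
    let ?\<sigma> = "start (r, m)" and ?B = "bnd (r 0) (r 1)"
    fix s :: state assume "case s of (r', m') \<Rightarrow> m' = m \<and> r' 0 = r 0 \<and> r' 1 = r 1 \<and> r' 2 = bnd (r 0) (r 1)"
    then obtain s1 where s1: "s = (s1, m)" "s1 0 = r 0" "rep ?\<sigma> (s1, m)"
      by (cases s) (auto simp: rep_def start_def)
    have B: "cB ?\<sigma> = ?B" by (simp add: start_def)
    show "runs (SEQ c1 (SEQ c2 (SEQ (LIT 0 0) (ADD 0 0 3)))) s (T1 ?B + (T2 ?B + Suc (Suc 0)))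
      (\<lambda>s'. fst s' 0 = F (f ?\<sigma> (\<lambda>_. r 0)) (\<lambda>_. r 0))"
      unfolding s1(1)
    proof (rule runs_seq[OF executes_runs[OF 1 s1(3), unfolded B]])
      fix s' assume "case s' of (s', m') \<Rightarrow> rep (f ?\<sigma> (\<lambda>j. s1 0)) (s', m') \<and> (\<forall>j<3. s' j = s1 j)"
      then obtain s2 m2 where s2: "s' = (s2, m2)" "rep (f ?\<sigma> (\<lambda>j. r 0)) (s2, m2)" "s2 0 = r 0"
        "s2 2 = s1 2"
        using s1(2) by (cases s') auto
      have B2: "cB (f ?\<sigma> (\<lambda>j. r 0)) = ?B" using s1(3) s2(2,4) B by (simp add: rep_def)
      show "runs (SEQ c2 (SEQ (LIT 0 0) (ADD 0 0 3))) s' (T2 ?B + Suc (Suc 0))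
        (\<lambda>s'. fst s' 0 = F (f ?\<sigma> (\<lambda>_. r 0)) (\<lambda>_. r 0))"
        unfolding s2(1)
      proof (rule evals_then[OF 2 s2(2), unfolded B2])
        fix s3 :: "nat \<Rightarrow> nat" assume "s3 3 = F (f ?\<sigma> (\<lambda>_. r 0)) (\<lambda>j. s2 0)"
        then show "runs (SEQ (LIT 0 0) (ADD 0 0 3)) (s3, m2) (Suc (Suc 0))
          (\<lambda>s'. fst s' 0 = F (f ?\<sigma> (\<lambda>_. r 0)) (\<lambda>_. r 0))"
          using s2(3) by (intro runs_then runs_basic) simp
      qed simp_all
    qed
  qed
  then have "runs c (r, m) (K * (bnd (r 0) (r 1) + 1) ^ q)
      (\<lambda>s'. fst s' 0 = F (f (start (r, m)) (\<lambda>_. r 0)) (\<lambda>_. r 0))" for r m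
    using T by (blast intro: runs_mono)
  then show ?thesis by blast
qed

text \<open>The dependence on the parameter must itself be computed by a machine. The prologue with
  register 1 equal to 0 supplies \<open>bnd d 0\<close>. Since \<open>K\<close> and \<open>q\<close>
  are fixed numbers, product and power are unrolled by induction outside the machine.\<close>

lemma computable_bnd_power: "computable (\<lambda>d. K * (bnd d 0 + 3) ^ q)"
proof -
  have 1: "imp (\<lambda>\<sigma> r. (cB \<sigma> + 3) ^ q)" for q
  proof (induction q)
    case (Suc q)
    have "imp (\<lambda>\<sigma> r. cB \<sigma> * (cB \<sigma> + 3) ^ q + ((cB \<sigma> + 3) ^ q + ((cB \<sigma> + 3) ^ q + (cB \<sigma> + 3) ^ q)))"
      by (intro imp_add imp_mult_cB Suc)
    then show ?case by (rule imp_cong) (simp add: algebra_simps)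
  qed (simp add: imp_const)
  have "imp (\<lambda>\<sigma> r. K * (cB \<sigma> + 3) ^ q)"
  proof (induction K)
    case (Suc K)
    then show ?case using imp_add[OF 1[of q]] by simp
  qed (simp add: imp_const)
  then obtain c K' q' where c: "\<And>r m. runs c (r, m) (K' * (bnd (r 0) (r 1) + 1) ^ q')
    (\<lambda>s'. fst s' 0 = K * (cB (start (r, m)) + 3) ^ q)"
    using runs_imp[OF stm_skip, of "\<lambda>\<sigma> r. K * (cB \<sigma> + 3) ^ q"] by blast
  from c[of "(\<lambda>_. 0)(0 := d)" "\<lambda>_. 0" for d] show ?thesis
    unfolding computable_def runs_def by (fastforce simp: start_def)
qed

lemma decides_within_imp:
  assumes "stm f" "imp (\<lambda>\<sigma> r. of_bool (P \<sigma> r))"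
  obtains c F q where "computable F" "\<And>r m. decides_within c (r, m) (F (r 0) * max 1 (r 1) ^ q)
    (P (f (start (r, m)) (\<lambda>_. r 0)) (\<lambda>_. r 0))"
proof -
  obtain c K q where c: "\<And>r m. runs c (r, m) (K * (bnd (r 0) (r 1) + 1) ^ q)
    (\<lambda>s'. fst s' 0 = of_bool (P (f (start (r, m)) (\<lambda>_. r 0)) (\<lambda>_. r 0)))"
    using runs_imp[OF assms] by blast
  have bound: "K * (bnd d n + 1) ^ q \<le> K * (bnd d 0 + 3) ^ q * max 1 n ^ q" for d n
  proof -
    have "n \<le> max 1 n" "1 \<le> max 1 n" by simp_all
    moreover have "bnd d 0 * 1 \<le> bnd d 0 * max 1 n" by (rule mult_left_mono) simp_all
    \<comment> \<open>The summand 3 comes from \<open>2 * n + 1 \<le> 3 * max 1 n\<close>.\<close>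
    ultimately have "bnd d n + 1 \<le> (bnd d 0 + 3) * max 1 n"
      unfolding bnd_def distrib_right by linarith
    then have "(bnd d n + 1) ^ q \<le> ((bnd d 0 + 3) * max 1 n) ^ q" by (rule power_mono) simp
    then show ?thesis by (simp add: power_mult_distrib)
  qed
  have "decides_within c (r, m) (K * (bnd (r 0) 0 + 3) ^ q * max 1 (r 1) ^ q)
      (P (f (start (r, m)) (\<lambda>_. r 0)) (\<lambda>_. r 0))" for r m
    using c[of r m] bound[of "r 0" "r 1"] unfolding decides_within_def runs_def of_bool_def
    by (meson le_trans)
  with computable_bnd_power show ?thesis by (rule that)
qed

section \<open>The algorithm\<close>

text \<open>Search as counting: the indices before the first hit are counted, so that the program is
  an instance of \<open>imp_card\<close>. Without a hit below \<open>B\<close> the value is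
  \<open>B\<close>.\<close>

definition least :: "nat \<Rightarrow> (nat \<Rightarrow> bool) \<Rightarrow> nat" where
  "least B P = card {x. x < B \<and> (\<forall>y<B. y \<le> x \<longrightarrow> \<not> P y)}"

lemma least_eq:
  assumes "x < B" "P x" "\<And>y. P y \<Longrightarrow> x \<le> y" shows "least B P = x"
proof -
  have "{z. z < B \<and> (\<forall>y<B. y \<le> z \<longrightarrow> \<not> P y)} = {..<x}"
    using assms by (auto simp: not_le) (metis leD le_trans)+
  then show ?thesis by (simp add: least_def)
qed

lemma least_props:
  assumes "x < B" "P x"
  shows "least B P < B" "P (least B P)" "least B P \<le> x"
proof -
  have *: "least B P = (LEAST x. P x)"
    using assms by (intro least_eq) (auto intro: LeastI Least_le le_less_trans)
  show "least B P < B" "P (least B P)" "least B P \<le> x"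
    unfolding * using assms by (auto intro: LeastI Least_le le_less_trans)
qed

text \<open>The number of rounds that a vertex survives when all simplicial vertices are removed in
  every round.\<close>

primrec surv :: "(nat \<Rightarrow> nat \<Rightarrow> bool) \<Rightarrow> nat \<Rightarrow> nat \<Rightarrow> nat \<Rightarrow> nat" where
  "surv E B 0 x = 0"
| "surv E B (Suc t) x = surv E B t x + of_bool (surv E B t x = t \<and>
    \<not> (\<forall>p<B. \<forall>q<B. t \<le> surv E B t p \<and> t \<le> surv E B t q \<and> E x p \<and> E x q \<and> p \<noteq> q \<longrightarrow> E p q))"

text \<open>The closed neighbourhood of \<open>v\<close> among the vertices that survive at least as
  long as \<open>v\<close>. In a chordal graph every maximal clique arises in this way. The tests
  against \<open>N\<close> exclude loop indices that are not vertices.\<close>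

definition cand :: "(nat \<Rightarrow> nat \<Rightarrow> bool) \<Rightarrow> nat \<Rightarrow> nat \<Rightarrow> nat \<Rightarrow> nat \<Rightarrow> bool" where
  "cand E B N v x \<longleftrightarrow> v < N \<and> x < N \<and> surv E B B v \<le> surv E B B x \<and> (x = v \<or> E v x)"

text \<open>\<open>lev\<close> is one plus the distance from the set \<open>C v\<close>, or 0 while the distance is not known.
  \<open>lead\<close> is the least vertex of the first layer of the component of \<open>x\<close> outside \<open>C v\<close>.\<close>

primrec lev :: "(nat \<Rightarrow> nat \<Rightarrow> bool) \<Rightarrow> nat \<Rightarrow> (nat \<Rightarrow> nat \<Rightarrow> bool) \<Rightarrow> nat \<Rightarrow> nat \<Rightarrow> nat \<Rightarrow> nat" where
  "lev E B C 0 v x = of_bool (C v x)"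
| "lev E B C (Suc t) v x = (if lev E B C t v x = 0 \<and> (\<exists>y<B. E x y \<and> lev E B C t v y = Suc t)
     then Suc (Suc t) else lev E B C t v x)"

primrec lead :: "(nat \<Rightarrow> nat \<Rightarrow> bool) \<Rightarrow> nat \<Rightarrow> (nat \<Rightarrow> nat \<Rightarrow> bool) \<Rightarrow> nat \<Rightarrow> nat \<Rightarrow> nat \<Rightarrow> nat" where
  "lead E B C 0 v x = 0"
| "lead E B C (Suc t) v x = (if lev E B C t v x = 0 \<and> (\<exists>y<B. E x y \<and> lev E B C t v y = Suc t)
     then if t = 0
       then least B (\<lambda>y. lev E B C t v y = 0 \<and> (\<exists>z<B. E y z \<and> lev E B C t v z = Suc t) \<and> (y = x \<or> E x y))
       else lead E B C t v (least B (\<lambda>y. E x y \<and> lev E B C t v y = Suc t))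
     else lead E B C t v x)"

text \<open>Leads are vertex numbers and may be large. Counting the smaller leads renumbers them
  from 0 without gaps, so that ray numbers can be positions and digits of a code in base
  \<open>D\<close>.\<close>

definition rank :: "nat \<Rightarrow> (nat \<Rightarrow> nat \<Rightarrow> nat) \<Rightarrow> (nat \<Rightarrow> nat \<Rightarrow> nat) \<Rightarrow> nat \<Rightarrow> nat \<Rightarrow> nat" where
  "rank B l m v x = card {z. z < B \<and> (z < m v x \<and> (\<exists>y<B. 1 < l v y \<and> m v y = z))}"

text \<open>Digit \<open>j\<close> of \<open>c\<close> in base \<open>D\<close>; the minima allow loops of fixed length \<open>B\<close>.\<close>

definition bdiv :: "nat \<Rightarrow> nat \<Rightarrow> nat \<Rightarrow> nat" where
  "bdiv B a b = card {q. q < B \<and> min (q + 1) B * b \<le> a}"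

definition digit :: "nat \<Rightarrow> nat \<Rightarrow> nat \<Rightarrow> nat \<Rightarrow> nat" where
  "digit B D c j = bdiv B c (min D B ^ min j B) -
     min (bdiv B (bdiv B c (min D B ^ min j B)) D) B * D"

text \<open>The code \<open>c\<close> stands for a map from the ray numbers on the side of
  \<open>w\<close> to those on the side of \<open>v\<close>, one digit for each ray; every ray
  number on the side of \<open>w\<close> is sent through it before it is compared.\<close>

definition same :: "nat \<Rightarrow> nat \<Rightarrow> (nat \<Rightarrow> nat \<Rightarrow> bool) \<Rightarrow> (nat \<Rightarrow> nat \<Rightarrow> nat) \<Rightarrow> (nat \<Rightarrow> nat \<Rightarrow> nat) \<Rightarrow>
    nat \<Rightarrow> nat \<Rightarrow> nat \<Rightarrow> nat \<Rightarrow> nat \<Rightarrow> bool" where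
  "same B D E l m v w c x y \<longleftrightarrow> l v x = l w y \<and>
     (1 < l v x \<longrightarrow> rank B l m v x = digit B D c (rank B l m w y)) \<and>
     card {z. z < B \<and> (E x z \<and> l v z + 1 = l v x)} = card {z. z < B \<and> (E y z \<and> l w z + 1 = l w y)} \<and>
     card {z. z < B \<and> (E x z \<and> l v z = l v x + 1)} = card {z. z < B \<and> (E y z \<and> l w z = l w y + 1)} \<and>
     (\<forall>i<B. card {z. z < B \<and> (E x z \<and> 1 < l v z \<and> rank B l m v z = i)} =
       card {z. z < B \<and> (E y z \<and> 1 < l w z \<and> digit B D c (rank B l m w z) = i)})"

text \<open>Instead of searching for a bijection, the test asks that the classes of
  \<open>same\<close> have equal sizes on both sides and that adjacency agrees for all choices of
  representatives. Then every bijection that respects the classes is an isomorphism.\<close>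

definition match :: "nat \<Rightarrow> nat \<Rightarrow> (nat \<Rightarrow> nat \<Rightarrow> bool) \<Rightarrow> (nat \<Rightarrow> nat \<Rightarrow> nat) \<Rightarrow> (nat \<Rightarrow> nat \<Rightarrow> nat) \<Rightarrow>
    nat \<Rightarrow> nat \<Rightarrow> nat \<Rightarrow> bool" where
  "match B D E l m v w c \<longleftrightarrow>
     (\<forall>x<B. 0 < l v x \<longrightarrow> (\<exists>y<B. 0 < l w y \<and> same B D E l m v w c x y)) \<and>
     (\<forall>y<B. 0 < l w y \<longrightarrow> (\<exists>x<B. 0 < l v x \<and> same B D E l m v w c x y)) \<and>
     (\<forall>x<B. \<forall>y<B. 0 < l v x \<longrightarrow> 0 < l w y \<longrightarrow> same B D E l m v w c x y \<longrightarrow>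
       card {x'. x' < B \<and> (0 < l v x' \<and> same B D E l m v w c x' y)} =
       card {y'. y' < B \<and> (0 < l w y' \<and> same B D E l m v w c x y')}) \<and>
     (\<forall>x<B. \<forall>x'<B. \<forall>y<B. \<forall>y'<B. 0 < l v x \<longrightarrow> 0 < l v x' \<longrightarrow> 0 < l w y \<longrightarrow> 0 < l w y' \<longrightarrow>
       x \<noteq> x' \<longrightarrow> y \<noteq> y' \<longrightarrow> same B D E l m v w c x y \<longrightarrow> same B D E l m v w c x' y' \<longrightarrow>
       (E x x' \<longleftrightarrow> E y y'))"

definition linked :: "nat \<Rightarrow> nat \<Rightarrow> (nat \<Rightarrow> nat \<Rightarrow> bool) \<Rightarrow> (nat \<Rightarrow> nat \<Rightarrow> nat) \<Rightarrow> (nat \<Rightarrow> nat \<Rightarrow> nat) \<Rightarrow>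
    nat \<Rightarrow> nat \<Rightarrow> bool" where
  "linked B D E l m a b \<longleftrightarrow>
     (\<exists>v<B. \<exists>w<B. 0 < l v a \<and> 0 < l w b \<and> (\<exists>c<B. match B D E l m v w c))"

definition answer :: "nat \<Rightarrow> nat \<Rightarrow> nat \<Rightarrow> (nat \<Rightarrow> nat \<Rightarrow> bool) \<Rightarrow> (nat \<Rightarrow> nat \<Rightarrow> nat) \<Rightarrow>
    (nat \<Rightarrow> nat \<Rightarrow> nat) \<Rightarrow> bool" where
  "answer B D n E l m \<longleftrightarrow> (\<forall>a<B. a < n + n \<longrightarrow>
     card {b. b < B \<and> (b < n \<and> linked B D E l m a b)} =
     card {b. b < B \<and> (n \<le> b \<and> b < n + n \<and> linked B D E l m a b)})"

section \<open>Compilation of the algorithm\<close>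

lemma imp_iff:
  assumes "imp (\<lambda>\<sigma> r. of_bool (P \<sigma> r))" "imp (\<lambda>\<sigma> r. of_bool (Q \<sigma> r))"
  shows "imp (\<lambda>\<sigma> r. of_bool (P \<sigma> r \<longleftrightarrow> Q \<sigma> r))"
  by (rule imp_cong[OF imp_and[OF imp_imp[OF assms] imp_imp[OF assms(2,1)]]]) auto

text \<open>Programs are found by resolution with these rules. This dictates the shape of the
  definitions above: a bounded set is a bound followed by a single bracketed predicate, and products
  and powers carry minima.\<close>

lemmas imp_rules = imp_iff imp_eq imp_less imp_le imp_and imp_or imp_imp imp_not imp_ex imp_all
  imp_card imp_get imp_input imp_if imp_add imp_diff imp_mult imp_pow imp_var imp_params imp_const

abbreviation "adjacent \<sigma> x y \<equiv> get \<sigma> 0 x y \<noteq> 0"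

lemma imp_same:
  "imp (\<lambda>\<sigma> r. of_bool (same (cB \<sigma>) (cd \<sigma>) (adjacent \<sigma>) (get \<sigma> 3) (get \<sigma> 4)
     (r v) (r w) (r c) (r x) (r y)))"
  unfolding same_def rank_def digit_def bdiv_def by (intro imp_rules)

lemma imp_answer:
  "imp (\<lambda>\<sigma> r. of_bool (answer (cB \<sigma>) (cd \<sigma>) (cn \<sigma>) (adjacent \<sigma>) (get \<sigma> 3) (get \<sigma> 4)))"
  unfolding answer_def linked_def match_def by (intro imp_rules imp_same)

definition read_adjacency :: "cfg \<Rightarrow> nat \<Rightarrow> nat \<Rightarrow> nat" where
  "read_adjacency \<sigma> x y =
    (if x < cn \<sigma> \<and> y < cn \<sigma> then input \<sigma> (min x (cB \<sigma>) * cn \<sigma> + y)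
     else if (cn \<sigma> \<le> x \<and> x < cn \<sigma> + cn \<sigma>) \<and> cn \<sigma> \<le> y \<and> y < cn \<sigma> + cn \<sigma>
     then input \<sigma> (min (cn \<sigma>) (cB \<sigma>) * cn \<sigma> + (min (x - cn \<sigma>) (cB \<sigma>) * cn \<sigma> + (y - cn \<sigma>)))
     else 0)"

definition surv_step :: "nat \<Rightarrow> cfg \<Rightarrow> nat \<Rightarrow> nat \<Rightarrow> nat" where
  "surv_step t \<sigma> x y = get \<sigma> 7 x x + of_bool (get \<sigma> 7 x x = t \<and>
    \<not> (\<forall>p<cB \<sigma>. \<forall>q<cB \<sigma>. t \<le> get \<sigma> 7 p p \<and> t \<le> get \<sigma> 7 q q \<and> adjacent \<sigma> x p \<and> adjacent \<sigma> x q \<and>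
      p \<noteq> q \<longrightarrow> adjacent \<sigma> p q))"

text \<open>A one-dimensional table is kept on the diagonal of array 7. Array 2 is a buffer, since
  \<open>stm_fill\<close> forbids an expression to read the array that it writes.\<close>

definition surv_prog :: "cfg \<Rightarrow> cfg" where
  "surv_prog \<sigma> = loop (\<lambda>t \<sigma>. let \<sigma> = upd \<sigma> 2 (surv_step t \<sigma>) in upd \<sigma> 7 (\<lambda>x y. get \<sigma> 2 x x)) \<sigma> (cB \<sigma>)"

definition cand_step :: "cfg \<Rightarrow> nat \<Rightarrow> nat \<Rightarrow> nat" where
  "cand_step \<sigma> v x = of_bool (v < cn \<sigma> + cn \<sigma> \<and> x < cn \<sigma> + cn \<sigma> \<and> get \<sigma> 7 v v \<le> get \<sigma> 7 x x \<and>
     (x = v \<or> adjacent \<sigma> v x))"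

definition lev_step :: "nat \<Rightarrow> cfg \<Rightarrow> nat \<Rightarrow> nat \<Rightarrow> nat" where
  "lev_step t \<sigma> v x = (if get \<sigma> 3 v x = 0 \<and> (\<exists>y<cB \<sigma>. adjacent \<sigma> x y \<and> get \<sigma> 3 v y = t + 1)
     then t + 2 else get \<sigma> 3 v x)"

definition lead_step :: "nat \<Rightarrow> cfg \<Rightarrow> nat \<Rightarrow> nat \<Rightarrow> nat" where
  "lead_step t \<sigma> v x = (if get \<sigma> 3 v x = 0 \<and> (\<exists>y<cB \<sigma>. adjacent \<sigma> x y \<and> get \<sigma> 3 v y = t + 1)
     then if t = 0
       then least (cB \<sigma>) (\<lambda>y. get \<sigma> 3 v y = 0 \<and> (\<exists>z<cB \<sigma>. adjacent \<sigma> y z \<and> get \<sigma> 3 v z = t + 1) \<and>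
         (y = x \<or> adjacent \<sigma> x y))
       else get \<sigma> 4 v (least (cB \<sigma>) (\<lambda>y. adjacent \<sigma> x y \<and> get \<sigma> 3 v y = t + 1))
     else get \<sigma> 4 v x)"

text \<open>Arrays 3 and 4 hold levels and leads, arrays 5 and 6 are their buffers. New leads depend
  on old levels, so nothing is copied back before both buffers are complete.\<close>

definition lev_prog :: "cfg \<Rightarrow> cfg" where
  "lev_prog \<sigma> = loop (\<lambda>t \<sigma>. let \<sigma> = upd \<sigma> 5 (lev_step t \<sigma>); \<sigma> = upd \<sigma> 6 (lead_step t \<sigma>);
     \<sigma> = upd \<sigma> 3 (get \<sigma> 5) in upd \<sigma> 4 (get \<sigma> 6)) \<sigma> (cB \<sigma>)"

definition prog :: "cfg \<Rightarrow> cfg" where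
  "prog \<sigma> = (let \<sigma> = upd \<sigma> 0 (read_adjacency \<sigma>); \<sigma> = upd \<sigma> 7 (\<lambda>x y. 0); \<sigma> = surv_prog \<sigma>;
     \<sigma> = upd \<sigma> 3 (cand_step \<sigma>); \<sigma> = upd \<sigma> 4 (\<lambda>x y. 0) in lev_prog \<sigma>)"

lemma stm_surv_prog: "stm (\<lambda>\<sigma> r. surv_prog \<sigma>)"
proof -
  have 1: "stm (\<lambda>\<sigma> r. upd \<sigma> 2 (surv_step (r 0) \<sigma>))"
    by (rule stm_fill[where e = "\<lambda>\<sigma> r. surv_step (r 0) \<sigma>"]; unfold surv_step_def; (intro imp_rules | simp cong: if_cong))
  have 2: "stm (\<lambda>\<sigma> r. upd \<sigma> 7 (\<lambda>x y. get \<sigma> 2 x x))"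
    by (rule stm_fill[where e = "\<lambda>\<sigma> r x y. get \<sigma> 2 x x"]; (intro imp_rules | simp cong: if_cong))
  show ?thesis
    unfolding surv_prog_def Let_def
    by (rule stm_loop[where f = "\<lambda>t \<sigma> r. upd (upd \<sigma> 2 (surv_step t \<sigma>)) 7
      (\<lambda>x y. get (upd \<sigma> 2 (surv_step t \<sigma>)) 2 x x)"]) (rule stm_seq[OF 1 2])
qed

lemma stm_copy: "k \<noteq> k' \<Longrightarrow> stm (\<lambda>\<sigma> r. upd \<sigma> k (get \<sigma> k'))"
  by (rule stm_fill[where e = "\<lambda>\<sigma> r. get \<sigma> k'"]; (intro imp_rules | simp cong: if_cong))

lemma stm_clear: "stm (\<lambda>\<sigma> r. upd \<sigma> k (\<lambda>x y. 0))"
  by (rule stm_fill[where e = "\<lambda>\<sigma> r x y. 0"]; (intro imp_rules | simp cong: if_cong))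

lemma stm_lev_prog: "stm (\<lambda>\<sigma> r. lev_prog \<sigma>)"
proof -
  have 1: "stm (\<lambda>\<sigma> r. upd \<sigma> 5 (lev_step (r 0) \<sigma>))"
    by (rule stm_fill[where e = "\<lambda>\<sigma> r. lev_step (r 0) \<sigma>"]; unfold lev_step_def; (intro imp_rules | simp cong: if_cong))
  have 2: "stm (\<lambda>\<sigma> r. upd \<sigma> 6 (lead_step (r 0) \<sigma>))"
    by (rule stm_fill[where e = "\<lambda>\<sigma> r. lead_step (r 0) \<sigma>"]; unfold lead_step_def least_def;
        (intro imp_rules | simp cong: if_cong))
  have 3: "stm (\<lambda>\<sigma> r. upd \<sigma> 3 (get \<sigma> 5))" "stm (\<lambda>\<sigma> r. upd \<sigma> 4 (get \<sigma> 6))"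
    by (rule stm_copy; simp)+
  show ?thesis
    unfolding lev_prog_def Let_def
    by (rule stm_loop[where f = "\<lambda>t \<sigma> r. (\<lambda>\<sigma>. upd \<sigma> 4 (get \<sigma> 6)) ((\<lambda>\<sigma>. upd \<sigma> 3 (get \<sigma> 5))
      ((\<lambda>\<sigma>. upd \<sigma> 6 (lead_step t \<sigma>)) (upd \<sigma> 5 (lev_step t \<sigma>))))"])
      (rule stm_seq[OF stm_seq[OF stm_seq[OF 1 2] 3(1)] 3(2)])
qed

lemma stm_prog: "stm (\<lambda>\<sigma> r. prog \<sigma>)"
proof -
  have 1: "stm (\<lambda>\<sigma> r. upd \<sigma> 0 (read_adjacency \<sigma>))"
    by (rule stm_fill[where e = "\<lambda>\<sigma> r. read_adjacency \<sigma>"]; unfold read_adjacency_def; (intro imp_rules | simp cong: if_cong))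
  have 2: "stm (\<lambda>\<sigma> r. upd \<sigma> 3 (cand_step \<sigma>))"
    by (rule stm_fill[where e = "\<lambda>\<sigma> r. cand_step \<sigma>"]; unfold cand_step_def; (intro imp_rules | simp cong: if_cong))
  show ?thesis
    unfolding prog_def Let_def
    by (rule stm_seq[OF stm_seq[OF stm_seq[OF stm_seq[OF stm_seq[OF 1 stm_clear[of 7]] stm_surv_prog] 2]
      stm_clear[of 4]] stm_lev_prog])
qed

section \<open>Agreement of the arrays with the recursive functions\<close>

lemma surv_prog_eq:
  assumes "\<And>x. x < cB \<sigma> \<Longrightarrow> get \<sigma> 7 x x = 0"
  shows "cB (surv_prog \<sigma>) = cB \<sigma>" "cn (surv_prog \<sigma>) = cn \<sigma>" "cd (surv_prog \<sigma>) = cd \<sigma>"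
    "get (surv_prog \<sigma>) 0 = get \<sigma> 0"
    "x < cB \<sigma> \<Longrightarrow> get (surv_prog \<sigma>) 7 x x = surv (adjacent \<sigma>) (cB \<sigma>) (cB \<sigma>) x"
proof -
  define body where "body t \<sigma> = (let \<sigma> = upd \<sigma> 2 (surv_step t \<sigma>) in upd \<sigma> 7 (\<lambda>x y. get \<sigma> 2 x x))" for t \<sigma>
  have body: "cB (body t \<sigma>) = cB \<sigma>" "cn (body t \<sigma>) = cn \<sigma>" "cd (body t \<sigma>) = cd \<sigma>"
    "get (body t \<sigma>) 0 = get \<sigma> 0" "x < cB \<sigma> \<Longrightarrow> get (body t \<sigma>) 7 x x = surv_step t \<sigma> x x" for t \<sigma> x
    by (simp_all add: body_def Let_def)
  have "cB (loop body \<sigma> t) = cB \<sigma> \<and> cn (loop body \<sigma> t) = cn \<sigma> \<and> cd (loop body \<sigma> t) = cd \<sigma> \<and>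
    get (loop body \<sigma> t) 0 = get \<sigma> 0 \<and>
    (\<forall>x < cB \<sigma>. get (loop body \<sigma> t) 7 x x = surv (adjacent \<sigma>) (cB \<sigma>) t x)" for t
    by (induction t) (simp_all add: assms body surv_step_def)
  moreover have "surv_prog \<sigma> = loop body \<sigma> (cB \<sigma>)"
    by (simp add: surv_prog_def body_def[abs_def])
  ultimately show "cB (surv_prog \<sigma>) = cB \<sigma>" "cn (surv_prog \<sigma>) = cn \<sigma>" "cd (surv_prog \<sigma>) = cd \<sigma>"
    "get (surv_prog \<sigma>) 0 = get \<sigma> 0"
    "x < cB \<sigma> \<Longrightarrow> get (surv_prog \<sigma>) 7 x x = surv (adjacent \<sigma>) (cB \<sigma>) (cB \<sigma>) x"
    by simp_all
qed

text \<open>\<open>get\<close> returns 0 outside the bounds. With this fact the arrays equal the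
  recursive functions as total functions, not only on the indices below \<open>B\<close>.\<close>

lemma lev_lead_outside:
  assumes "\<And>x y. E x y \<Longrightarrow> x < B" "\<And>v x. C v x \<Longrightarrow> v < B \<and> x < B" "\<not> (v < B \<and> x < B)"
  shows "lev E B C t v x = 0 \<and> lead E B C t v x = 0"
  using assms(3)
proof (induction t arbitrary: x)
  case (Suc t)
  have "\<not> (E x y \<and> lev E B C t v y = Suc t)" for y
    using Suc.IH[of y] Suc.prems assms(1)[of x y] by auto
  with Suc show ?case by auto
qed (use assms(2) in auto)

lemma lev_prog_eq:
  assumes "\<And>v x. get \<sigma> 3 v x = of_bool (C v x)" "\<And>v x. get \<sigma> 4 v x = 0"
  shows "cB (lev_prog \<sigma>) = cB \<sigma>" "cn (lev_prog \<sigma>) = cn \<sigma>" "cd (lev_prog \<sigma>) = cd \<sigma>"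
    "get (lev_prog \<sigma>) 0 = get \<sigma> 0"
    "get (lev_prog \<sigma>) 3 = lev (adjacent \<sigma>) (cB \<sigma>) C (cB \<sigma>)"
    "get (lev_prog \<sigma>) 4 = lead (adjacent \<sigma>) (cB \<sigma>) C (cB \<sigma>)"
proof -
  define body where "body t \<sigma> = (let \<sigma> = upd \<sigma> 5 (lev_step t \<sigma>); \<sigma> = upd \<sigma> 6 (lead_step t \<sigma>);
     \<sigma> = upd \<sigma> 3 (get \<sigma> 5) in upd \<sigma> 4 (get \<sigma> 6))" for t \<sigma>
  have indep: "lead_step t (upd \<sigma> 5 h) = lead_step t \<sigma>" for t \<sigma> h
    by (simp add: lead_step_def fun_eq_iff cong: if_cong)
  have body: "cB (body t \<sigma>) = cB \<sigma>" "cn (body t \<sigma>) = cn \<sigma>" "cd (body t \<sigma>) = cd \<sigma>"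
    "get (body t \<sigma>) 0 = get \<sigma> 0"
    "get (body t \<sigma>) 3 v x = (if v < cB \<sigma> \<and> x < cB \<sigma> then lev_step t \<sigma> v x else 0)"
    "get (body t \<sigma>) 4 v x = (if v < cB \<sigma> \<and> x < cB \<sigma> then lead_step t \<sigma> v x else 0)" for t \<sigma> v x
    by (simp_all add: body_def Let_def indep) (simp_all add: get_def)
  have out: "lev (adjacent \<sigma>) (cB \<sigma>) C t v x = 0 \<and> lead (adjacent \<sigma>) (cB \<sigma>) C t v x = 0"
    if "\<not> (v < cB \<sigma> \<and> x < cB \<sigma>)" for t v x
  proof (rule lev_lead_outside[OF _ _ that])
    show "v < cB \<sigma> \<and> x < cB \<sigma>" if "C v x" for v x
      using assms(1)[of v x] that by (auto simp: get_def split: if_splits)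
  qed (auto simp: get_def split: if_splits)
  have inv: "cB (loop body \<sigma> t) = cB \<sigma> \<and> cn (loop body \<sigma> t) = cn \<sigma> \<and> cd (loop body \<sigma> t) = cd \<sigma> \<and>
    get (loop body \<sigma> t) 0 = get \<sigma> 0 \<and>
    get (loop body \<sigma> t) 3 = lev (adjacent \<sigma>) (cB \<sigma>) C t \<and>
    get (loop body \<sigma> t) 4 = lead (adjacent \<sigma>) (cB \<sigma>) C t" for t
  proof (induction t)
    case (Suc t)
    note step = loop.simps body lev_step_def lead_step_def Suc_eq_plus1[symmetric] add_2_eq_Suc'
      Suc[THEN conjunct1] Suc[THEN conjunct2, THEN conjunct2, THEN conjunct2]
    have "get (loop body \<sigma> (Suc t)) 3 v x = lev (adjacent \<sigma>) (cB \<sigma>) C (Suc t) v x" for v x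
    proof (cases "v < cB \<sigma> \<and> x < cB \<sigma>")
      case True
      then show ?thesis by (simp only: step lev.simps simp_thms if_True)
    next
      case False
      then show ?thesis using Suc out[OF False, of "Suc t"] by (auto simp: body simp del: lev.simps lead.simps)
    qed
    moreover have "get (loop body \<sigma> (Suc t)) 4 v x = lead (adjacent \<sigma>) (cB \<sigma>) C (Suc t) v x" for v x
    proof (cases "v < cB \<sigma> \<and> x < cB \<sigma>")
      case True
      then show ?thesis by (simp only: step lead.simps simp_thms if_True)
    next
      case False
      then show ?thesis using Suc out[OF False, of "Suc t"] by (auto simp: body simp del: lev.simps lead.simps)
    qed
    ultimately show ?case using Suc by (simp add: body fun_eq_iff del: lev.simps lead.simps)
  qed (simp add: assms fun_eq_iff)
  moreover have "lev_prog \<sigma> = loop body \<sigma> (cB \<sigma>)"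
    by (simp add: lev_prog_def body_def[abs_def])
  ultimately show "cB (lev_prog \<sigma>) = cB \<sigma>" "cn (lev_prog \<sigma>) = cn \<sigma>" "cd (lev_prog \<sigma>) = cd \<sigma>"
    "get (lev_prog \<sigma>) 0 = get \<sigma> 0"
    "get (lev_prog \<sigma>) 3 = lev (adjacent \<sigma>) (cB \<sigma>) C (cB \<sigma>)"
    "get (lev_prog \<sigma>) 4 = lead (adjacent \<sigma>) (cB \<sigma>) C (cB \<sigma>)"
    by simp_all
qed

lemma prog_eq:
  assumes "cn \<sigma> + cn \<sigma> \<le> cB \<sigma>"
    and E: "\<And>x y. E x y \<longleftrightarrow> x < cB \<sigma> \<and> y < cB \<sigma> \<and> read_adjacency \<sigma> x y \<noteq> 0"
  defines "C \<equiv> cand E (cB \<sigma>) (cn \<sigma> + cn \<sigma>)"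
  shows "cB (prog \<sigma>) = cB \<sigma>" "cn (prog \<sigma>) = cn \<sigma>" "cd (prog \<sigma>) = cd \<sigma>"
    "adjacent (prog \<sigma>) = E"
    "get (prog \<sigma>) 3 = lev E (cB \<sigma>) C (cB \<sigma>)" "get (prog \<sigma>) 4 = lead E (cB \<sigma>) C (cB \<sigma>)"
proof -
  define s1 where "s1 = upd (upd \<sigma> 0 (read_adjacency \<sigma>)) 7 (\<lambda>x y. 0)"
  define s2 where "s2 = surv_prog s1"
  define s3 where "s3 = upd (upd s2 3 (cand_step s2)) 4 (\<lambda>x y. 0)"
  have s1: "cB s1 = cB \<sigma>" "cn s1 = cn \<sigma>" "cd s1 = cd \<sigma>" "adjacent s1 = E"
    and "get s1 7 x x = 0" for x
    by (auto simp: s1_def E fun_eq_iff get_def)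
  note 2 = surv_prog_eq[of s1, OF this(5), folded s2_def]
  have s2: "cB s2 = cB \<sigma>" "cn s2 = cn \<sigma>" "cd s2 = cd \<sigma>" "adjacent s2 = E"
    "x < cB \<sigma> \<Longrightarrow> get s2 7 x x = surv E (cB \<sigma>) (cB \<sigma>) x" for x
    using 2 s1 by (simp_all add: fun_eq_iff)
  have "get s3 3 v x = of_bool (C v x)" for v x
    using assms(1) s2
    by (auto simp: s3_def get_def[of "upd s2 3 (cand_step s2)"] cand_step_def C_def cand_def fun_eq_iff)
  moreover have "get s3 4 v x = 0" for v x by (auto simp: s3_def get_def)
  ultimately have 3: "cB (lev_prog s3) = cB s3" "cn (lev_prog s3) = cn s3" "cd (lev_prog s3) = cd s3"
    "get (lev_prog s3) 0 = get s3 0"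
    "get (lev_prog s3) 3 = lev (adjacent s3) (cB s3) C (cB s3)"
    "get (lev_prog s3) 4 = lead (adjacent s3) (cB s3) C (cB s3)"
    by (rule lev_prog_eq)+
  have s3: "cB s3 = cB \<sigma>" "cn s3 = cn \<sigma>" "cd s3 = cd \<sigma>" "adjacent s3 = E"
    using s2 by (simp_all add: s3_def)
  have "prog \<sigma> = lev_prog s3" by (simp add: prog_def Let_def s1_def s2_def s3_def)
  then show "cB (prog \<sigma>) = cB \<sigma>" "cn (prog \<sigma>) = cn \<sigma>" "cd (prog \<sigma>) = cd \<sigma>"
    "adjacent (prog \<sigma>) = E"
    "get (prog \<sigma>) 3 = lev E (cB \<sigma>) C (cB \<sigma>)" "get (prog \<sigma>) 4 = lead E (cB \<sigma>) C (cB \<sigma>)"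
    using 3 s3 by simp_all
qed

definition union_adj :: "nat \<Rightarrow> nat pair_pre_digraph \<Rightarrow> nat pair_pre_digraph \<Rightarrow> nat \<Rightarrow> nat \<Rightarrow> bool" where
  "union_adj n G H x y \<longleftrightarrow> x < n \<and> y < n \<and> (x, y) \<in> parcs G \<or>
     n \<le> x \<and> n \<le> y \<and> x < n + n \<and> y < n + n \<and> (x - n, y - n) \<in> parcs H"

lemma read_adjacency_input:
  fixes d n :: nat and G H :: "nat pair_pre_digraph"
  defines "\<sigma> \<equiv> start (graph_pair_input d n G H)"
  shows "x < cB \<sigma> \<and> y < cB \<sigma> \<and> read_adjacency \<sigma> x y \<noteq> 0 \<longleftrightarrow> union_adj n G H x y"
proof -
  have \<sigma>: "cn \<sigma> = n" "cB \<sigma> = bnd d n" "inp \<sigma> = snd (graph_pair_input d n G H)"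
    by (simp_all add: \<sigma>_def start_def graph_pair_input_def)
  have B: "n + n < bnd d n" by (simp add: bnd_def)
  \<comment> \<open>Only the first \<open>B * B\<close> cells count as raw input; both matrices fit
    into them because \<open>2 * n < B\<close>.\<close>
  have "(n + n) * (n + n) \<le> bnd d n * bnd d n" using B by (intro mult_mono) auto
  then have in2: "input \<sigma> a = snd (graph_pair_input d n G H) a" if "a < 2 * n * n" for a
    using that by (simp add: input_def \<sigma> algebra_simps)
  have sq: "x * n + y < n * n" if "x < n" "y < n" for x y :: nat
  proof -
    have "Suc x * n \<le> n * n" using that by (intro mult_right_mono) auto
    then show ?thesis using that by simp
  qed
  consider "x < n" "y < n" | "n \<le> x" "x < n + n" "n \<le> y" "y < n + n"
    | "\<not> (x < n \<and> y < n)" "\<not> ((n \<le> x \<and> x < n + n) \<and> n \<le> y \<and> y < n + n)" by blast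
  then show ?thesis
  proof cases
    case 1
    have "read_adjacency \<sigma> x y = input \<sigma> (x * n + y)"
      using 1 B by (simp add: read_adjacency_def \<sigma>)
    also have "\<dots> = of_bool ((x, y) \<in> parcs G)"
      using 1 sq[OF 1] by (simp add: in2 graph_pair_input_def)
    finally show ?thesis using 1 B by (auto simp: union_adj_def \<sigma>)
  next
    case 2
    define x' y' where "x' = x - n" and "y' = y - n"
    have l: "x' < n" "y' < n" using 2 by (auto simp: x'_def y'_def)
    have "read_adjacency \<sigma> x y = input \<sigma> (n * n + (x' * n + y'))"
      using 2 B by (simp add: read_adjacency_def \<sigma> x'_def y'_def)
    also have "\<dots> = of_bool ((x', y') \<in> parcs H)"
      using l sq[OF l] by (simp add: in2 graph_pair_input_def)
    finally show ?thesis using 2 B by (auto simp: union_adj_def \<sigma> x'_def y'_def)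
  next
    case 3
    then have "read_adjacency \<sigma> x y = 0" by (auto simp: read_adjacency_def \<sigma>)
    with 3 show ?thesis by (auto simp: union_adj_def)
  qed
qed

lemma decides_within_answer:
  "\<exists>c F q. computable F \<and> (\<forall>d n G H.
    decides_within c (graph_pair_input d n G H) (F d * max 1 n ^ q)
      (let B = bnd d n; E = union_adj n G H; C = cand E B (n + n) in
        answer B d n E (lev E B C B) (lead E B C B)))"
proof (rule decides_within_imp[OF stm_prog imp_answer])
  fix c F q assume 1: "computable F"
    "\<And>r m. decides_within c (r, m) (F (r 0) * max 1 (r 1) ^ q)
      (answer (cB (prog (start (r, m)))) (cd (prog (start (r, m)))) (cn (prog (start (r, m))))
        (adjacent (prog (start (r, m)))) (get (prog (start (r, m))) 3) (get (prog (start (r, m))) 4))"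
  have "decides_within c (graph_pair_input d n G H) (F d * max 1 n ^ q)
      (let B = bnd d n; E = union_adj n G H; C = cand E B (n + n) in
        answer B d n E (lev E B C B) (lead E B C B))" for d n G H
  proof -
    let ?\<sigma> = "start (graph_pair_input d n G H)"
    have \<sigma>: "cn ?\<sigma> = n" "cB ?\<sigma> = bnd d n" "cd ?\<sigma> = d"
      by (simp_all add: start_def graph_pair_input_def)
    have "cn ?\<sigma> + cn ?\<sigma> \<le> cB ?\<sigma>" by (simp add: \<sigma> bnd_def)
    note p = prog_eq[OF this read_adjacency_input[symmetric], unfolded \<sigma>]
    from 1(2)[of "fst (graph_pair_input d n G H)" "snd (graph_pair_input d n G H)"]
    have "decides_within c (graph_pair_input d n G H) (F d * max 1 n ^ q)
      (answer (cB (prog ?\<sigma>)) (cd (prog ?\<sigma>)) (cn (prog ?\<sigma>)) (adjacent (prog ?\<sigma>))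
        (get (prog ?\<sigma>) 3) (get (prog ?\<sigma>) 4))"
      by (simp add: graph_pair_input_def)
    then show ?thesis unfolding p Let_def .
  qed
  with 1(1) show ?thesis by blast
qed

section \<open>Ray models\<close>

text \<open>
  The vertices of \<open>K\<close> contain a common point \<open>c\<close>; every other vertex \<open>x\<close> is an interval
  \<open>[a x, b x]\<close> on a ray, and \<open>e v i\<close> is the last point of \<open>v \<in> K\<close> on ray \<open>i\<close>.
\<close>

definition ray_model :: "('v \<Rightarrow> 'v \<Rightarrow> bool) \<Rightarrow> 'v set \<Rightarrow> 'v set \<Rightarrow> nat set \<Rightarrow> ('v \<Rightarrow> nat) \<Rightarrow> ('v \<Rightarrow> nat) \<Rightarrow>
    ('v \<Rightarrow> nat) \<Rightarrow> ('v \<Rightarrow> nat \<Rightarrow> nat) \<Rightarrow> bool" where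
  "ray_model E X K R ray a b e \<longleftrightarrow>
     K \<subseteq> X \<and> (\<forall>x\<in>K. \<forall>y\<in>K. x \<noteq> y \<longrightarrow> E x y) \<and>
     (\<forall>x\<in>X - K. ray x \<in> R \<and> 0 < a x \<and> a x \<le> b x) \<and>
     (\<forall>x\<in>X - K. \<forall>y\<in>X - K. x \<noteq> y \<longrightarrow> (E x y \<longleftrightarrow> ray x = ray y \<and> a x \<le> b y \<and> a y \<le> b x)) \<and>
     (\<forall>x\<in>X - K. \<forall>y\<in>X - K. ray x = ray y \<longrightarrow> (a x \<le> a y \<longleftrightarrow> b x \<le> b y)) \<and>
     (\<forall>v\<in>K. \<forall>x\<in>X - K. (E v x \<longleftrightarrow> a x \<le> e v (ray x)) \<and> e v (ray x) < b x)"

lemma ray_modelD: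
  assumes "ray_model E X K R ray a b e"
  shows "K \<subseteq> X" "x \<in> K \<Longrightarrow> y \<in> K \<Longrightarrow> x \<noteq> y \<Longrightarrow> E x y"
    "x \<in> X - K \<Longrightarrow> ray x \<in> R" "x \<in> X - K \<Longrightarrow> 0 < a x" "x \<in> X - K \<Longrightarrow> a x \<le> b x"
    "x \<in> X - K \<Longrightarrow> y \<in> X - K \<Longrightarrow> x \<noteq> y \<Longrightarrow> E x y \<longleftrightarrow> ray x = ray y \<and> a x \<le> b y \<and> a y \<le> b x"
    "x \<in> X - K \<Longrightarrow> y \<in> X - K \<Longrightarrow> ray x = ray y \<Longrightarrow> a x \<le> a y \<longleftrightarrow> b x \<le> b y"
    "v \<in> K \<Longrightarrow> x \<in> X - K \<Longrightarrow> E v x \<longleftrightarrow> a x \<le> e v (ray x)"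
    "v \<in> K \<Longrightarrow> x \<in> X - K \<Longrightarrow> e v (ray x) < b x"
  using assms unfolding ray_model_def by blast+

lemma ray_model_restrict:
  "ray_model E X K R ray a b e \<Longrightarrow> Y \<subseteq> X \<Longrightarrow> ray_model E Y (K \<inter> Y) R ray a b e"
  unfolding ray_model_def by blast

text \<open>Transporting one model, rather than choosing a second one, gives two isomorphic
  components corresponding rays, ends and center cliques.\<close>

lemma ray_model_image:
  assumes "ray_model E X K R ray a b e" and inj: "inj_on \<phi> X"
    and iso: "\<And>x y. x \<in> X \<Longrightarrow> y \<in> X \<Longrightarrow> E' (\<phi> x) (\<phi> y) \<longleftrightarrow> E x y"
  defines "\<psi> \<equiv> inv_into X \<phi>"
  shows "ray_model E' (\<phi> ` X) (\<phi> ` K) R (ray \<circ> \<psi>) (a \<circ> \<psi>) (b \<circ> \<psi>) (e \<circ> \<psi>)"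
proof -
  have KX: "K \<subseteq> X" using assms(1) unfolding ray_model_def by blast
  have \<psi>: "\<psi> (\<phi> x) = x" if "x \<in> X" for x using that inj by (simp add: \<psi>_def)
  have inj': "\<phi> x = \<phi> y \<longleftrightarrow> x = y" if "x \<in> X" "y \<in> X" for x y using that inj by (auto dest: inj_onD)
  have diff: "\<phi> ` X - \<phi> ` K = \<phi> ` (X - K)" using inj KX by (simp add: inj_on_image_set_diff)
  note D = ray_modelD[OF assms(1)]
  show ?thesis
    unfolding ray_model_def diff ball_simps
    using D subsetD[OF KX] image_mono[OF KX, of \<phi>]
    by (intro conjI ballI impI; (simp add: \<psi> inj' iso)?)
qed

text \<open>The common point can be moved to the point \<open>p\<close> of ray \<open>i\<close>.\<close>

lemma recenter:
  assumes M: "ray_model E X K R ray a b e" and sym: "\<And>x y. E x y \<Longrightarrow> E y x"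
    and p: "\<And>v. v \<in> K \<Longrightarrow> p \<le> e v i" "\<And>x. x \<in> X - K \<Longrightarrow> ray x = i \<Longrightarrow> p \<le> b x"
  defines "K' \<equiv> K \<union> {x \<in> X - K. ray x = i \<and> a x \<le> p}"
    and "e' \<equiv> \<lambda>v j. if v \<in> K then e v j else if j = i then b v else 0"
  shows "ray_model E X K' R ray a b e'"
proof -
  note D = ray_modelD[OF M]
  have sub: "K' \<subseteq> X" "X - K' \<subseteq> X - K" using D(1) by (auto simp: K'_def)
  \<comment> \<open>No interval of ray \<open>i\<close> ends before \<open>p\<close>, so those that
    start at or before \<open>p\<close> contain it and join \<open>K\<close>, while the others start
    beyond it. A vertex that joins reaches ray \<open>i\<close> up to its own right end and no other
    ray, which is what \<open>e'\<close> records.\<close>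
  have new: "x \<in> X - K" "ray x = i" "a x \<le> p" "p \<le> b x" if "x \<in> K'" "x \<notin> K" for x
    using that p(2) by (auto simp: K'_def)
  have old: "x \<in> X - K" "ray x = i \<Longrightarrow> p < a x" if "x \<in> X - K'" for x
    using that by (auto simp: K'_def)
  show ?thesis
    unfolding ray_model_def
  proof (intro conjI ballI impI)
    fix x y assume xy: "x \<in> K'" "y \<in> K'" "x \<noteq> y"
    have KN: "E v w" if "v \<in> K" "w \<in> K'" "w \<notin> K" for v w
      using that D(8)[OF that(1) new(1)[OF that(2,3)]] new[OF that(2,3)] p(1)[OF that(1)] by auto
    have NN: "E x y" if "x \<notin> K" "y \<notin> K"
      using that xy D(6)[OF new(1)[OF xy(1) that(1)] new(1)[OF xy(2) that(2)] xy(3)]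
        new[OF xy(1) that(1)] new[OF xy(2) that(2)] by auto
    show "E x y"
      using xy D(2)[of x y] KN[of x y] sym[OF KN[of y x]] NN by blast
  next
    fix v x assume v: "v \<in> K'" and x: "x \<in> X - K'"
    have "(E v x \<longleftrightarrow> a x \<le> e' v (ray x)) \<and> e' v (ray x) < b x"
    proof (cases "v \<in> K")
      case True
      then show ?thesis using D(8,9)[OF True old(1)[OF x]] by (simp add: e'_def)
    next
      case False
      note n = new[OF v False] and o = old[OF x]
      have ne: "v \<noteq> x" using v x by auto
      show ?thesis
      proof (cases "ray x = i")
        case True
        \<comment> \<open>Properness on ray \<open>i\<close>: \<open>v\<close> starts no later than
          \<open>p\<close> and \<open>x\<close> after it, so \<open>x\<close> also ends
          later.\<close>
        have "\<not> b x \<le> b v" using D(7)[OF o(1) n(1)] True n(2,3) o(2) by auto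
        then show ?thesis
          using D(6)[OF n(1) o(1) ne] D(5)[OF o(1)] True n o(2) False by (auto simp: e'_def)
      next
        case r: False
        then show ?thesis
          using D(6)[OF n(1) o(1) ne] D(4,5)[OF o(1)] n False by (auto simp: e'_def)
      qed
    qed
    then show "E v x \<longleftrightarrow> a x \<le> e' v (ray x)" "e' v (ray x) < b x" by blast+
  next
    show "K' \<subseteq> X" by (rule sub)
  next
    fix x assume "x \<in> X - K'"
    from D(3-5)[OF subsetD[OF sub(2) this]] show "ray x \<in> R" "0 < a x" "a x \<le> b x" .
  next
    fix x y assume xy: "x \<in> X - K'" "y \<in> X - K'"
    note xy' = subsetD[OF sub(2) xy(1)] subsetD[OF sub(2) xy(2)]
    show "E x y \<longleftrightarrow> ray x = ray y \<and> a x \<le> b y \<and> a y \<le> b x" if "x \<noteq> y"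
      using D(6)[OF xy' that] .
    show "a x \<le> a y \<longleftrightarrow> b x \<le> b y" if "ray x = ray y"
      using D(7)[OF xy' that] .
  qed
qed

text \<open>If no vertex of the component contains the center, connectedness keeps the component on
  one ray, and the common point moves to the earliest right end. Otherwise \<open>K\<^sub>0\<close>
  is enlarged to a maximal clique \<open>K\<close>. Its new members are pairwise adjacent and hence
  on one ray, and by the Helly property the members of \<open>K\<close> share a point there. The
  clique at that point contains \<open>K\<close>, so it is \<open>K\<close>.\<close>

lemma maximal_center:
  assumes M: "ray_model E X K\<^sub>0 R ray a b e" and sym: "\<And>x y. E x y \<Longrightarrow> E y x"
    and fin: "finite X" and x0: "x\<^sub>0 \<in> X" and conn: "\<And>x. x \<in> X \<Longrightarrow> E\<^sup>*\<^sup>* x\<^sub>0 x"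
    and closed: "\<And>x y. x \<in> X \<Longrightarrow> E x y \<Longrightarrow> y \<in> X"
  shows "\<exists>K e'. ray_model E X K R ray a b e' \<and> K \<noteq> {} \<and>
    (\<forall>x\<in>X. (\<forall>v\<in>K. v = x \<or> E v x) \<longrightarrow> x \<in> K)"
proof (cases "K\<^sub>0 = {}")
  case True
  note D = ray_modelD[OF M, unfolded True]
  have one: "ray x = ray x\<^sub>0" if "x \<in> X" for x
  proof -
    from conn[OF that] show ?thesis
    proof (induction rule: rtranclp_induct)
      case (step y z)
      have "y \<in> X" using step(1) x0 closed by (induction rule: rtranclp_induct) auto
      with step D(6)[of y z] closed[of y z] show ?case by (cases "y = z") auto
    qed simp
  qed
  \<comment> \<open>The interval that ends first meets exactly the intervals that contain its right
    end; this makes the clique at \<open>p\<close> maximal.\<close>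
  define p where "p = Min (b ` X)"
  have p: "p \<in> b ` X" "\<And>x. x \<in> X \<Longrightarrow> p \<le> b x" using fin x0 unfolding p_def by (auto intro: Min_in)
  then obtain y where y: "y \<in> X" "b y = p" by auto
  define K where "K = {} \<union> {x \<in> X - {}. ray x = ray x\<^sub>0 \<and> a x \<le> p}"
  have "ray_model E X K R ray a b (\<lambda>v j. if v \<in> {} then e v j else if j = ray x\<^sub>0 then b v else 0)"
    unfolding K_def by (rule recenter[OF M[unfolded True] sym]) (use p in auto)
  moreover have yK: "y \<in> K" using y one D(5)[of y] by (auto simp: K_def)
  moreover have "x \<in> K" if "x \<in> X" "\<forall>v\<in>K. v = x \<or> E v x" for x
    using that yK D(6)[of y x] y one by (cases "y = x") (auto simp: K_def)
  ultimately show ?thesis by blast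
next
  case False
  note D = ray_modelD[OF M]
  define \<C> where "\<C> = {K. K\<^sub>0 \<subseteq> K \<and> K \<subseteq> X \<and> (\<forall>x\<in>K. \<forall>y\<in>K. x \<noteq> y \<longrightarrow> E x y)}"
  have "finite \<C>" using fin by (auto simp: \<C>_def intro: finite_subset[of _ "Pow X"])
  moreover have "K\<^sub>0 \<in> \<C>" using D(1,2) by (auto simp: \<C>_def)
  ultimately obtain K where K: "K \<in> \<C>" "\<And>L. L \<in> \<C> \<Longrightarrow> K \<subseteq> L \<Longrightarrow> L = K"
    using finite_has_maximal2[of \<C> K\<^sub>0] by auto
  have K0: "K\<^sub>0 \<subseteq> K" "K \<subseteq> X" and clique: "\<And>x y. x \<in> K \<Longrightarrow> y \<in> K \<Longrightarrow> x \<noteq> y \<Longrightarrow> E x y"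
    using K(1) by (auto simp: \<C>_def)
  have max: "x \<in> K" if "x \<in> X" "\<And>v. v \<in> K \<Longrightarrow> v = x \<or> E v x" for x
  proof -
    have "insert x K \<in> \<C>" using that K0 clique sym by (fastforce simp: \<C>_def)
    then show ?thesis using K(2)[of "insert x K"] by auto
  qed
  have ne: "K \<noteq> {}" using K0 False by auto
  show ?thesis
  proof (cases "K = K\<^sub>0")
    case True
    then show ?thesis using M ne max by blast
  next
    case new: False
    then obtain w where w: "w \<in> K" "w \<notin> K\<^sub>0" using K0 by blast
    have same: "ray x = ray w" if "x \<in> K - K\<^sub>0" for x
      using that w K0 clique[of x w] D(6)[of x w] by (cases "x = w") auto
    \<comment> \<open>The last left end among the new members lies in every member of
      \<open>K\<close>: old ones meet its owner \<open>y\<close>, and new ones start at or before it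
      but end beyond all vertices of \<open>K\<^sub>0\<close>.\<close>
    define p where "p = Max (a ` (K - K\<^sub>0))"
    have finK: "finite (K - K\<^sub>0)" using fin K0 by (auto intro: finite_subset)
    have p: "p \<in> a ` (K - K\<^sub>0)" "\<And>x. x \<in> K - K\<^sub>0 \<Longrightarrow> a x \<le> p"
      using finK w unfolding p_def by (auto intro!: Max_in)
    then obtain y where y: "y \<in> K" "y \<notin> K\<^sub>0" "a y = p" by auto
    have pe: "p \<le> e v (ray w)" if "v \<in> K\<^sub>0" for v
      using that y K0 same[of y] clique[of v y] D(8)[OF that, of y] by fastforce
    obtain v\<^sub>0 where v0: "v\<^sub>0 \<in> K\<^sub>0" using False by blast
    have pb: "p \<le> b x" if "x \<in> X - K\<^sub>0" "ray x = ray w" for x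
      using pe[OF v0] D(9)[OF v0 that(1)] that(2) by simp
    have "K = K\<^sub>0 \<union> {x \<in> X - K\<^sub>0. ray x = ray w \<and> a x \<le> p}" (is "_ = ?K'")
    proof (intro equalityI subsetI)
      fix x assume "x \<in> K" then show "x \<in> ?K'" using K0 p(2)[of x] same[of x] by auto
    next
      have M': "ray_model E X ?K' R ray a b (\<lambda>v j. if v \<in> K\<^sub>0 then e v j else if j = ray w then b v else 0)"
        by (rule recenter[OF M sym pe pb])
      have sub: "K \<subseteq> ?K'" using K0 p(2) same by auto
      fix x assume x: "x \<in> ?K'"
      then have "x \<in> X" using D(1) by auto
      then show "x \<in> K" using x sub ray_modelD(2)[OF M', of _ x] by (intro max) auto
    qed
    moreover have "ray_model E X ?K' R ray a b (\<lambda>v j. if v \<in> K\<^sub>0 then e v j else if j = ray w then b v else 0)"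
      by (rule recenter[OF M sym pe pb])
    ultimately show ?thesis using ne max by (metis (no_types, lifting))
  qed
qed

text \<open>Among the vertices of \<open>S\<close> outside \<open>K\<close> take one with the last
  left end. All its neighbours in \<open>S\<close> contain that point, so they are pairwise
  adjacent. If \<open>S\<close> lies in \<open>K\<close>, it is a clique and any vertex will do.
  Allowing every \<open>S\<close> makes this usable in each round of the elimination.\<close>

lemma simplicial_exists:
  assumes M: "ray_model E X K R ray a b e" and sym: "\<And>x y. E x y \<Longrightarrow> E y x"
    and S: "finite S" "S \<noteq> {}" "S \<subseteq> X"
  shows "\<exists>x\<in>S. \<forall>p\<in>S. \<forall>q\<in>S. p \<noteq> x \<and> q \<noteq> x \<and> E x p \<and> E x q \<and> p \<noteq> q \<longrightarrow> E p q"
proof (cases "S \<subseteq> K")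
  case True
  then show ?thesis using S(2) ray_modelD(2)[OF M] by blast
next
  case False
  note D = ray_modelD[OF M]
  define p where "p = Max (a ` (S - K))"
  have fin: "finite (S - K)" using S by auto
  have p: "p \<in> a ` (S - K)" "\<And>x. x \<in> S - K \<Longrightarrow> a x \<le> p"
    using fin False unfolding p_def by (auto intro!: Max_in)
  then obtain x where x: "x \<in> S - K" "a x = p" by auto
  then have xX: "x \<in> X - K" using S by auto
  have N: "ray y = ray x \<and> a y \<le> a x \<and> a x \<le> b y" if "y \<in> S - K" "E x y" "y \<noteq> x" for y
    using that D(6)[OF xX, of y] p(2)[of y] x S by auto
  have C: "a x \<le> e v (ray x)" if "v \<in> K" "E x v" for v
    using that D(8)[OF that(1) xX] sym by blast
  have "E y z" if yz: "y \<in> S" "z \<in> S" "y \<noteq> x" "z \<noteq> x" "E x y" "E x z" "y \<noteq> z" for y z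
  proof -
    have KN: "E v u" if "v \<in> K" "E x v" "u \<in> S - K" "E x u" "u \<noteq> x" for v u
      using C[OF that(1,2)] N[OF that(3-5)] D(8)[OF that(1), of u] that(3) S by auto
    have "E y z" if "y \<notin> K" "z \<notin> K"
      using N[of y] N[of z] that yz S D(6)[of y z] by auto
    then show ?thesis using yz KN[of y z] KN[of z y] D(2)[of y z] sym by blast
  qed
  then show ?thesis using x by blast
qed

section \<open>Layers around the center clique\<close>

definition levels :: "('v \<Rightarrow> 'v \<Rightarrow> bool) \<Rightarrow> 'v set \<Rightarrow> 'v set \<Rightarrow> ('v \<Rightarrow> nat) \<Rightarrow> bool" where
  "levels E X K l \<longleftrightarrow> (\<forall>x\<in>X. 0 < l x) \<and> (\<forall>x\<in>X. l x = 1 \<longleftrightarrow> x \<in> K) \<and>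
     (\<forall>x\<in>X. \<forall>y\<in>X. E x y \<longrightarrow> l x \<le> l y + 1) \<and>
     (\<forall>x\<in>X. 1 < l x \<longrightarrow> (\<exists>y\<in>X. E x y \<and> l y + 1 = l x))"

text \<open>The axioms of \<open>levels\<close> describe one plus the distance to \<open>K\<close>
  without mentioning paths. A predecessor under \<open>l'\<close> bounds \<open>l\<close> by one
  more than its own value, so induction along \<open>l'\<close> applies. The resulting uniqueness
  lets levels be carried along isomorphisms.\<close>

lemma levels_le:
  assumes "levels E X K l" "levels E X K l'" "x \<in> X"
  shows "l x \<le> l' x"
  using assms(3)
proof (induction "l' x" arbitrary: x rule: less_induct)
  case less
  show ?case
  proof (cases "l' x = 1")
    case True
    then show ?thesis using assms(1,2) less.prems unfolding levels_def by force
  next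
    case False
    then obtain y where "y \<in> X" "E x y" "l' y + 1 = l' x"
      using assms(2) less.prems unfolding levels_def by (metis less_one linorder_neqE_nat neq0_conv)
    moreover from this have "l x \<le> l y + 1" using assms(1) less.prems unfolding levels_def by blast
    ultimately show ?thesis using less.hyps[of y] by linarith
  qed
qed

lemma levels_unique: "levels E X K l \<Longrightarrow> levels E X K l' \<Longrightarrow> x \<in> X \<Longrightarrow> l x = l' x"
  by (meson antisym levels_le)

locale layered =
  fixes E :: "'v \<Rightarrow> 'v \<Rightarrow> bool" and X K R ray a b e l
  assumes model: "ray_model E X K R ray a b e" and levels: "levels E X K l"
    and sym: "E x y \<Longrightarrow> E y x" and fin: "finite X"
begin

lemmas D = ray_modelD[OF model]

lemma L:
  "x \<in> X \<Longrightarrow> 0 < l x" "x \<in> X \<Longrightarrow> l x = 1 \<longleftrightarrow> x \<in> K"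
  "x \<in> X \<Longrightarrow> y \<in> X \<Longrightarrow> E x y \<Longrightarrow> l x \<le> l y + 1"
  "x \<in> X \<Longrightarrow> 1 < l x \<Longrightarrow> \<exists>y\<in>X. E x y \<and> l y + 1 = l x"
  using levels unfolding levels_def by blast+

lemma outer: "x \<in> X \<Longrightarrow> 1 < l x \<longleftrightarrow> x \<in> X - K"
  using L(1,2)[of x] by auto

text \<open>Take a neighbour \<open>z\<close> of \<open>y\<close> in the previous layer. If
  \<open>z\<close> is in \<open>K\<close>, it reaches the left end of \<open>y\<close> and so also
  that of \<open>x\<close>. If \<open>z\<close> starts no earlier than \<open>x\<close>, induction
  applies to \<open>x\<close> and \<open>z\<close>. Otherwise the left end of \<open>x\<close> lies
  between those of \<open>z\<close> and \<open>y\<close>, hence inside \<open>z\<close>, and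
  \<open>x\<close> is adjacent to \<open>z\<close>.\<close>

lemma level_mono:
  assumes "x \<in> X - K" "y \<in> X - K" "ray x = ray y" "a x \<le> a y"
  shows "l x \<le> l y"
  using assms
proof (induction "l y" arbitrary: x y rule: less_induct)
  case less
  then obtain z where z: "z \<in> X" "E y z" "l z + 1 = l y" using L(4)[of y] outer[of y] by blast
  show ?case
  proof (cases "z \<in> K")
    case True
    then have "a y \<le> e z (ray y)" using D(8)[OF True less.prems(2)] sym[OF z(2)] by blast
    then have "E z x" using D(8)[OF True less.prems(1)] less.prems by simp
    then show ?thesis using L(3)[of x z] sym z less.prems by force
  next
    case False
    then have zX: "z \<in> X - K" using z by simp
    have yz: "y \<noteq> z" using z by auto
    then have r: "ray z = ray y" "a z \<le> b y" "a y \<le> b z"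
      using D(6)[OF less.prems(2) zX] z(2) by auto
    show ?thesis
    proof (cases "a x \<le> a z")
      case True
      then show ?thesis using less.hyps[of z x] less.prems zX r z by force
    next
      case False
      then have "x = z \<or> E x z"
        using D(6)[OF less.prems(1) zX] less.prems r D(5)[OF less.prems(1)] by auto
      then show ?thesis using L(3)[of x z] less.prems z by auto
    qed
  qed
qed

lemma earlier:
  "x \<in> X - K \<Longrightarrow> z \<in> X - K \<Longrightarrow> ray x = ray z \<Longrightarrow> l z < l x \<Longrightarrow> a z < a x"
  using level_mono[of x z] by (meson leD not_le)

text \<open>Let \<open>x\<close> start no later than \<open>y\<close>, and let \<open>z\<close>
  precede \<open>y\<close>, so \<open>z\<close> reaches the left end of \<open>y\<close>. By
  properness \<open>x\<close> ends no earlier than \<open>z\<close>: either \<open>z\<close> is in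
  \<open>K\<close>, or it is an interval that starts before \<open>x\<close>. So \<open>x\<close>
  reaches \<open>y\<close>.\<close>

lemma layer_clique:
  assumes "x \<in> X - K" "y \<in> X - K" "ray x = ray y" "l x = l y" "x \<noteq> y"
  shows "E x y"
proof -
  have *: "E x y" if xy: "x \<in> X - K" "y \<in> X - K" "ray x = ray y" "l x = l y" "x \<noteq> y" "a x \<le> a y" for x y
  proof -
    obtain z where z: "z \<in> X" "E y z" "l z + 1 = l y" using L(4)[of y] outer[of y] xy by blast
    have "a y \<le> b x"
    proof (cases "z \<in> K")
      case True
      then have "a y \<le> e z (ray y)" using D(8)[OF True xy(2)] sym[OF z(2)] by blast
      also have "\<dots> < b x" using D(9)[OF True xy(1)] xy(3) by simp
      finally show ?thesis by simp
    next
      case False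
      then have zX: "z \<in> X - K" using z by simp
      have "y \<noteq> z" using z by auto
      then have r: "ray z = ray y" "a y \<le> b z" using D(6)[OF xy(2) zX] z(2) by auto
      have "a z < a x" using earlier[OF xy(1) zX] r xy z by simp
      then have "b z \<le> b x" using D(7)[OF zX xy(1)] r xy by simp
      with r show ?thesis by simp
    qed
    then show ?thesis using D(6)[OF xy(1,2)] xy D(5)[OF xy(2)] by auto
  qed
  show ?thesis using assms *[of x y] *[of y x] sym by (metis nle_le)
qed

text \<open>The vertex with the smaller left end has the larger neighbourhood: a predecessor of the
  other one starts before both and reaches the later left end.\<close>

lemma previous_chain:
  assumes "x \<in> X - K" "y \<in> X - K" "ray x = ray y" "l x = l y"
  shows "(\<forall>z\<in>X. E x z \<and> l z + 1 = l x \<longrightarrow> E y z) \<or> (\<forall>z\<in>X. E y z \<and> l z + 1 = l y \<longrightarrow> E x z)"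
proof -
  have *: "E x z" if xy: "x \<in> X - K" "y \<in> X - K" "ray x = ray y" "l x = l y" "a x \<le> a y"
    and z: "z \<in> X" "E y z" "l z + 1 = l y" for x y z
  proof (cases "z \<in> K")
    case True
    then show ?thesis using D(8)[OF True xy(1)] D(8)[OF True xy(2)] sym[OF z(2)] xy by (auto intro: sym)
  next
    case False
    then have zX: "z \<in> X - K" using z by simp
    have "y \<noteq> z" "x \<noteq> z" using z xy by auto
    then have r: "ray z = ray y" "a y \<le> b z" using D(6)[OF xy(2) zX] z(2) by auto
    have "a z < a x" using earlier[OF xy(1) zX] r xy z by simp
    then show ?thesis using D(6)[OF xy(1) zX] \<open>x \<noteq> z\<close> r xy D(5)[OF xy(1)] by auto
  qed
  show ?thesis using assms *[of x y] *[of y x] by (metis nle_le)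
qed

text \<open>In a bipartite graph, if the neighbourhoods on one side form a chain, so do those on the
  other: two incomparable ones would give \<open>z\<close> and \<open>z'\<close> that contradict
  \<open>previous_chain\<close>. As \<open>x\<close> and \<open>y\<close> may lie in
  \<open>K\<close>, one ray at a time has to be considered.\<close>

lemma next_chain:
  assumes "x \<in> X" "y \<in> X" "l x = l y"
  shows "(\<forall>z\<in>X. E x z \<and> l z = l x + 1 \<and> ray z = i \<longrightarrow> E y z) \<or>
    (\<forall>z\<in>X. E y z \<and> l z = l y + 1 \<and> ray z = i \<longrightarrow> E x z)"
proof (rule ccontr)
  assume "\<not> ?thesis"
  then obtain z z' where z: "z \<in> X" "E x z" "l z = l x + 1" "ray z = i" "\<not> E y z"
    "z' \<in> X" "E y z'" "l z' = l y + 1" "ray z' = i" "\<not> E x z'" by blast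
  then have "z \<in> X - K" "z' \<in> X - K" using outer[of z] outer[of z'] L(1) assms by auto
  from previous_chain[OF this] show False using z assms sym by (metis add_right_cancel)
qed

lemma chain_card_eq:
  assumes "finite A" "finite A'" "A \<subseteq> A' \<or> A' \<subseteq> A" "card A = card A'" shows "A = A'"
  using assms card_subset_eq by metis

text \<open>Within a layer of a ray all vertices are adjacent, and towards the adjacent layers the
  neighbourhoods form chains, where equal size means equality. For vertices of \<open>K\<close> the
  next layer splits into one chain for each ray, which is why the counts by rays are needed.\<close>

lemma twins:
  assumes x: "x \<in> X" "y \<in> X" "l x = l y" "1 < l x \<Longrightarrow> ray x = ray y"
    and prev: "card {z \<in> X. E x z \<and> l z + 1 = l x} = card {z \<in> X. E y z \<and> l z + 1 = l y}"
    and "next": "card {z \<in> X. E x z \<and> l z = l x + 1} = card {z \<in> X. E y z \<and> l z = l y + 1}"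
    and rays: "\<And>z\<^sub>0. z\<^sub>0 \<in> X - K \<Longrightarrow> card {z \<in> X. E x z \<and> 1 < l z \<and> ray z = ray z\<^sub>0} =
      card {z \<in> X. E y z \<and> 1 < l z \<and> ray z = ray z\<^sub>0}"
    and z: "z \<in> X" "z \<noteq> x" "z \<noteq> y" "E x z"
  shows "E y z"
proof (cases "1 < l x")
  case True
  then have xK: "x \<in> X - K" "y \<in> X - K" and r: "ray x = ray y" using x outer[of x] outer[of y] by auto
  have ray: "ray u = ray x" if "u \<in> X - K" "E x u \<or> E y u" for u
    using that D(6)[OF xK(1) that(1)] D(6)[OF xK(2) that(1)] r by (cases "u = x \<or> u = y") auto
  consider "l z = l x" | "l z + 1 = l x" | "l z = l x + 1"
    using L(3)[OF x(1) z(1,4)] L(3)[OF z(1) x(1) sym[OF z(4)]] by linarith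
  then show ?thesis
  proof cases
    case 1
    then have zK: "z \<in> X - K" using outer[of z] True z by simp
    then show ?thesis using ray[OF zK] z 1 x r by (intro layer_clique[OF xK(2) zK]) auto
  next
    case 2
    have "{z \<in> X. E x z \<and> l z + 1 = l x} = {z \<in> X. E y z \<and> l z + 1 = l y}"
      using prev previous_chain[OF xK r x(3)] x(3) fin by (intro chain_card_eq) auto
    then show ?thesis using 2 z by blast
  next
    case 3
    have zK: "u \<in> X - K" if "u \<in> X" "l u = l x + 1" for u using outer[of u] L(1)[OF x(1)] that by simp
    have "{z \<in> X. E x z \<and> l z = l x + 1} = {z \<in> X. E y z \<and> l z = l y + 1}"
      using "next" next_chain[OF x(1-3), of "ray x"] x(3) fin ray zK
      by (intro chain_card_eq) (auto 0 3)
    then show ?thesis using 3 z by blast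
  qed
next
  case False
  then have lx: "l x = 1" using L(1)[OF x(1)] by simp
  show ?thesis
  proof (cases "z \<in> K")
    case True
    then show ?thesis using D(2)[of y z] L(2)[OF x(2)] lx x(3) z by auto
  next
    case zK: False
    then have zX: "z \<in> X - K" using z by simp
    \<comment> \<open>Neighbours of a vertex of \<open>K\<close> outside \<open>K\<close> are in the
      next layer, so counting by rays is counting in that layer, ray by ray.\<close>
    have l2: "1 < l u \<and> ray u = ray z \<longleftrightarrow> l u = l x + 1 \<and> ray u = ray z" if "u \<in> X" "E x u \<or> E y u" for u
    proof -
      have "l u \<le> 2"
        using that L(3)[of u x] L(3)[of u y] x lx sym by (auto simp: numeral_2_eq_2)
      then show ?thesis using lx by auto
    qed
    let ?A = "\<lambda>x. {u \<in> X. E x u \<and> 1 < l u \<and> ray u = ray z}"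
    have A: "?A x = {u \<in> X. E x u \<and> l u = l x + 1 \<and> ray u = ray z}"
      "?A y = {u \<in> X. E y u \<and> l u = l y + 1 \<and> ray u = ray z}"
      using l2 x(3) by auto
    have "?A x \<subseteq> ?A y \<or> ?A y \<subseteq> ?A x"
      unfolding A using next_chain[OF x(1-3), of "ray z"] x(3) by auto
    then have "?A x = ?A y"
      using rays[OF zX] fin by (intro chain_card_eq) auto
    then show ?thesis using z outer[OF z(1)] zX by blast
  qed
qed

end

section \<open>Codes of ray maps\<close>

lemma bdiv_eq:
  assumes "0 < b" "a div b \<le> B" shows "bdiv B a b = a div b"
proof -
  have "{q. q < B \<and> min (q + 1) B * b \<le> a} = {..<a div b}"
  proof (intro set_eqI iffI; simp; (elim conjE)?)
    fix q assume "q < B" "min (Suc q) B * b \<le> a"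
    then have "Suc q * b \<le> a" by (simp add: min_def)
    then show "q < a div b" using assms(1) by (simp add: less_eq_div_iff_mult_less_eq flip: Suc_le_eq)
  next
    fix q assume q: "q < a div b"
    then have "Suc q * b \<le> a" using assms(1) by (simp add: less_eq_div_iff_mult_less_eq flip: Suc_le_eq)
    then show "q < B \<and> min (Suc q) B * b \<le> a" using q assms(2) by (simp add: min_def)
  qed
  then show ?thesis by (simp add: bdiv_def)
qed

lemma digit_eq:
  assumes "0 < D" "D \<le> B" "j \<le> B" "c \<le> B" shows "digit B D c j = c div D ^ j mod D"
proof -
  have le: "c div m \<le> B" for m using assms(4) div_le_dividend le_trans by blast
  have 1: "bdiv B c (min D B ^ min j B) = c div D ^ j"
    using assms le by (simp add: min_def bdiv_eq)
  have le2: "c div D ^ j div D \<le> B" using le div_le_dividend le_trans by blast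
  then have "bdiv B (c div D ^ j) D = c div D ^ j div D" using assms(1) by (rule bdiv_eq[rotated])
  then show ?thesis
    unfolding digit_def 1 using le2 by (simp add: min_def minus_div_mult_eq_mod)
qed

lemma digits_exist:
  fixes D :: nat assumes "\<And>j. j < k \<Longrightarrow> g j < D"
  shows "\<exists>c < D ^ k. \<forall>j<k. c div D ^ j mod D = g j"
  using assms
proof (induction k)
  case (Suc k)
  then obtain c where c: "c < D ^ k" "\<And>j. j < k \<Longrightarrow> c div D ^ j mod D = g j" by auto
  have g: "g k < D" "0 < D" using Suc.prems[of k] by auto
  have "c + g k * D ^ k < Suc (g k) * D ^ k" using c(1) by simp
  also have "\<dots> \<le> D * D ^ k" using g by (intro mult_right_mono) auto
  finally have "c + g k * D ^ k < D ^ Suc k" by simp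
  moreover have "(c + g k * D ^ k) div D ^ j mod D = g j" if "j < Suc k" for j
  proof (cases "j = k")
    case True
    then show ?thesis using c(1) g by simp
  next
    case False
    then have "j < k" using that by simp
    then obtain i where i: "k = j + Suc i" using less_imp_Suc_add[of j k] by auto
    have "(c + g k * D ^ k) div D ^ j = (c + D ^ j * (D * (g k * D ^ i))) div D ^ j"
      unfolding i by (simp add: power_add algebra_simps)
    also have "\<dots> = D * (g k * D ^ i) + c div D ^ j"
      using g by (intro div_mult_self2) simp
    finally show ?thesis using c(2)[of j] i by simp
  qed
  ultimately show ?case by blast
qed simp

text \<open>The codes of maps on \<open>d\<close> ray numbers must be within reach of a loop of
  length \<open>B\<close>. The estimate uses \<open>d \<le> 2 ^ d\<close> twice, giving
  \<open>d ^ d \<le> 2 ^ (d * d)\<close> and \<open>d * d \<le> 4 ^ d\<close>.\<close>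

lemma digit_bound: "d ^ d < bnd d n"
proof -
  have "d ^ d \<le> (2 ^ d) ^ d" by (intro power_mono) (auto simp: less_imp_le)
  also have "\<dots> = 2 ^ (d * d)" by (simp add: power_mult)
  also have "\<dots> < (2::nat) ^ 4 ^ (d + 1)"
  proof -
    have "d * d \<le> 2 ^ d * 2 ^ d" by (intro mult_mono) (auto simp: less_imp_le)
    also have "\<dots> = 4 ^ d" by (simp flip: power_mult_distrib)
    also have "\<dots> < (4::nat) ^ (d + 1)" by simp
    finally show ?thesis by simp
  qed
  finally show ?thesis by (simp add: bnd_def)
qed

section \<open>Correctness of the layers\<close>

locale layers =
  fixes E :: "nat \<Rightarrow> nat \<Rightarrow> bool" and N B :: nat and C :: "nat \<Rightarrow> nat \<Rightarrow> bool" and v :: nat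
  assumes EN: "E x y \<Longrightarrow> x < N \<and> y < N" and sym: "E x y \<Longrightarrow> E y x" and irr: "\<not> E x x" and NB: "N \<le> B"
    and Cv: "C v v" "C v x \<Longrightarrow> x = v \<or> E v x" "C v x \<Longrightarrow> x < N"
begin

abbreviation "l t x \<equiv> lev E B C t v x"

lemma lev_Suc: "l t x \<noteq> 0 \<Longrightarrow> l (Suc t) x = l t x"
  by simp

lemma lev_stable:
  assumes "l t x \<noteq> 0" "t \<le> s" shows "l s x = l t x"
  using assms(2) by (induction s rule: dec_induct) (use assms(1) lev_Suc in \<open>simp_all del: lev.simps\<close>)

lemma lev_le: "l t x \<le> Suc t"
  by (induction t arbitrary: x) (simp_all add: le_SucI)

lemma lev_time: "l t x = Suc s \<Longrightarrow> s \<le> t \<and> l s x = Suc s"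
proof (induction t)
  case (Suc t)
  show ?case
  proof (cases "l t x = 0")
    case True
    then have "l (Suc t) x = 0 \<or> l (Suc t) x = Suc (Suc t)" by simp
    then have "s = Suc t" using Suc.prems by (simp del: lev.simps)
    then show ?thesis using Suc.prems by simp
  next
    case False
    then show ?thesis using Suc.IH Suc.prems lev_Suc[OF False] by simp
  qed
qed (auto simp: of_bool_def split: if_splits)

lemma lev_1: "l t x = 1 \<longleftrightarrow> C v x"
proof
  assume "l t x = 1"
  then have "l 0 x = 1" using lev_time[of t x 0] by simp
  then show "C v x" by (auto simp: of_bool_def split: if_splits)
next
  assume "C v x"
  then show "l t x = 1" using lev_stable[of 0 x t] by simp
qed

lemma lev_pred:
  assumes "l t x = Suc (Suc s)" shows "\<exists>y. E x y \<and> l t y = Suc s"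
proof -
  have 1: "Suc s \<le> t" "l (Suc s) x = Suc (Suc s)" using lev_time[OF assms] by auto
  have "l s x = 0" using lev_Suc[of s x] 1(2) lev_le[of s x] by (cases "l s x = 0") auto
  then obtain y where "E x y" "l s y = Suc s" using 1(2) by (auto split: if_splits)
  then show ?thesis using lev_stable[of s y t] 1(1) by auto
qed

lemma lev_succ:
  assumes "E x y" "l t y = Suc s" "s < t" shows "l t x \<noteq> 0 \<and> l t x \<le> Suc (Suc s)"
proof -
  have y: "l s y = Suc s" using lev_time[OF assms(2)] by simp
  show ?thesis
  proof (cases "l s x = 0")
    case True
    have "y < B" using EN[OF assms(1)] NB by simp
    then have "l (Suc s) x = Suc (Suc s)" using True assms(1) y by auto
    then show ?thesis using lev_stable[of "Suc s" x t] assms(3) by simp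
  next
    case False
    then show ?thesis using lev_stable[of s x t] assms(3) lev_le[of s x] by simp
  qed
qed

lemma lev_conn: "l t x \<noteq> 0 \<Longrightarrow> E\<^sup>*\<^sup>* v x"
proof (induction "l t x" arbitrary: x rule: less_induct)
  case less
  show ?case
  proof (cases "l t x = 1")
    case True
    then show ?thesis using lev_1 Cv(2)[of x] by auto
  next
    case False
    then obtain s where s: "l t x = Suc (Suc s)"
      using less.prems by (metis One_nat_def not0_implies_Suc)
    then obtain y where y: "E x y" "l t y = Suc s" using lev_pred by blast
    then have "E\<^sup>*\<^sup>* v y" using less.hyps[of y] s by simp
    then show ?thesis using sym[OF y(1)] by simp
  qed
qed

lemma lev_lt_N: "l t x \<noteq> 0 \<Longrightarrow> x < N"
proof (cases "l t x = 1")
  case True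
  then show ?thesis using lev_1 Cv(3) by simp
next
  case False
  moreover assume "l t x \<noteq> 0"
  ultimately obtain s where "l t x = Suc (Suc s)" by (metis One_nat_def not0_implies_Suc)
  then show ?thesis using lev_pred EN by blast
qed

text \<open>A vertex reached in the last round proves that every earlier round reached a new vertex
  too. As there are at most \<open>N\<close> vertices, the search is finished before
  \<open>B\<close> rounds are over.\<close>

lemma card_lev: "l t x = Suc t \<Longrightarrow> Suc t \<le> card {y. l t y \<noteq> 0}"
proof (induction t arbitrary: x)
  case 0
  have "finite {y. l 0 y \<noteq> 0}" using lev_lt_N[of 0] by (auto intro: finite_subset[of _ "{..<N}"] simp del: lev.simps)
  moreover have "{v} \<subseteq> {y. l 0 y \<noteq> 0}" using Cv(1) by simp
  ultimately have "card {v} \<le> card {y. l 0 y \<noteq> 0}" by (rule card_mono)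
  then show ?case by (simp del: lev.simps)
next
  case (Suc t)
  have x0: "l t x = 0" using lev_Suc[of t x] Suc.prems lev_le[of t x] by (cases "l t x = 0") auto
  obtain y where "l (Suc t) y = Suc t" using lev_pred[OF Suc.prems] by blast
  then have "l t y = Suc t" using lev_time by blast
  then have 1: "Suc t \<le> card {y. l t y \<noteq> 0}" by (rule Suc.IH)
  have fin: "finite {y. l t y \<noteq> 0}" for t
    using lev_lt_N[of t] by (auto intro: finite_subset[of _ "{..<N}"] simp del: lev.simps)
  have "insert x {y. l t y \<noteq> 0} \<subseteq> {y. l (Suc t) y \<noteq> 0}"
    using Suc.prems lev_Suc by (auto simp del: lev.simps)
  then have "card (insert x {y. l t y \<noteq> 0}) \<le> card {y. l (Suc t) y \<noteq> 0}"
    using fin by (intro card_mono)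
  with 1 x0 fin[of t] show ?case by simp
qed

lemma lev_lt: "l B x \<noteq> 0 \<Longrightarrow> l B x \<le> B"
proof (rule ccontr)
  assume "\<not> l B x \<le> B"
  then have "l B x = Suc B" using lev_le[of B x] by simp
  from card_lev[OF this] have "Suc B \<le> card {y. l B y \<noteq> 0}" .
  also have "\<dots> \<le> card {..<N}" using lev_lt_N by (intro card_mono) auto
  finally show False using NB by simp
qed

lemma lev_closed:
  assumes "E x y" "l B y \<noteq> 0" shows "l B x \<noteq> 0 \<and> l B x \<le> l B y + 1"
proof -
  obtain s where s: "l B y = Suc s" using assms(2) not0_implies_Suc by blast
  \<comment> \<open>By \<open>lev_lt\<close> at least one round remains after the one that reached
    \<open>y\<close>.\<close>
  then show ?thesis using lev_succ[OF assms(1) s] lev_lt[of y] by simp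
qed

lemma lev_pos_iff: "0 < l B x \<longleftrightarrow> E\<^sup>*\<^sup>* v x"
proof
  assume "E\<^sup>*\<^sup>* v x"
  then show "0 < l B x"
  proof (induction rule: rtranclp_induct)
    case base
    then show ?case using lev_1[of B v] Cv(1) by simp
  next
    case (step y z)
    then show ?case using lev_closed[OF sym[OF step(2)]] by simp
  qed
qed (simp add: lev_conn)

definition "X = {x. E\<^sup>*\<^sup>* v x}"

lemma X_lev: "x \<in> X \<longleftrightarrow> 0 < l B x"
  by (simp add: X_def lev_pos_iff)

lemma levels_lev: "levels E X {x. C v x} (l B)"
  unfolding levels_def
proof (intro conjI ballI impI)
  show "0 < l B x" if "x \<in> X" for x using that by (simp add: X_lev)
  show "l B x = 1 \<longleftrightarrow> x \<in> {x. C v x}" for x using lev_1 by simp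
  show "l B x \<le> l B y + 1" if "y \<in> X" "E x y" for x y
    using that lev_closed[OF that(2)] by (simp add: X_lev)
  show "\<exists>y\<in>X. E x y \<and> l B y + 1 = l B x" if gt: "1 < l B x" for x
  proof -
    obtain s where s: "l B x = Suc (Suc s)" using less_imp_Suc_add[OF gt] by auto
    then obtain y where "E x y" "l B y = Suc s" using lev_pred by blast
    then show ?thesis using s by (auto simp: X_lev)
  qed
qed

lemma X_N: "x \<in> X \<Longrightarrow> x < N" using lev_lt_N X_lev by blast

lemma finite_X: "finite X" using X_N by (auto intro: finite_subset[of _ "{..<N}"])

end

section \<open>Recognising the rays\<close>

locale ray_layers = layers E N B C v for E :: "nat \<Rightarrow> nat \<Rightarrow> bool" and N B C v +
  fixes R :: "nat set" and ray a b :: "nat \<Rightarrow> nat" and e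
  assumes model: "ray_model E X {x. C v x} R ray a b e" and finR: "finite R"
begin

sublocale layered E X "{x. C v x}" R ray a b e "l B"
  by unfold_locales (use model levels_lev sym finite_X in auto)

definition "\<mu> i = least B (\<lambda>y. y \<in> X \<and> l B y = 2 \<and> ray y = i)"

lemma outerX: "1 < l B x \<longleftrightarrow> x \<in> X - {x. C v x}"
  using outer[of x] by (auto simp: X_lev)

lemma adjacent_ray:
  assumes "E x y" "1 < l B x" "1 < l B y" shows "ray x = ray y"
  using D(6)[of x y] assms irr outerX by (metis)

text \<open>Walking back layer by layer stays on the ray until the clique is reached.\<close>

lemma second_layer: "1 < l B x \<Longrightarrow> \<exists>y. l B y = 2 \<and> ray y = ray x"
proof (induction "l B x" arbitrary: x rule: less_induct)
  case less
  then obtain y where y: "y \<in> X" "E x y" "l B y + 1 = l B x" using L(4)[of x] outerX by auto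
  show ?case
  proof (cases "l B y = 1")
    case True
    then show ?thesis using y by (intro exI[of _ x]) simp
  next
    case False
    then have "1 < l B y" using y X_lev[of y] by simp
    then show ?thesis using less.hyps[of y] y adjacent_ray[OF y(2) less.prems] by auto
  qed
qed

lemma \<mu>:
  assumes "1 < l B x"
  shows "\<mu> (ray x) < B" "l B (\<mu> (ray x)) = 2" "ray (\<mu> (ray x)) = ray x"
proof -
  obtain y where "l B y = 2" "ray y = ray x" using second_layer[OF assms] by blast
  moreover from this have "y \<in> X" by (simp add: X_lev)
  moreover from this have "y < B" using X_N NB by fastforce
  ultimately have "\<mu> (ray x) < B \<and> (\<mu> (ray x) \<in> X \<and> l B (\<mu> (ray x)) = 2 \<and> ray (\<mu> (ray x)) = ray x)"
    unfolding \<mu>_def using least_props[of y B "\<lambda>y. y \<in> X \<and> l B y = 2 \<and> ray y = ray x"] by blast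
  then show "\<mu> (ray x) < B" "l B (\<mu> (ray x)) = 2" "ray (\<mu> (ray x)) = ray x" by blast+
qed

text \<open>The layer next to the clique is a clique on each ray and has no edges between rays. So
  being equal or adjacent to \<open>x\<close> picks out exactly its vertices on the ray of
  \<open>x\<close>, and the least of them names the ray. Vertices further out inherit the name from
  a neighbour in the previous layer, which is on the same ray.\<close>

lemma lead_partial: "t \<le> B \<Longrightarrow> 1 < l t x \<Longrightarrow> lead E B C t v x = \<mu> (ray x)"
proof (induction t arbitrary: x)
  case 0
  then show ?case using lev_le[of 0 x] by (simp del: lev.simps)
next
  case (Suc t)
  have x: "1 < l B x" using Suc.prems lev_stable[of "Suc t" x B] by (simp del: lev.simps)
  show ?case
  proof (cases "l t x = 0")
    case False
    then show ?thesis using Suc lev_Suc[OF False] by (simp del: lev.simps)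
  next
    case True
    then have "\<exists>y<B. E x y \<and> l t y = Suc t" using Suc.prems by (auto split: if_splits)
    then obtain y where y: "y < B" "E x y" "l t y = Suc t" by blast
    have eq: "lead E B C (Suc t) v x = (if t = 0
       then least B (\<lambda>y. l t y = 0 \<and> (\<exists>z<B. E y z \<and> l t z = Suc t) \<and> (y = x \<or> E x y))
       else lead E B C t v (least B (\<lambda>y. E x y \<and> l t y = Suc t)))"
      using True y by (simp del: lev.simps) blast
    show ?thesis
    proof (cases "t = 0")
      case t: True
      have lx: "l B x = 2" using t Suc.prems lev_le[of "Suc 0" x] lev_stable[of "Suc 0" x B] by (simp del: lev.simps)
      have "(l t y = 0 \<and> (\<exists>z<B. E y z \<and> l t z = Suc t) \<and> (y = x \<or> E x y)) \<longleftrightarrow>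
        (y \<in> X \<and> l B y = 2 \<and> ray y = ray x)" for y
      proof
        assume asm: "l t y = 0 \<and> (\<exists>z<B. E y z \<and> l t z = Suc t) \<and> (y = x \<or> E x y)"
        then obtain z where z: "E y z" "l B z = 1" using t lev_1[of 0] lev_1[of B] by auto
        have "\<not> C v y" using asm lev_1[of t y] by simp
        then have "l B y \<noteq> 1" using lev_1[of B y] by simp
        then have "l B y = 2" using lev_closed[OF z(1)] z(2) by simp
        then show "y \<in> X \<and> l B y = 2 \<and> ray y = ray x"
          using asm adjacent_ray[of x y] x by (auto simp: X_lev)
      next
        assume asm: "y \<in> X \<and> l B y = 2 \<and> ray y = ray x"
        then obtain z where z: "E y z" "l B z = 1" using lev_pred[of B y 0] by auto
        have "l t y = 0" using asm t lev_1[of B y] by auto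
        moreover have "l t z = Suc t" using z t lev_1[of B z] by simp
        moreover have "z < B" using EN[OF z(1)] NB by simp
        moreover have "y = x \<or> E x y"
          using layer_clique[of x y] outerX[of x] outerX[of y] asm lx by auto
        ultimately show "l t y = 0 \<and> (\<exists>z<B. E y z \<and> l t z = Suc t) \<and> (y = x \<or> E x y)"
          using z(1) by blast
      qed
      then show ?thesis unfolding eq \<mu>_def using t by simp
    next
      case t: False
      define w where "w = least B (\<lambda>y. E x y \<and> l t y = Suc t)"
      have w: "E x w" "l t w = Suc t"
        unfolding w_def using least_props(2)[of y B "\<lambda>y. E x y \<and> l t y = Suc t"] y by auto
      then have "lead E B C t v w = \<mu> (ray w)" using Suc t by simp
      moreover have "1 < l B w" using w(2) t lev_stable[of t w B] Suc.prems by simp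
      then have "ray x = ray w" using adjacent_ray[OF w(1) x] by simp
      ultimately show ?thesis unfolding eq w_def[symmetric] using t by simp
    qed
  qed
qed

lemma lead_eq: "1 < l B x \<Longrightarrow> lead E B C B v x = \<mu> (ray x)"
  by (rule lead_partial) simp_all

text \<open>The vertex \<open>\<mu> i\<close> lies on ray \<open>i\<close> whenever that ray occurs,
  so different rays have different leads. There are at most as many leads as rays, and the rank is
  the position among the leads.\<close>

lemma rank_ray:
  fixes rk defines "rk \<equiv> rank B (lev E B C B) (lead E B C B) v"
  assumes x: "1 < l B x"
  shows "rk x < card R" "1 < l B y \<Longrightarrow> rk x = rk y \<longleftrightarrow> ray x = ray y"
proof -
  define Z where "Z = {z. z < B \<and> (\<exists>y<B. 1 < l B y \<and> lead E B C B v y = z)}"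
  have finZ: "finite Z" by (simp add: Z_def)
  have rk: "rk x = card {z \<in> Z. z < \<mu> (ray x)}" if "1 < l B x" for x
    unfolding rk_def rank_def Z_def using lead_eq[OF that] by (intro arg_cong[where f = card]) auto
  have mem: "\<mu> (ray x) \<in> Z" if "1 < l B x" for x
    using that \<mu>(1)[OF that] lead_eq[OF that] lev_lt_N[of B x] NB by (auto simp: Z_def intro!: exI[of _ x])
  have less: "rk x < rk y" if "1 < l B x" "1 < l B y" "\<mu> (ray x) < \<mu> (ray y)" for x y
    unfolding rk[OF that(1)] rk[OF that(2)]
    by (rule psubset_card_mono) (use that(3) mem[OF that(1)] finZ in auto)
  have "Z \<subseteq> \<mu> ` R"
    using lead_eq D(3) outerX by (auto simp: Z_def)
  then have "card Z \<le> card R" using card_mono[of "\<mu> ` R" Z] card_image_le[OF finR, of \<mu>] finR by simp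
  moreover have "rk x < card Z"
    unfolding rk[OF x] by (rule psubset_card_mono) (use mem[OF x] finZ in auto)
  ultimately show "rk x < card R" by simp
  assume y: "1 < l B y"
  show "rk x = rk y \<longleftrightarrow> ray x = ray y"
  proof
    assume "rk x = rk y"
    then have "\<mu> (ray x) = \<mu> (ray y)" using less[OF x y] less[OF y x] by force
    then show "ray x = ray y" using \<mu>(3)[OF x] \<mu>(3)[OF y] by metis
  next
    assume "ray x = ray y"
    then show "rk x = rk y" using rk[OF x] rk[OF y] by simp
  qed
qed

end

section \<open>Comparing components\<close>

definition component :: "('v \<Rightarrow> 'v \<Rightarrow> bool) \<Rightarrow> 'v \<Rightarrow> 'v set" where
  "component E a = {x. E\<^sup>*\<^sup>* a x}"

definition iso_on :: "('v \<Rightarrow> 'v \<Rightarrow> bool) \<Rightarrow> ('w \<Rightarrow> 'w \<Rightarrow> bool) \<Rightarrow> 'v set \<Rightarrow> 'w set \<Rightarrow> ('v \<Rightarrow> 'w) \<Rightarrow> bool" where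
  "iso_on E E' X Y \<phi> \<longleftrightarrow> bij_betw \<phi> X Y \<and> (\<forall>x\<in>X. \<forall>y\<in>X. E x y \<longleftrightarrow> E' (\<phi> x) (\<phi> y))"

abbreviation "alike E a b \<equiv> \<exists>\<phi>. iso_on E E (component E a) (component E b) \<phi>"

text \<open>Classes with the same value have equal size, so bijections between them can be chosen
  separately and glued together.\<close>

lemma class_bijection:
  fixes s :: "'a \<Rightarrow> 'c" and t :: "'b \<Rightarrow> 'c"
  assumes fin: "finite X" "finite Y"
    and XY: "\<And>x. x \<in> X \<Longrightarrow> \<exists>y\<in>Y. t y = s x" and YX: "\<And>y. y \<in> Y \<Longrightarrow> \<exists>x\<in>X. s x = t y"
    and card: "\<And>x. x \<in> X \<Longrightarrow> card {z \<in> X. s z = s x} = card {z \<in> Y. t z = s x}"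
  shows "\<exists>\<phi>. bij_betw \<phi> X Y \<and> (\<forall>x\<in>X. t (\<phi> x) = s x)"
proof -
  have "\<exists>f. bij_betw f {z \<in> X. s z = c} {z \<in> Y. t z = c}" if "c \<in> s ` X" for c
    using that fin card by (intro finite_same_card_bij) auto
  then obtain f where f: "\<And>c. c \<in> s ` X \<Longrightarrow> bij_betw (f c) {z \<in> X. s z = c} {z \<in> Y. t z = c}"
    by metis
  define \<phi> where "\<phi> x = f (s x) x" for x
  have \<phi>: "\<phi> x \<in> Y \<and> t (\<phi> x) = s x" if "x \<in> X" for x
    using bij_betwE[OF f[of "s x"]] that by (auto simp: \<phi>_def)
  have "inj_on \<phi> X"
  proof (rule inj_onI)
    fix x y assume xy: "x \<in> X" "y \<in> X" "\<phi> x = \<phi> y"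
    then have "s x = s y" using \<phi> by metis
    then show "x = y"
      using xy bij_betw_imp_inj_on[OF f[of "s x"]] by (auto simp: \<phi>_def inj_on_def)
  qed
  moreover have "y \<in> \<phi> ` X" if y: "y \<in> Y" for y
  proof -
    obtain x where x: "x \<in> X" "s x = t y" using YX[OF y] by blast
    then have "f (s x) ` {z \<in> X. s z = s x} = {z \<in> Y. t z = s x}"
      by (intro bij_betw_imp_surj_on f imageI x(1))
    then have "y \<in> f (s x) ` {z \<in> X. s z = s x}" using x y by simp
    then obtain z where "z \<in> X" "s z = s x" "y = f (s x) z" by blast
    then have "z \<in> X" "y = \<phi> z" by (simp_all add: \<phi>_def)
    then show ?thesis by blast
  qed
  ultimately have "bij_betw \<phi> X Y" using \<phi> by (auto simp: bij_betw_def)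
  with \<phi> show ?thesis by blast
qed

text \<open>The ends of the edge are exchanged for their twins one at a time. This breaks down if
  \<open>x'\<close> is \<open>u\<close>, as the first exchange would produce a loop; but then all
  four vertices belong to the same class and one exchange, or symmetry alone, is enough.\<close>

lemma twin_exchange:
  assumes tw: "\<And>p q z. p \<in> X \<Longrightarrow> q \<in> X \<Longrightarrow> z \<in> X \<Longrightarrow> s p = s q \<Longrightarrow> z \<noteq> p \<Longrightarrow> z \<noteq> q \<Longrightarrow> E p z \<longleftrightarrow> E q z"
    and sym: "\<And>x y. E x y \<longleftrightarrow> E y x"
    and X: "x \<in> X" "x' \<in> X" "u \<in> X" "u' \<in> X" and s: "s x = s u" "s x' = s u'" and ne: "x \<noteq> x'" "u \<noteq> u'"
  shows "E x x' \<longleftrightarrow> E u u'"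
proof (cases "x' = u")
  case False
  then have "E x x' \<longleftrightarrow> E u x'" using tw[of x u x'] X s ne by auto
  also have "\<dots> \<longleftrightarrow> E u u'" using tw[of x' u' u] X s ne False sym by metis
  finally show ?thesis .
next
  case u: True
  show ?thesis
  proof (cases "x = u'")
    case True
    then show ?thesis using u sym by simp
  next
    case False
    then have "E u' u \<longleftrightarrow> E x u" using tw[of u' x u] X s ne u by auto
    then show ?thesis using u sym by metis
  qed
qed

lemma component_eq:
  assumes "\<And>x y. E x y \<Longrightarrow> E y x" "b \<in> component E a" shows "component E b = component E a"
proof -
  have "symp E\<^sup>*\<^sup>*" using assms(1) by (intro symp_rtranclp) (auto simp: symp_def)
  then have "E\<^sup>*\<^sup>* b a" using assms(2) by (auto simp: component_def symp_def)
  then show ?thesis using assms(2) unfolding component_def by (auto intro: rtranclp_trans)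
qed

text \<open>Turns the comparison \<open>same\<close> into equality of values computed on each side
  alone, which is the form that \<open>class_bijection\<close> expects. The default 0 hides the
  entries that \<open>same\<close> does not compare.\<close>

definition signature :: "nat \<Rightarrow> (nat \<Rightarrow> nat \<Rightarrow> bool) \<Rightarrow> (nat \<Rightarrow> nat) \<Rightarrow> (nat \<Rightarrow> nat) \<Rightarrow> nat \<Rightarrow>
    nat \<times> nat \<times> nat \<times> nat \<times> (nat \<Rightarrow> nat)" where
  "signature B E l lab x = (l x, if 1 < l x then lab x else 0,
     card {z. z < B \<and> (E x z \<and> l z + 1 = l x)}, card {z. z < B \<and> (E x z \<and> l z = l x + 1)},
     \<lambda>i. if i < B then card {z. z < B \<and> (E x z \<and> 1 < l z \<and> lab z = i)} else 0)"

lemma same_iff: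
  "same B D E l m v w c x y \<longleftrightarrow>
    signature B E (l v) (rank B l m v) x = signature B E (l w) (\<lambda>z. digit B D c (rank B l m w z)) y"
  unfolding same_def signature_def by (auto simp: fun_eq_iff)

section \<open>Soundness and completeness of the comparison\<close>

locale ugraph =
  fixes E :: "nat \<Rightarrow> nat \<Rightarrow> bool" and N B :: nat
  assumes EN: "E x y \<Longrightarrow> x < N \<and> y < N" and sym: "E x y \<Longrightarrow> E y x" and irr: "\<not> E x x" and NB: "N \<le> B"
begin

abbreviation "C \<equiv> cand E B N"
abbreviation "lv \<equiv> lev E B C B"
abbreviation "ld \<equiv> lead E B C B"

lemma layers_C: "v < N \<Longrightarrow> layers E N B C v"
  by unfold_locales (use EN sym irr NB in \<open>auto simp: cand_def\<close>)

lemma lev_large: "N \<le> v \<Longrightarrow> lev E B C t v x = 0"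
  by (induction t arbitrary: x) (auto simp: cand_def)

lemma lev_pos: "0 < lv v x \<longleftrightarrow> v < N \<and> x \<in> component E v"
proof (cases "v < N")
  case True
  then interpret layers E N B C v by (rule layers_C)
  show ?thesis using True lev_pos_iff by (simp add: component_def)
qed (simp add: lev_large)

lemma component_N:
  assumes "v < N" shows "component E v \<subseteq> {..<N}"
proof -
  interpret layers E N B C v by (rule layers_C) fact
  show ?thesis using X_N by (auto simp: X_def component_def)
qed

lemma finite_component: "v < N \<Longrightarrow> finite (component E v)"
  using component_N finite_subset by blast

text \<open>No model is assumed here. A bijection that respects the signatures comes from the equal
  class sizes, and the last clause of \<open>match\<close> says that any such bijection preserves
  adjacency.\<close>

lemma linked_imp_iso:
  assumes "linked B D E lv ld a b"
  shows "alike E a b"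
proof -
  obtain v w c where "0 < lv v a" "0 < lv w b" and m: "match B D E lv ld v w c"
    using assms unfolding linked_def by blast
  then have vw: "v < N" "w < N" "component E a = component E v" "component E b = component E w"
    using component_eq[of E, OF sym] by (simp_all add: lev_pos)
  define X where "X = component E v"
  define Y where "Y = component E w"
  have XY: "X \<subseteq> {..<B}" "Y \<subseteq> {..<B}" and fin: "finite X" "finite Y"
    using component_N finite_component NB vw unfolding X_def Y_def by fastforce+
  have pos: "0 < lv v x \<longleftrightarrow> x \<in> X" "0 < lv w x \<longleftrightarrow> x \<in> Y" for x
    using vw by (simp_all add: lev_pos X_def Y_def)
  define s where "s = signature B E (lv v) (rank B lv ld v)"
  define t where "t = signature B E (lv w) (\<lambda>z. digit B D c (rank B lv ld w z))"
  have same: "same B D E lv ld v w c x y \<longleftrightarrow> s x = t y" for x y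
    unfolding s_def t_def by (rule same_iff)
  note m' = m[unfolded match_def same pos]
  note m3 = m'[THEN conjunct2, THEN conjunct2, THEN conjunct1, rule_format]
    and m4 = m'[THEN conjunct2, THEN conjunct2, THEN conjunct2, rule_format]
  have less_B: "x < B" if "x \<in> X \<or> x \<in> Y" for x using XY that by auto
  have 1: "\<exists>y\<in>Y. t y = s x" if "x \<in> X" for x
    using m that XY unfolding match_def same pos by (metis lessThan_iff subset_iff)
  have 2: "\<exists>x\<in>X. s x = t y" if "y \<in> Y" for y
    using m that XY unfolding match_def same pos by (metis lessThan_iff subset_iff)
  have 3: "card {z \<in> X. s z = s x} = card {z \<in> Y. t z = s x}" if x: "x \<in> X" for x
  proof -
    obtain y where y: "y \<in> Y" "t y = s x" using 1[OF x] by blast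
    have "card {x'. x' < B \<and> (x' \<in> X \<and> s x' = t y)} = card {y'. y' < B \<and> (y' \<in> Y \<and> s x = t y')}"
      using m3[of x y] less_B x y by simp
    moreover have "{x'. x' < B \<and> (x' \<in> X \<and> s x' = t y)} = {z \<in> X. s z = s x}"
      "{y'. y' < B \<and> (y' \<in> Y \<and> s x = t y')} = {z \<in> Y. t z = s x}"
      using XY y by auto
    ultimately show ?thesis by simp
  qed
  obtain \<phi> where \<phi>: "bij_betw \<phi> X Y" "\<And>x. x \<in> X \<Longrightarrow> t (\<phi> x) = s x"
    using class_bijection[OF fin 1 2 3] by blast
  have "E x x' \<longleftrightarrow> E (\<phi> x) (\<phi> x')" if x: "x \<in> X" "x' \<in> X" for x x'
  proof (cases "x = x'")
    case True
    then show ?thesis using irr by simp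
  next
    case False
    have Y: "\<phi> x \<in> Y" "\<phi> x' \<in> Y" using \<phi>(1) x by (auto dest: bij_betwE)
    have "\<phi> x \<noteq> \<phi> x'" using \<phi>(1) x False by (auto simp: bij_betw_def dest: inj_onD)
    then show ?thesis
      using m4[of x x' "\<phi> x" "\<phi> x'"] less_B x Y False \<phi>(2) by simp
  qed
  then have "iso_on E E X Y \<phi>" using \<phi>(1) by (simp add: iso_on_def)
  then show ?thesis using vw by (auto simp: X_def Y_def)
qed

lemma surv_le: "surv E B t x \<le> t"
  by (induction t) (auto simp: le_SucI)

lemma surv_mono: "t \<le> s \<Longrightarrow> surv E B t x \<le> surv E B s x"
  by (induction s rule: dec_induct) (auto intro: le_trans)

lemma surv_stop: "surv E B t x < t \<Longrightarrow> t \<le> s \<Longrightarrow> surv E B s x = surv E B t x"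
proof (induction s)
  case (Suc s)
  show ?case
  proof (cases "t = Suc s")
    case False
    then have "surv E B s x = surv E B t x" "surv E B s x \<noteq> s" using Suc by auto
    then show ?thesis by simp
  qed simp
qed simp

text \<open>A vertex still present before round \<open>t\<close> has survived \<open>t\<close>
  rounds, and one removed earlier keeps its count. So whether the threshold \<open>t\<close> is met
  is settled after \<open>t\<close> rounds.\<close>

lemma surv_iff: "t \<le> s \<Longrightarrow> t \<le> surv E B s x \<longleftrightarrow> t \<le> surv E B t x"
  using surv_mono[of t s x] surv_stop[of t x s] by (metis le_trans linorder_not_less)

text \<open>Every maximal clique consists of its first removed vertex and the neighbours that were
  still there at that time.\<close>

lemma maximal_clique_cand:
  assumes simplicial: "\<And>S. S \<subseteq> {..<N} \<Longrightarrow> S \<noteq> {} \<Longrightarrow>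
      \<exists>x\<in>S. \<forall>p\<in>S. \<forall>q\<in>S. p \<noteq> x \<and> q \<noteq> x \<and> E x p \<and> E x q \<and> p \<noteq> q \<longrightarrow> E p q"
    and K: "K \<noteq> {}" "K \<subseteq> {..<N}" "\<And>x y. x \<in> K \<Longrightarrow> y \<in> K \<Longrightarrow> x \<noteq> y \<Longrightarrow> E x y"
    and max: "\<And>x. x < N \<Longrightarrow> (\<And>v. v \<in> K \<Longrightarrow> v = x \<or> E v x) \<Longrightarrow> x \<in> K"
  shows "\<exists>v\<in>K. {x. C v x} = K"
proof -
  define S where "S t = {x. x < N \<and> t \<le> surv E B t x}" for t
  have SN: "S t \<subseteq> {..<N}" "finite (S t)" for t by (auto simp: S_def)
  have step: "surv E B (Suc t) x = t"
    if x: "x \<in> S t" and s: "\<forall>p\<in>S t. \<forall>q\<in>S t. E x p \<and> E x q \<and> p \<noteq> q \<longrightarrow> E p q" for t x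
  proof -
    have "E p q" if "t \<le> surv E B t p" "t \<le> surv E B t q" "E x p" "E x q" "p \<noteq> q" for p q
      using that s EN[OF that(3)] EN[OF that(4)] by (simp add: S_def)
    moreover have "surv E B t x = t" using x surv_le[of t x] by (simp add: S_def)
    ultimately show ?thesis by simp
  qed
  \<comment> \<open>While vertices are left, one of them is simplicial and goes, so \<open>N\<close>
    rounds remove everything.\<close>
  have card: "card (S t) \<le> N - t" for t
  proof (induction t)
    case 0
    show ?case using card_mono[OF _ SN(1)[of 0]] by simp
  next
    case (Suc t)
    have sub: "S (Suc t) \<subseteq> S t"
    proof
      fix x assume "x \<in> S (Suc t)"
      then have "x < N" "t \<le> surv E B (Suc t) x" unfolding S_def by (blast, metis (mono_tags) Suc_leD mem_Collect_eq)
      then show "x \<in> S t" using surv_iff[OF le_SucI[OF order_refl], of t x] unfolding S_def by blast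
    qed
    show ?case
    proof (cases "S t = {}")
      case False
      then obtain x where x0: "x \<in> S t" "\<forall>p\<in>S t. \<forall>q\<in>S t. p \<noteq> x \<and> q \<noteq> x \<and> E x p \<and> E x q \<and> p \<noteq> q \<longrightarrow> E p q"
        using simplicial[OF SN(1)] by blast
      have "\<forall>p\<in>S t. \<forall>q\<in>S t. E x p \<and> E x q \<and> p \<noteq> q \<longrightarrow> E p q"
        using x0(2) irr by metis
      with x0(1) have "surv E B (Suc t) x = t" by (rule step)
      then have "x \<notin> S (Suc t)"
        unfolding S_def by (metis (mono_tags) mem_Collect_eq not_less_eq_eq order_refl)
      then have "card (S (Suc t)) < card (S t)" using sub SN x0(1) by (intro psubset_card_mono) auto
      then show ?thesis using Suc by simp
    qed (use sub in simp)
  qed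
  have "card (S B) = 0" using card[of B] NB by simp
  then have empty: "S B = {}" using SN by simp
  have finK: "finite K" using K(2) finite_subset by blast
  define t where "t = Min (surv E B B ` K)"
  have t: "t \<in> surv E B B ` K" "\<And>x. x \<in> K \<Longrightarrow> t \<le> surv E B B x"
    using finK K(1) unfolding t_def by (auto intro: Min_in)
  then obtain v where v: "v \<in> K" "surv E B B v = t" by auto
  \<comment> \<open>Nothing survives all \<open>B\<close> rounds, so the round that removes
    \<open>v\<close> is actually executed.\<close>
  have tB: "t < B" using empty v K(2) surv_le[of B v] by (force simp: S_def)
  have vS: "v \<in> S t" using v K(2) surv_iff[of t B v] tB by (auto simp: S_def)
  have "\<not> Suc t \<le> surv E B (Suc t) v" using surv_iff[of "Suc t" B v] v tB by (simp del: surv.simps)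
  have simp: "\<forall>p<B. \<forall>q<B. t \<le> surv E B t p \<and> t \<le> surv E B t q \<and> E v p \<and> E v q \<and> p \<noteq> q \<longrightarrow> E p q" (is ?simp)
  proof (rule ccontr)
    assume "\<not> ?simp"
    moreover have "surv E B t v = t" using vS surv_le[of t v] by (simp add: S_def)
    ultimately have "surv E B (Suc t) v = Suc t" by simp
    with \<open>\<not> Suc t \<le> surv E B (Suc t) v\<close> show False by (simp del: surv.simps)
  qed
  have Cv: "C v x \<longleftrightarrow> x < N \<and> t \<le> surv E B t x \<and> (x = v \<or> E v x)" for x
    using surv_iff[of t B x] tB v K(2) by (auto simp: cand_def)
  have clique: "E x y" if "C v x" "C v y" "x \<noteq> y" for x y
    using that simp NB unfolding Cv by (metis less_le_trans sym)
  have sub: "C v x" if "x \<in> K" for x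
    using that K(2) K(3)[OF v(1) that] t(2)[OF that] v by (auto simp: cand_def)
  have "x \<in> K" if "C v x" for x
    using that clique sub by (intro max) (auto simp: Cv)
  with sub v show ?thesis by blast
qed

lemma iso_card:
  assumes iso: "iso_on E E X Y \<phi>" and XB: "X \<subseteq> {..<B}" "Y \<subseteq> {..<B}"
    and P: "\<And>z. P z \<Longrightarrow> z \<in> X" "\<And>z. Q z \<Longrightarrow> z \<in> Y" "\<And>z. z \<in> X \<Longrightarrow> P z \<longleftrightarrow> Q (\<phi> z)"
  shows "card {z. z < B \<and> P z} = card {z. z < B \<and> Q z}"
proof -
  have bij: "bij_betw \<phi> X Y" using iso by (simp add: iso_on_def)
  then have "{z. z < B \<and> Q z} = \<phi> ` {z. z < B \<and> P z}"
    using P XB unfolding bij_betw_def by (auto simp: image_iff) (metis image_iff lessThan_iff subset_iff)+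
  moreover have "inj_on \<phi> {z. z < B \<and> P z}" using bij P(1) by (auto simp: bij_betw_def inj_on_def)
  ultimately show ?thesis by (simp add: card_image)
qed

text \<open>Levels and neighbour counts are invariant under \<open>\<phi>\<close>, but ray numbers
  are not: they depend on how the vertices are numbered. The code \<open>c\<close> translates them.
  That all pairs of vertices with equal signature pass the adjacency test is where the structure of
  ray models enters, through \<open>twins\<close>.\<close>

lemma iso_imp_linked:
  assumes ab: "a < N" "b < N" and iso: "iso_on E E (component E a) (component E b) \<phi>"
    and M: "ray_model E (component E a) K {1..d} ray la ra e"
    and K: "v \<in> K" "{x. C v x} = K" and K': "w \<in> \<phi> ` K" "{x. C w x} = \<phi> ` K"
    and B: "d ^ d < B" "0 < d"
  shows "linked B d E lv ld a b"
proof -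
  define X where "X = component E a"
  define Y where "Y = component E b"
  have bij: "bij_betw \<phi> X Y" and E\<phi>: "\<And>x y. x \<in> X \<Longrightarrow> y \<in> X \<Longrightarrow> E (\<phi> x) (\<phi> y) \<longleftrightarrow> E x y"
    using iso by (simp_all add: iso_on_def X_def Y_def)
  have KX: "K \<subseteq> X" using ray_modelD(1)[OF M] by (simp add: X_def)
  have vX: "v \<in> X" and wY: "w \<in> Y" using K K' KX bij by (auto simp: bij_betw_def)
  have vw: "v < N" "w < N" using component_N[OF ab(1)] component_N[OF ab(2)] vX wY by (auto simp: X_def Y_def)
  have cv: "component E v = X" and cw: "component E w = Y"
    using component_eq[of E v a, OF sym] component_eq[of E w b, OF sym] vX wY by (simp_all add: X_def Y_def)
  have XB: "X \<subseteq> {..<B}" and YB: "Y \<subseteq> {..<B}"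
    using component_N[OF ab(1)] component_N[OF ab(2)] NB by (auto simp: X_def Y_def)
  have surj: "\<phi> ` X = Y" and inj: "inj_on \<phi> X" using bij by (simp_all add: bij_betw_def)
  have M1: "ray_model E X {x. C v x} {1..d} ray la ra e" using M K by (simp add: X_def)
  have M2: "ray_model E Y {x. C w x} {1..d} (ray \<circ> inv_into X \<phi>) (la \<circ> inv_into X \<phi>)
      (ra \<circ> inv_into X \<phi>) (e \<circ> inv_into X \<phi>)"
    using ray_model_image[OF M[folded X_def] inj E\<phi>] K' surj by simp
  have Lv: "layers.X E v = X" and Lw: "layers.X E w = Y"
    using layers.X_def[OF layers_C] vw cv cw by (auto simp: component_def)
  interpret V: ray_layers E N B C v "{1..d}" ray la ra e
    by (intro ray_layers.intro layers_C vw) (unfold_locales, use M1 Lv in auto)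
  interpret W: ray_layers E N B C w "{1..d}" "ray \<circ> inv_into X \<phi>" "la \<circ> inv_into X \<phi>"
      "ra \<circ> inv_into X \<phi>" "e \<circ> inv_into X \<phi>"
    by (intro ray_layers.intro layers_C vw) (unfold_locales, use M2 Lw in auto)
  have posv: "0 < lv v x \<longleftrightarrow> x \<in> X" and posw: "0 < lv w x \<longleftrightarrow> x \<in> Y" for x
    using vw cv cw by (simp_all add: lev_pos)
  have inv: "inv_into X \<phi> (\<phi> x) = x" if "x \<in> X" for x using that inj by simp
  have \<phi>Y: "\<phi> x \<in> Y" if "x \<in> X" for x using that surj by blast
  \<comment> \<open>Pulled back along \<open>\<phi>\<close>, the levels found from \<open>w\<close>
    satisfy the axioms with respect to \<open>K\<close>; by uniqueness they are the levels found
    from \<open>v\<close>.\<close>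
  have "levels E X K (lv w \<circ> \<phi>)"
  proof -
    have l: "levels E Y (\<phi> ` K) (lv w)" using W.levels_lev K' Lw by simp
    show ?thesis
      unfolding levels_def
    proof (intro conjI ballI impI)
      fix x assume x: "x \<in> X"
      show "0 < (lv w \<circ> \<phi>) x" using l \<phi>Y[OF x] by (simp add: levels_def)
      show "(lv w \<circ> \<phi>) x = 1 \<longleftrightarrow> x \<in> K"
        using l \<phi>Y[OF x] inj KX x by (simp add: levels_def inj_on_image_mem_iff)
      show "(lv w \<circ> \<phi>) x \<le> (lv w \<circ> \<phi>) y + 1" if "y \<in> X" "E x y" for y
        using l \<phi>Y[OF x] \<phi>Y[OF that(1)] E\<phi>[OF x that(1)] that(2) by (simp add: levels_def)
      show "\<exists>y\<in>X. E x y \<and> (lv w \<circ> \<phi>) y + 1 = (lv w \<circ> \<phi>) x" if "1 < (lv w \<circ> \<phi>) x"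
      proof -
        obtain y where "y \<in> Y" "E (\<phi> x) y" "lv w y + 1 = lv w (\<phi> x)"
          using l \<phi>Y[OF x] \<open>1 < (lv w \<circ> \<phi>) x\<close> unfolding levels_def component_def by force
        moreover from this obtain z where "z \<in> X" "y = \<phi> z" using surj by blast
        ultimately show ?thesis using E\<phi>[OF x] by auto
      qed
    qed
  qed
  moreover have "levels E X K (lv v)" using V.levels_lev K Lv by simp
  ultimately have lev\<phi>: "lv w (\<phi> x) = lv v x" if "x \<in> X" for x
    using levels_unique[of E X K "lv w \<circ> \<phi>" "lv v" x] that by simp
  let ?rv = "rank B lv ld v" and ?rw = "rank B lv ld w"
  have rv: "?rv x < d" "1 < lv v y \<Longrightarrow> ?rv x = ?rv y \<longleftrightarrow> ray x = ray y" if "1 < lv v x" for x y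
    using V.rank_ray[OF that] by simp_all
  have rw: "?rw (\<phi> x) < d" "?rw (\<phi> x) = ?rw (\<phi> y) \<longleftrightarrow> ray x = ray y"
    if "x \<in> X" "y \<in> X" "1 < lv v x" "1 < lv v y" for x y
    using W.rank_ray[of "\<phi> x"] W.rank_ray(2)[of "\<phi> x" "\<phi> y"] that lev\<phi> inv by simp_all
  have Xv: "x \<in> X" if "1 < lv v x" for x using that posv[of x] by simp
  \<comment> \<open>For a ray number \<open>j\<close> on the side of \<open>w\<close>,
    \<open>g j\<close> is the number of the same ray on the side of \<open>v\<close>. The default 0
    for numbers that no ray has is a legal digit because \<open>0 < d\<close>.\<close>
  define g where "g j = (if \<exists>x. 1 < lv v x \<and> ?rw (\<phi> x) = j then ?rv (SOME x. 1 < lv v x \<and> ?rw (\<phi> x) = j) else 0)" for j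
  have g: "g (?rw (\<phi> x)) = ?rv x" if x: "1 < lv v x" for x
  proof -
    define y where "y = (SOME y. 1 < lv v y \<and> ?rw (\<phi> y) = ?rw (\<phi> x))"
    have y: "1 < lv v y \<and> ?rw (\<phi> y) = ?rw (\<phi> x)" unfolding y_def by (rule someI[of _ x]) (use x in simp)
    then have "ray y = ray x" using rw(2)[of y x] x Xv by blast
    then have "?rv y = ?rv x" using rv(2)[of y x] x y by blast
    moreover have "g (?rw (\<phi> x)) = ?rv y" unfolding g_def y_def using x by auto
    ultimately show ?thesis by simp
  qed
  have gd: "g j < d" for j
  proof (cases "\<exists>x. 1 < lv v x \<and> ?rw (\<phi> x) = j")
    case True
    then obtain x where "1 < lv v x" "?rw (\<phi> x) = j" by blast
    then show ?thesis using g[of x] rv(1)[of x] by simp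
  next
    case False
    then have "g j = 0" unfolding g_def by (simp only: if_False)
    then show ?thesis using B(2) by simp
  qed
  obtain c where c: "c < d ^ d" "\<And>j. j < d \<Longrightarrow> c div d ^ j mod d = g j"
    using digits_exist[of d g d] gd by blast
  have dB: "d \<le> B"
  proof -
    have "d \<le> d ^ d" using self_le_power[of d d] B(2) by simp
    then show ?thesis using B(1) by simp
  qed
  define s where "s = signature B E (lv v) ?rv"
  define t where "t = signature B E (lv w) (\<lambda>z. digit B d c (?rw z))"
  have same: "same B d E lv ld v w c x y \<longleftrightarrow> s x = t y" for x y
    unfolding s_def t_def by (rule same_iff)
  have lab: "digit B d c (?rw (\<phi> x)) = ?rv x" if x: "1 < lv v x" for x
  proof -
    have j: "?rw (\<phi> x) < d" using rw(1)[of x x] Xv[OF x] x by blast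
    then have "digit B d c (?rw (\<phi> x)) = c div d ^ ?rw (\<phi> x) mod d"
      using dB B c(1) by (intro digit_eq) auto
    then show ?thesis using c(2)[OF j] g[OF x] by simp
  qed
  have s\<phi>: "t (\<phi> x) = s x" if x: "x \<in> X" for x
  proof -
    note ic = iso_card[OF iso[folded X_def Y_def] XB YB]
    have closedX: "z \<in> X" if "E x z" for z
      using that x unfolding X_def component_def by (auto intro: rtranclp.rtrancl_into_rtrancl)
    have closedY: "z \<in> Y" if "E (\<phi> x) z" for z
      using that \<phi>Y[OF x] unfolding Y_def component_def by (auto intro: rtranclp.rtrancl_into_rtrancl)
    have "card {z. z < B \<and> (E x z \<and> lv v z + 1 = lv v x)} =
        card {z. z < B \<and> (E (\<phi> x) z \<and> lv w z + 1 = lv w (\<phi> x))}"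
      "card {z. z < B \<and> (E x z \<and> lv v z = lv v x + 1)} =
        card {z. z < B \<and> (E (\<phi> x) z \<and> lv w z = lv w (\<phi> x) + 1)}"
      "card {z. z < B \<and> (E x z \<and> 1 < lv v z \<and> ?rv z = i)} =
        card {z. z < B \<and> (E (\<phi> x) z \<and> 1 < lv w z \<and> digit B d c (?rw z) = i)}" for i
      using closedX closedY x by (intro ic; auto simp: E\<phi> lev\<phi> lab)+
    then show ?thesis using lev\<phi>[OF x] lab[of x] unfolding s_def t_def signature_def by auto
  qed
  \<comment> \<open>With ranks translated back into rays, equal signatures are the hypotheses of
    \<open>twins\<close>.\<close>
  have tw: "E q z" if pq: "p \<in> X" "q \<in> X" "z \<in> X" "s p = s q" "z \<noteq> p" "z \<noteq> q" "E p z" for p q z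
  proof -
    have mem: "{z. z < B \<and> (E p z \<and> P z)} = {z \<in> X. E p z \<and> P z}" if "p \<in> X" for p P
      using that XB unfolding X_def component_def
      by (auto intro: rtranclp.rtrancl_into_rtrancl dest: EN)
    have eq: "lv v p = lv v q" "1 < lv v p \<Longrightarrow> ?rv p = ?rv q"
      "card {z \<in> X. E p z \<and> lv v z + 1 = lv v p} = card {z \<in> X. E q z \<and> lv v z + 1 = lv v q}"
      "card {z \<in> X. E p z \<and> lv v z = lv v p + 1} = card {z \<in> X. E q z \<and> lv v z = lv v q + 1}"
      "i < B \<Longrightarrow> card {z \<in> X. E p z \<and> 1 < lv v z \<and> ?rv z = i} =
         card {z \<in> X. E q z \<and> 1 < lv v z \<and> ?rv z = i}" for i
      using pq(4) unfolding s_def signature_def mem[OF pq(1)] mem[OF pq(2)]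
      by (auto dest: fun_cong[of _ _ i] split: if_splits)
    show ?thesis
    proof (rule V.twins[unfolded Lv K(2)])
      show "lv v p = lv v q" by (rule eq)
      show "ray p = ray q" if "1 < lv v p" using rv(2)[OF that, of q] eq(1,2) that by simp
      fix z\<^sub>0 assume "z\<^sub>0 \<in> X - K"
      then have z0: "1 < lv v z\<^sub>0" using V.outerX Lv K(2) by simp
      have "{z \<in> X. E u z \<and> 1 < lv v z \<and> ray z = ray z\<^sub>0} =
          {z \<in> X. E u z \<and> 1 < lv v z \<and> ?rv z = ?rv z\<^sub>0}" for u
        using rv(2)[of _ z\<^sub>0] z0 by auto
      then show "card {z \<in> X. E p z \<and> 1 < lv v z \<and> ray z = ray z\<^sub>0} =
          card {z \<in> X. E q z \<and> 1 < lv v z \<and> ray z = ray z\<^sub>0}"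
        using eq(5)[of "?rv z\<^sub>0"] rv(1)[OF z0] dB by simp
    qed (use pq eq in auto)
  qed
  have "match B d E lv ld v w c"
    unfolding match_def same posv posw
  proof (intro conjI allI impI)
    show "\<exists>y<B. y \<in> Y \<and> s x = t y" if "x \<in> X" for x
      using s\<phi>[OF that] \<phi>Y[OF that] YB by (intro exI[of _ "\<phi> x"]) auto
    have preimage: "\<exists>x\<in>X. y = \<phi> x \<and> s x = t y" if "y \<in> Y" for y
      using that s\<phi> surj by (metis imageE)
    then show "\<exists>x<B. x \<in> X \<and> s x = t y" if "y \<in> Y" for y
      using that XB by blast
    show "card {x'. x' < B \<and> (x' \<in> X \<and> s x' = t y)} = card {y'. y' < B \<and> (y' \<in> Y \<and> s x = t y')}"
      if "s x = t y" for x y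
      by (rule iso_card[OF iso[folded X_def Y_def] XB YB]) (use that s\<phi> \<phi>Y in auto)
    show "E x x' \<longleftrightarrow> E y y'"
      if h: "x \<in> X" "x' \<in> X" "y \<in> Y" "y' \<in> Y" "x \<noteq> x'" "y \<noteq> y'" "s x = t y" "s x' = t y'" for x x' y y'
    proof -
      \<comment> \<open>The image pair of \<open>u\<close> and \<open>u'\<close> is the given pair
        on the other side, so only twins on the side of \<open>v\<close> remain to be
        exchanged.\<close>
      obtain u u' where u: "u \<in> X" "y = \<phi> u" "s u = t y" "u' \<in> X" "y' = \<phi> u'" "s u' = t y'"
        using preimage[OF h(3)] preimage[OF h(4)] by blast
      have "E x x' \<longleftrightarrow> E u u'"
      proof (rule twin_exchange[where X = X and s = s])
        show "E p z \<longleftrightarrow> E q z" if "p \<in> X" "q \<in> X" "z \<in> X" "s p = s q" "z \<noteq> p" "z \<noteq> q" for p q z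
          using tw[of p q z] tw[of q p z] that by metis
      qed (use h u sym in auto)
      then show ?thesis using E\<phi>[OF u(1,4)] u by simp
    qed
  qed
  moreover have "0 < lv v a" "0 < lv w b"
    using posv[of a] posw[of b] by (auto simp: X_def Y_def component_def)
  moreover have "v < B" "w < B" "c < B" using vw NB c(1) B(1) by auto
  ultimately show ?thesis unfolding linked_def by blast
qed

end

section \<open>Subdivided stars\<close>

text \<open>Coordinates on a subdivided star with center 0: every other vertex is given by its ray and
  by its distance \<open>idx\<close> from the center.\<close>

definition star_coords :: "nat set \<Rightarrow> (nat \<times> nat) set \<Rightarrow> nat \<Rightarrow> (nat \<Rightarrow> nat) \<Rightarrow> (nat \<Rightarrow> nat) \<Rightarrow> bool" where
  "star_coords V A d ray idx \<longleftrightarrow> 0 \<in> V \<and> A \<subseteq> V \<times> V \<and> (\<forall>x y. (x, y) \<in> A \<longrightarrow> (y, x) \<in> A) \<and>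
     (\<forall>x\<in>V. idx x = 0 \<longleftrightarrow> x = 0) \<and> (\<forall>x\<in>V. x \<noteq> 0 \<longrightarrow> ray x \<in> {1..d}) \<and>
     (\<forall>x\<in>V. \<forall>y\<in>V. x \<noteq> 0 \<longrightarrow> y \<noteq> 0 \<longrightarrow> ray x = ray y \<longrightarrow> idx x = idx y \<longrightarrow> x = y) \<and>
     (\<forall>x y. (x, y) \<in> A \<longrightarrow> (x = 0 \<or> y = 0 \<or> ray x = ray y) \<and> (idx x = Suc (idx y) \<or> idx y = Suc (idx x)))"

lemma star_coordsD:
  assumes "star_coords V A d ray idx"
  shows "0 \<in> V" "(x, y) \<in> A \<Longrightarrow> x \<in> V" "(x, y) \<in> A \<Longrightarrow> y \<in> V" "(x, y) \<in> A \<Longrightarrow> (y, x) \<in> A"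
    "x \<in> V \<Longrightarrow> idx x = 0 \<longleftrightarrow> x = 0" "x \<in> V \<Longrightarrow> x \<noteq> 0 \<Longrightarrow> ray x \<in> {1..d}"
    "x \<in> V \<Longrightarrow> y \<in> V \<Longrightarrow> x \<noteq> 0 \<Longrightarrow> y \<noteq> 0 \<Longrightarrow> ray x = ray y \<Longrightarrow> idx x = idx y \<Longrightarrow> x = y"
    "(x, y) \<in> A \<Longrightarrow> x = 0 \<or> y = 0 \<or> ray x = ray y" "(x, y) \<in> A \<Longrightarrow> idx x = Suc (idx y) \<or> idx y = Suc (idx x)"
proof -
  have c: "0 \<in> V" "A \<subseteq> V \<times> V" "\<forall>x y. (x, y) \<in> A \<longrightarrow> (y, x) \<in> A"
    "\<forall>x\<in>V. idx x = 0 \<longleftrightarrow> x = 0" "\<forall>x\<in>V. x \<noteq> 0 \<longrightarrow> ray x \<in> {1..d}"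
    "\<forall>x\<in>V. \<forall>y\<in>V. x \<noteq> 0 \<longrightarrow> y \<noteq> 0 \<longrightarrow> ray x = ray y \<longrightarrow> idx x = idx y \<longrightarrow> x = y"
    "\<forall>x y. (x, y) \<in> A \<longrightarrow> (x = 0 \<or> y = 0 \<or> ray x = ray y) \<and> (idx x = Suc (idx y) \<or> idx y = Suc (idx x))"
    using assms unfolding star_coords_def by - (elim conjE, assumption)+
  show "0 \<in> V" by (rule c(1))
  show "(x, y) \<in> A \<Longrightarrow> x \<in> V" "(x, y) \<in> A \<Longrightarrow> y \<in> V" using c(2) by blast+
  show "(x, y) \<in> A \<Longrightarrow> (y, x) \<in> A" using c(3) by blast
  show "x \<in> V \<Longrightarrow> idx x = 0 \<longleftrightarrow> x = 0" by (rule c(4)[rule_format])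
  show "x \<in> V \<Longrightarrow> x \<noteq> 0 \<Longrightarrow> ray x \<in> {1..d}" by (rule c(5)[rule_format])
  show "x \<in> V \<Longrightarrow> y \<in> V \<Longrightarrow> x \<noteq> 0 \<Longrightarrow> y \<noteq> 0 \<Longrightarrow> ray x = ray y \<Longrightarrow> idx x = idx y \<Longrightarrow> x = y"
    by (rule c(6)[rule_format])
  show "(x, y) \<in> A \<Longrightarrow> x = 0 \<or> y = 0 \<or> ray x = ray y"
    "(x, y) \<in> A \<Longrightarrow> idx x = Suc (idx y) \<or> idx y = Suc (idx x)"
    using c(7)[rule_format, of x y] by blast+
qed

lemma star_coords_star: "star_coords (pverts (star d)) (parcs (star d)) d id (\<lambda>x. if x = 0 then 0 else 1)"
  unfolding star_coords_def star_def by auto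

text \<open>The new vertex takes over the position of \<open>v\<close>, and everything on that ray
  from \<open>v\<close> outwards, the set \<open>far\<close>, moves up by one.\<close>

lemma star_coords_subdivide:
  assumes c: "star_coords V A d ray idx" and uv: "(u, v) \<in> A" "idx v = Suc (idx u)" and w: "w \<notin> V"
  shows "\<exists>ray' idx'. star_coords (V \<union> {w}) (A - {(u,v), (v,u)} \<union> {(u,w), (w,u), (w,v), (v,w)}) d ray' idx'"
proof -
  note D = star_coordsD[OF c]
  have V: "u \<in> V" "v \<in> V" using D(2,3)[OF uv(1)] by auto
  have v0: "v \<noteq> 0" using D(5)[OF V(2)] uv(2) by auto
  have w0: "w \<noteq> 0" "w \<noteq> u" "w \<noteq> v" using D(1) V w by metis+
  have u: "u = 0 \<or> ray u = ray v" using D(8)[OF uv(1)] v0 by auto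
  define ray' where "ray' x = (if x = w then ray v else ray x)" for x
  define far where "far x \<longleftrightarrow> x \<noteq> 0 \<and> ray x = ray v \<and> idx v \<le> idx x" for x
  define idx' where "idx' x = (if x = w then idx v else if far x then Suc (idx x) else idx x)" for x
  have far: "far v" "\<not> far u" using v0 uv(2) by (auto simp: far_def)
  \<comment> \<open>The subdivided arc is the only entrance to \<open>far\<close>, so on every other
    arc both ends are shifted or neither is.\<close>
  have border: "(x, y) = (u, v)" if xy: "(x, y) \<in> A" "\<not> far x" "far y" for x y
  proof -
    have xV: "x \<in> V" "y \<in> V" using D(2,3)[OF xy(1)] by auto
    have r: "x = 0 \<or> ray x = ray v" using D(8)[OF xy(1)] xy(3) by (auto simp: far_def)
    have lt: "idx x < idx v" using xy(2) r D(5)[OF xV(1)] uv(2) by (auto simp: far_def)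
    then have i: "idx y = idx v" "idx x = idx u" using D(9)[OF xy(1)] xy(3) uv(2) by (auto simp: far_def)
    then have "y = v" using D(7)[OF xV(2) V(2)] xy(3) v0 by (auto simp: far_def)
    moreover have "x = u"
    proof (cases "x = 0")
      case True
      then show ?thesis using i(2) D(5)[OF xV(1)] D(5)[OF V(1)] by metis
    next
      case False
      then have "u \<noteq> 0" using i(2) D(5)[OF xV(1)] D(5)[OF V(1)] by metis
      then show ?thesis using False r u i(2) D(7)[OF xV(1) V(1)] by metis
    qed
    ultimately show ?thesis by simp
  qed
  have old: "(x = 0 \<or> y = 0 \<or> ray' x = ray' y) \<and> (idx' x = Suc (idx' y) \<or> idx' y = Suc (idx' x))"
    if xy: "(x, y) \<in> A" "(x, y) \<noteq> (u, v)" "(x, y) \<noteq> (v, u)" for x y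
  proof -
    have "far x \<longleftrightarrow> far y" using border[OF xy(1)] border[OF D(4)[OF xy(1)]] xy(2,3) by auto
    moreover have "x \<noteq> w" "y \<noteq> w" using D(2,3)[OF xy(1)] w by auto
    ultimately show ?thesis using D(8,9)[OF xy(1)] by (auto simp: ray'_def idx'_def)
  qed
  have "star_coords (V \<union> {w}) (A - {(u,v), (v,u)} \<union> {(u,w), (w,u), (w,v), (v,w)}) d ray' idx'"
    unfolding star_coords_def
  proof (intro conjI ballI allI impI)
    show "0 \<in> V \<union> {w}" using D(1) by simp
    show "A - {(u, v), (v, u)} \<union> {(u, w), (w, u), (w, v), (v, w)} \<subseteq> (V \<union> {w}) \<times> (V \<union> {w})"
      using D(2,3) V by auto
  next
    fix x y assume "(x, y) \<in> A - {(u, v), (v, u)} \<union> {(u, w), (w, u), (w, v), (v, w)}"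
    then show "(y, x) \<in> A - {(u, v), (v, u)} \<union> {(u, w), (w, u), (w, v), (v, w)}"
      using D(4)[of x y] by auto
  next
    fix x assume "x \<in> V \<union> {w}"
    then show "idx' x = 0 \<longleftrightarrow> x = 0"
      using D(5)[of x] uv(2) w0 by (auto simp: idx'_def far_def)
  next
    fix x assume "x \<in> V \<union> {w}" "x \<noteq> 0"
    then show "ray' x \<in> {1..d}"
      using D(6)[of x] D(6)[OF V(2) v0] by (auto simp: ray'_def)
  next
    fix x y assume xy: "x \<in> V \<union> {w}" "y \<in> V \<union> {w}" "x \<noteq> 0" "y \<noteq> 0" "ray' x = ray' y" "idx' x = idx' y"
    have *: "x \<in> V \<Longrightarrow> ray x = ray v \<Longrightarrow> idx' x \<noteq> idx v \<or> x = w" for x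
      using D(5)[of x] uv(2) by (auto simp: idx'_def far_def)
    show "x = y"
    proof (cases "x = w \<or> y = w")
      case True
      then show ?thesis using xy *[of x] *[of y] by (auto simp: ray'_def idx'_def split: if_splits)
    next
      case False
      then have r: "ray x = ray y" "x \<in> V" "y \<in> V" using xy by (auto simp: ray'_def)
      moreover have "idx x = idx y" using False xy(3,4,6) r(1) by (auto simp: idx'_def far_def split: if_splits)
      ultimately show ?thesis using D(7) xy(3,4) by blast
    qed
  next
    fix x y assume xy: "(x, y) \<in> A - {(u, v), (v, u)} \<union> {(u, w), (w, u), (w, v), (v, w)}"
    have nw: "idx' w = idx v" "idx' u = idx u" "idx' v = Suc (idx v)" "ray' w = ray v" "ray' u = ray u" "ray' v = ray v"
      using w0 far by (auto simp: idx'_def ray'_def)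
    show "x = 0 \<or> y = 0 \<or> ray' x = ray' y" "idx' x = Suc (idx' y) \<or> idx' y = Suc (idx' x)"
      using xy old[of x y] nw uv(2) u by auto
  qed
  then show ?thesis by blast
qed

lemma subdivision_star_coords:
  assumes "subdivision_pair (star d) H"
  shows "\<exists>ray idx. star_coords (pverts H) (parcs H) d ray idx"
  using assms
proof (induction rule: subdivision_pair_induct)
  case base
  then show ?case using star_coords_star by blast
next
  case (divide e w H)
  obtain u v where e: "e = (u, v)" by (cases e)
  obtain ray idx where c: "star_coords (pverts H) (parcs H) d ray idx" using divide.IH by blast
  have uv: "(u, v) \<in> parcs H" "(v, u) \<in> parcs H" using divide.hyps e star_coordsD(4)[OF c] by auto
  have eq: "parcs H - {(v,u), (u,v)} \<union> {(v,w), (w,v), (w,u), (u,w)} =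
    parcs H - {(u,v), (v,u)} \<union> {(u,w), (w,u), (w,v), (v,w)}" by auto
  \<comment> \<open>The arc may be given in either direction; the one that leads away from the
    center is subdivided.\<close>
  show ?case
    using star_coordsD(9)[OF c uv(1)] star_coords_subdivide[OF c uv(1) _ divide.hyps(2)]
      star_coords_subdivide[OF c uv(2) _ divide.hyps(2)]
    unfolding e subdivide_simps eq by metis
qed

section \<open>Connected subgraphs of a subdivided star\<close>

definition cut_connected :: "nat set \<Rightarrow> (nat \<times> nat) set \<Rightarrow> bool" where
  "cut_connected P Q \<longleftrightarrow> (\<forall>S x y. x \<in> P \<and> x \<in> S \<and> y \<in> P \<and> y \<notin> S \<longrightarrow> (\<exists>(z, z')\<in>Q. z \<in> S \<and> z' \<notin> S))"

text \<open>A path from inside \<open>S\<close> to outside has an arc that leaves \<open>S\<close>.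
  The symmetric closure in the definition of \<open>connected\<close> adds no arcs, since those of
  \<open>M\<close> are already symmetric.\<close>

lemma cut_connected_subgraph:
  assumes "pair_graph M" "connected (with_proj M)"
  shows "cut_connected (pverts M) (parcs M)" "pverts M \<noteq> {}" "finite (pverts M)"
    "parcs M \<subseteq> pverts M \<times> pverts M" "(x, y) \<in> parcs M \<Longrightarrow> (y, x) \<in> parcs M"
proof -
  interpret pair_graph M by fact
  have sc: "strongly_connected (mk_symmetric (with_proj M))" using assms(2) by (simp add: connected_def)
  show sym: "(y, x) \<in> parcs M" if "(x, y) \<in> parcs M" for x y
    using that pair_sym_arcs by (auto simp: symmetric_def elim: symE)
  have arcs: "parcs (mk_symmetric (with_proj M)) = parcs M"
    using sym by (auto simp: parcs_mk_symmetric)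
  show "pverts M \<noteq> {}" using sc by (auto simp: strongly_connected_def)
  show "finite (pverts M)" by (rule pair_finite_verts)
  show "parcs M \<subseteq> pverts M \<times> pverts M" using arc_fst_in_verts arc_snd_in_verts by force
  show "cut_connected (pverts M) (parcs M)"
    unfolding cut_connected_def
  proof (intro allI impI)
    fix S x y assume xy: "x \<in> pverts M \<and> x \<in> S \<and> y \<in> pverts M \<and> y \<notin> S"
    then have "(x, y) \<in> rtrancl_on (pverts M) (parcs M)"
      using sc arcs by (auto simp: strongly_connected_def reachable_def)
    then have "x \<in> S \<longrightarrow> y \<in> S \<or> (\<exists>(z, z')\<in>parcs M. z \<in> S \<and> z' \<notin> S)"
      by (induction rule: rtrancl_on_induct) auto
    then show "\<exists>(z, z')\<in>parcs M. z \<in> S \<and> z' \<notin> S" using xy by blast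
  qed
qed

locale star_subgraphs =
  fixes V A d and ray idx :: "nat \<Rightarrow> nat"
  assumes coords: "star_coords V A d ray idx"
begin

lemmas D = star_coordsD[OF coords]

definition sub :: "nat set \<Rightarrow> (nat \<times> nat) set \<Rightarrow> bool" where
  "sub P Q \<longleftrightarrow> cut_connected P Q \<and> P \<noteq> {} \<and> finite P \<and> P \<subseteq> V \<and> Q \<subseteq> A \<and> Q \<subseteq> P \<times> P \<and>
     (\<forall>x y. (x, y) \<in> Q \<longrightarrow> (y, x) \<in> Q)"

lemma subD:
  assumes "sub P Q"
  shows "finite P" "P \<noteq> {}" "x \<in> P \<Longrightarrow> x \<in> V" "(x, y) \<in> Q \<Longrightarrow> (x, y) \<in> A" "(x, y) \<in> Q \<Longrightarrow> x \<in> P"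
    "(x, y) \<in> Q \<Longrightarrow> y \<in> P" "(x, y) \<in> Q \<Longrightarrow> (y, x) \<in> Q"
    "x \<in> P \<Longrightarrow> x \<in> S \<Longrightarrow> y \<in> P \<Longrightarrow> y \<notin> S \<Longrightarrow> \<exists>z z'. (z, z') \<in> Q \<and> z \<in> S \<and> z' \<notin> S"
  using assms unfolding sub_def cut_connected_def by blast+

text \<open>Crossing the cut before position \<open>s\<close> of a ray uses the arc that ends at position \<open>s\<close>.\<close>

lemma cut_arc:
  assumes PQ: "sub P Q" and x: "x \<in> P" "x \<noteq> 0" "s \<le> idx x" and y: "y \<in> P" "y = 0 \<or> idx y < s \<or> ray y \<noteq> ray x"
    and s: "0 < s"
  shows "\<exists>z z'. (z, z') \<in> Q \<and> z \<noteq> 0 \<and> ray z = ray x \<and> idx z = s \<and> Suc (idx z') = s \<and> (z' = 0 \<or> ray z' = ray x)"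
proof -
  note P = subD[OF PQ]
  define S where "S = {z. z \<noteq> 0 \<and> ray z = ray x \<and> s \<le> idx z}"
  have "x \<in> S" "y \<notin> S" using x y by (auto simp: S_def)
  then obtain z z' where z: "(z, z') \<in> Q" "z \<in> S" "z' \<notin> S" using P(8)[OF x(1) _ y(1)] by blast
  have zA: "(z, z') \<in> A" using P(4)[OF z(1)] .
  have r: "z' = 0 \<or> ray z' = ray x" using D(8)[OF zA] z(2) by (auto simp: S_def)
  then have "idx z' < s" using z(3) D(5)[OF D(3)[OF zA]] s by (auto simp: S_def)
  then have "idx z = s" "Suc (idx z') = s" using D(9)[OF zA] z(2) by (auto simp: S_def)
  with z r show ?thesis by (auto simp: S_def)
qed

text \<open>In a tree, an arc is the only link across the cut it determines, so a connected subgraph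
  that contains both ends contains the arc. Hence inclusion of representing subgraphs, which
  properness speaks of, reduces to inclusion of their vertex sets.\<close>

lemma induced:
  assumes P: "sub P Q" and P': "sub P' Q'" and le: "P \<subseteq> P'" shows "Q \<subseteq> Q'"
proof -
  have *: "(x, y) \<in> Q'" if xy: "(x, y) \<in> Q" and i: "idx x = Suc (idx y)" for x y
  proof -
    have A: "(x, y) \<in> A" using subD(4)[OF P xy] .
    have m: "x \<in> P'" "y \<in> P'" using subD(5,6)[OF P xy] le by auto
    have x0: "x \<noteq> 0" using D(5)[OF D(2)[OF A]] i by auto
    obtain z z' where z: "(z, z') \<in> Q'" "z \<noteq> 0" "ray z = ray x" "idx z = idx x" "Suc (idx z') = idx x"
      "z' = 0 \<or> ray z' = ray x"
      using cut_arc[OF P' m(1) x0 order_refl m(2)] i by auto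
    have zA: "(z, z') \<in> A" using subD(4)[OF P' z(1)] .
    have "z = x" using D(7)[OF D(2)[OF zA] D(2)[OF A]] z x0 by simp
    moreover have "z' = y"
    proof (cases "y = 0")
      case True
      then show ?thesis using z(5) i D(5)[OF D(3)[OF zA]] D(5)[OF D(3)[OF A]] by (metis nat.inject)
    next
      case False
      then have "z' \<noteq> 0" using z(5) i D(5)[OF D(3)[OF zA]] D(5)[OF D(3)[OF A]] by (metis nat.inject)
      then show ?thesis using False z(5,6) i D(7)[OF D(3)[OF zA] D(3)[OF A]] D(8)[OF A] x0 by simp
    qed
    ultimately show ?thesis using z(1) by simp
  qed
  show ?thesis
  proof (rule subrelI)
    fix x y assume xy: "(x, y) \<in> Q"
    show "(x, y) \<in> Q'"
      using D(9)[OF subD(4)[OF P xy]] *[OF xy] *[OF subD(7)[OF P xy]] subD(7)[OF P'] by blast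
  qed
qed

definition covers :: "nat set \<Rightarrow> nat \<Rightarrow> nat \<Rightarrow> bool" where
  "covers P j s \<longleftrightarrow> (\<exists>z\<in>P. z \<noteq> 0 \<and> ray z = j \<and> idx z = s)"

lemma covers_subset:
  assumes P: "sub P Q" "sub P' Q'" and "0 \<in> P \<Longrightarrow> 0 \<in> P'" "\<And>j s. covers P j s \<Longrightarrow> covers P' j s"
  shows "P \<subseteq> P'"
proof
  fix x assume x: "x \<in> P"
  show "x \<in> P'"
  proof (cases "x = 0")
    case False
    then have "covers P (ray x) (idx x)" using x by (auto simp: covers_def)
    then obtain z where "z \<in> P'" "z \<noteq> 0" "ray z = ray x" "idx z = idx x" using assms(4) covers_def by blast
    then show ?thesis using D(7)[OF subD(3)[OF P(1) x] subD(3)[OF P(2)]] False by metis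
  qed (use assms(3) x in simp)
qed

lemma meet_iff:
  assumes P: "sub P Q" "sub P' Q'"
  shows "P \<inter> P' \<noteq> {} \<longleftrightarrow> 0 \<in> P \<and> 0 \<in> P' \<or> (\<exists>j s. covers P j s \<and> covers P' j s)"
proof
  assume "P \<inter> P' \<noteq> {}"
  then obtain x where "x \<in> P" "x \<in> P'" by blast
  then show "0 \<in> P \<and> 0 \<in> P' \<or> (\<exists>j s. covers P j s \<and> covers P' j s)"
    by (cases "x = 0") (auto simp: covers_def)
next
  assume "0 \<in> P \<and> 0 \<in> P' \<or> (\<exists>j s. covers P j s \<and> covers P' j s)"
  then show "P \<inter> P' \<noteq> {}"
  proof
    assume "\<exists>j s. covers P j s \<and> covers P' j s"
    then obtain z z' where "z \<in> P" "z' \<in> P'" "z \<noteq> 0" "z' \<noteq> 0" "ray z = ray z'" "idx z = idx z'"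
      unfolding covers_def by metis
    then show ?thesis using D(7)[of z z'] subD(3)[OF P(1)] subD(3)[OF P(2)] by auto
  qed auto
qed

text \<open>The value 0, the position of the center, stands for a ray that \<open>P\<close> does not
  enter.\<close>

definition last_on :: "nat set \<Rightarrow> nat \<Rightarrow> nat" where
  "last_on P j = Max (insert 0 (idx ` {x \<in> P. x \<noteq> 0 \<and> ray x = j}))"

text \<open>Connectedness leaves no gap between the center and the outermost vertex on a ray, so
  \<open>P\<close> meets each ray in an initial segment.\<close>

lemma covers_center:
  assumes P: "sub P Q" "0 \<in> P"
  shows "covers P j s \<longleftrightarrow> 0 < s \<and> s \<le> last_on P j"
proof -
  define I where "I = insert 0 (idx ` {x \<in> P. x \<noteq> 0 \<and> ray x = j})"
  have I: "finite I" "last_on P j = Max I" using subD(1)[OF P(1)] by (simp_all add: I_def last_on_def)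
  show ?thesis
  proof
    assume "covers P j s"
    then obtain z where z: "z \<in> P" "z \<noteq> 0" "ray z = j" "idx z = s" unfolding covers_def by blast
    then have "s \<in> I" by (auto simp: I_def)
    then show "0 < s \<and> s \<le> last_on P j" using I D(5)[OF subD(3)[OF P(1) z(1)]] z by simp
  next
    assume s: "0 < s \<and> s \<le> last_on P j"
    have "last_on P j \<in> I" unfolding I(2) using I(1) by (intro Max_in) (auto simp: I_def)
    then obtain x where x: "x \<in> P" "x \<noteq> 0" "ray x = j" "s \<le> idx x" using s by (auto simp: I_def)
    then obtain z z' where "(z, z') \<in> Q" "z \<noteq> 0" "ray z = j" "idx z = s"
      using cut_arc[OF P(1) x(1,2,4) P(2)] s by blast
    then show "covers P j s" using subD(5)[OF P(1)] unfolding covers_def by blast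
  qed
qed

text \<open>Applied to connected sets without the center; these stay on one ray, so the choice of
  the element does not matter.\<close>

definition first_ray :: "nat set \<Rightarrow> nat" where
  "first_ray P = ray (SOME x. x \<in> P)"

lemma covers_off_center:
  assumes P: "sub P Q" "0 \<notin> P"
  shows "covers P j s \<longleftrightarrow> j = first_ray P \<and> Min (idx ` P) \<le> s \<and> s \<le> Max (idx ` P)"
    "0 < Min (idx ` P)" "Min (idx ` P) \<le> Max (idx ` P)" "first_ray P \<in> {1..d}"
proof -
  have fin: "finite (idx ` P)" "idx ` P \<noteq> {}" using subD(1,2)[OF P(1)] by auto
  have pos: "0 < idx x" "x \<noteq> 0" if "x \<in> P" for x
    using D(5)[OF subD(3)[OF P(1) that]] that P(2) by (cases "idx x = 0"; auto)+
  have same: "ray x = ray y" if x: "x \<in> P" and y: "y \<in> P" for x y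
  proof (rule ccontr)
    assume "ray x \<noteq> ray y"
    \<comment> \<open>An arc that leaves a ray ends at position 0, that is, at the center, which
      \<open>P\<close> avoids.\<close>
    then obtain z z' where z: "(z, z') \<in> Q" "idx z = 1" "Suc (idx z') = 1"
      using cut_arc[OF P(1) x pos(2)[OF x] _ y, of 1] pos(1)[OF x] by force
    then have "z' \<in> P" "idx z' = 0" using subD(6)[OF P(1) z(1)] by auto
    then show False using pos(1)[of z'] by simp
  qed
  obtain x\<^sub>0 where x0: "x\<^sub>0 \<in> P" "first_ray P = ray x\<^sub>0"
    unfolding first_ray_def using subD(2)[OF P(1)] by (metis all_not_in_conv someI_ex)
  have r: "ray x = first_ray P" if "x \<in> P" for x using same[OF that x0(1)] x0(2) by simp
  show "0 < Min (idx ` P)" using pos fin by (auto simp: Min_gr_iff)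
  show "Min (idx ` P) \<le> Max (idx ` P)" using fin by (meson Max_ge Min_in)
  show "first_ray P \<in> {1..d}" using x0 D(6)[OF subD(3)[OF P(1) x0(1)] pos(2)[OF x0(1)]] by simp
  show "covers P j s \<longleftrightarrow> j = first_ray P \<and> Min (idx ` P) \<le> s \<and> s \<le> Max (idx ` P)"
  proof
    assume "covers P j s"
    then obtain z where z: "z \<in> P" "z \<noteq> 0" "ray z = j" "idx z = s" unfolding covers_def by blast
    then show "j = first_ray P \<and> Min (idx ` P) \<le> s \<and> s \<le> Max (idx ` P)" using r fin by auto
  next
    assume s: "j = first_ray P \<and> Min (idx ` P) \<le> s \<and> s \<le> Max (idx ` P)"
    obtain x y where x: "x \<in> P" "idx x = Max (idx ` P)" and y: "y \<in> P" "idx y = Min (idx ` P)"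
      using Max_in[OF fin] Min_in[OF fin] by (metis imageE)
    show "covers P j s"
    proof (cases "s = idx y")
      case True
      then show ?thesis using y pos r s unfolding covers_def by blast
    next
      case False
      then have "idx y < s" using s y by simp
      then obtain z z' where z: "(z, z') \<in> Q" "z \<noteq> 0" "ray z = ray x" "idx z = s"
        using cut_arc[OF P(1) x(1) pos(2)[OF x(1)] _ y(1), of s] s x(2) by auto
      have "z \<in> P" using subD(5)[OF P(1) z(1)] .
      moreover have "ray z = j" using z(3) r[OF x(1)] s by simp
      ultimately show ?thesis using z unfolding covers_def by blast
    qed
  qed
qed

end

text \<open>\<open>K\<close> consists of the vertices whose subgraphs contain the center. The others
  are intervals on single rays, and both order conditions of \<open>ray_model\<close> express that
  no vertex set contains another one.\<close>

lemma proper_star_ray_model: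
  assumes "proper_H_graph (star d) G"
  shows "\<exists>K ray a b e. ray_model (\<lambda>x y. (x, y) \<in> parcs G) (pverts G) K {1..d} ray a b e"
proof -
  obtain M H where sd: "subdivision_pair (star d) H"
    and M: "\<And>v. v \<in> pverts G \<Longrightarrow> pair_graph (M v) \<and> connected (with_proj (M v)) \<and>
        subgraph (with_proj (M v)) (with_proj H)"
    and adj: "\<And>u v. u \<in> pverts G \<Longrightarrow> v \<in> pverts G \<Longrightarrow> u \<noteq> v \<Longrightarrow>
        (u, v) \<in> parcs G \<longleftrightarrow> pverts (M u) \<inter> pverts (M v) \<noteq> {}"
    and proper: "\<And>u v. u \<in> pverts G \<Longrightarrow> v \<in> pverts G \<Longrightarrow> u \<noteq> v \<Longrightarrow>
        \<not> subgraph (with_proj (M u)) (with_proj (M v))"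
    using assms unfolding proper_H_graph_def is_representation_def by blast
  obtain ray idx where "star_coords (pverts H) (parcs H) d ray idx"
    using subdivision_star_coords[OF sd] by blast
  then interpret star_subgraphs "pverts H" "parcs H" d ray idx by unfold_locales
  define P where "P v = pverts (M v)" for v
  have sub: "sub (P v) (parcs (M v))" if "v \<in> pverts G" for v
    using M[OF that] cut_connected_subgraph[of "M v"] unfolding sub_def P_def subgraph_def by auto
  have incomp: "\<not> P u \<subseteq> P v" if uv: "u \<in> pverts G" "v \<in> pverts G" "u \<noteq> v" for u v
  proof
    assume le: "P u \<subseteq> P v"
    then have "parcs (M u) \<subseteq> parcs (M v)" by (rule induced[OF sub sub, OF uv(1,2)])
    moreover have "wf_digraph (with_proj (M u))" "wf_digraph (with_proj (M v))"
      using M[OF uv(1)] M[OF uv(2)] unfolding subgraph_def by auto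
    ultimately have "subgraph (with_proj (M u)) (with_proj (M v))"
      using le by (auto simp: subgraph_def P_def)
    then show False using proper[OF uv] by blast
  qed
  define K where "K = {v \<in> pverts G. 0 \<in> P v}"
  define a where "a v = Min (idx ` P v)" for v
  define b where "b v = Max (idx ` P v)" for v
  have KG: "v \<in> pverts G" "0 \<in> P v" if "v \<in> K" for v using that by (auto simp: K_def)
  have cK: "covers (P v) j s \<longleftrightarrow> 0 < s \<and> s \<le> last_on (P v) j" if "v \<in> K" for v j s
    using covers_center[OF sub[OF KG(1)[OF that]] KG(2)[OF that]] .
  have off: "v \<in> pverts G" "0 \<notin> P v" if "v \<in> pverts G - K" for v using that by (auto simp: K_def)
  have cN: "covers (P v) j s \<longleftrightarrow> j = first_ray (P v) \<and> a v \<le> s \<and> s \<le> b v"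
    "0 < a v" "a v \<le> b v" "first_ray (P v) \<in> {1..d}" if "v \<in> pverts G - K" for v j s
    using covers_off_center[OF sub[OF off(1)[OF that]] off(2)[OF that]] unfolding a_def b_def by blast+
  have adj': "(u, v) \<in> parcs G \<longleftrightarrow> 0 \<in> P u \<and> 0 \<in> P v \<or> (\<exists>j s. covers (P u) j s \<and> covers (P v) j s)"
    if "u \<in> pverts G" "v \<in> pverts G" "u \<noteq> v" for u v
    using adj[OF that] meet_iff[OF sub sub, OF that(1,2)] unfolding P_def by simp
  have le: "(0 \<in> P u \<longrightarrow> 0 \<in> P v) \<longrightarrow> (\<forall>j s. covers (P u) j s \<longrightarrow> covers (P v) j s) \<longrightarrow> False"
    if "u \<in> pverts G" "v \<in> pverts G" "u \<noteq> v" for u v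
    using covers_subset[OF sub sub, OF that(1,2)] incomp[OF that] by blast
  have "ray_model (\<lambda>x y. (x, y) \<in> parcs G) (pverts G) K {1..d} (\<lambda>v. first_ray (P v)) a b (\<lambda>v. last_on (P v))"
    unfolding ray_model_def
  proof (intro conjI ballI impI)
    show "K \<subseteq> pverts G" by (auto simp: K_def)
    show "(x, y) \<in> parcs G" if "x \<in> K" "y \<in> K" "x \<noteq> y" for x y
      using that KG adj'[of x y] by blast
  next
    fix x assume "x \<in> pverts G - K"
    then show "first_ray (P x) \<in> {1..d}" "0 < a x" "a x \<le> b x" using cN by blast+
  next
    fix x y assume xy: "x \<in> pverts G - K" "y \<in> pverts G - K" and "x \<noteq> y"
    have "(\<exists>j s. covers (P x) j s \<and> covers (P y) j s) \<longleftrightarrow>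
      first_ray (P x) = first_ray (P y) \<and> a x \<le> b y \<and> a y \<le> b x"
      using cN(1,3)[OF xy(1)] cN(1,3)[OF xy(2)]
      \<comment> \<open>The later left end is a common point of two intervals that meet.\<close>
      by (auto intro: exI[of _ "max (a x) (a y)"])
    then show "(x, y) \<in> parcs G \<longleftrightarrow> first_ray (P x) = first_ray (P y) \<and> a x \<le> b y \<and> a y \<le> b x"
      using adj'[of x y] off[OF xy(1)] off[OF xy(2)] \<open>x \<noteq> y\<close> by blast
  next
    fix x y assume xy: "x \<in> pverts G - K" "y \<in> pverts G - K" and r: "first_ray (P x) = first_ray (P y)"
    have *: "\<not> (a y \<le> a x \<and> b x \<le> b y)" if "x \<noteq> y" "x \<in> pverts G - K" "y \<in> pverts G - K"
      "first_ray (P x) = first_ray (P y)" for x y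
      using le[of x y] that off[OF that(2)] off[OF that(3)] cN(1)[OF that(2)] cN(1)[OF that(3)]
      by (auto intro: le_trans)
    show "a x \<le> a y \<longleftrightarrow> b x \<le> b y"
      using *[of x y] *[of y x] xy r by (cases "x = y") auto
  next
    fix v x assume v: "v \<in> K" and x: "x \<in> pverts G - K"
    have ne: "v \<noteq> x" using v x by auto
    have "(\<exists>j s. covers (P v) j s \<and> covers (P x) j s) \<longleftrightarrow> a x \<le> last_on (P v) (first_ray (P x))"
      using cN(1-3)[OF x] cK[OF v] by (auto intro: le_trans)
    then show "(v, x) \<in> parcs G \<longleftrightarrow> a x \<le> last_on (P v) (first_ray (P x))"
      using adj'[of v x] KG[OF v] off[OF x] ne by blast
    \<comment> \<open>Otherwise the initial segment of \<open>v\<close> on the ray of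
      \<open>x\<close> would swallow \<open>x\<close> entirely.\<close>
    show "last_on (P v) (first_ray (P x)) < b x"
    proof (rule ccontr)
      assume "\<not> last_on (P v) (first_ray (P x)) < b x"
      then have "\<forall>j s. covers (P x) j s \<longrightarrow> covers (P v) j s"
        using cN(1,2)[OF x] cK[OF v] by auto
      then show False using le[of x v] KG[OF v] off[OF x] ne by blast
    qed
  qed
  then show ?thesis by blast
qed

section \<open>Assembling components\<close>

lemma iso_on_trans: "iso_on E E' X Y \<phi> \<Longrightarrow> iso_on E' E'' Y Z \<psi> \<Longrightarrow> iso_on E E'' X Z (\<psi> \<circ> \<phi>)"
  unfolding iso_on_def by (auto intro: bij_betw_trans dest: bij_betwE)

lemma iso_on_sym:
  assumes "iso_on E E' X Y \<phi>" shows "iso_on E' E Y X (inv_into X \<phi>)"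
proof -
  have bij: "bij_betw \<phi> X Y" using assms by (simp add: iso_on_def)
  have "E' y z \<longleftrightarrow> E (inv_into X \<phi> y) (inv_into X \<phi> z)" if "y \<in> Y" "z \<in> Y" for y z
    using assms that bij_betw_inv_into_right[OF bij] bij_betwE[OF bij_betw_inv_into[OF bij]]
    unfolding iso_on_def by metis
  then show ?thesis using bij_betw_inv_into[OF bij] by (simp add: iso_on_def)
qed

lemma iso_on_component:
  assumes iso: "iso_on E E' V W \<psi>" and V: "\<And>x y. E x y \<Longrightarrow> x \<in> V \<Longrightarrow> y \<in> V"
    and W: "\<And>x y. E' x y \<Longrightarrow> x \<in> W \<Longrightarrow> y \<in> W" and a: "a \<in> V"
  shows "iso_on E E' (component E a) (component E' (\<psi> a)) \<psi>"
proof -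
  have bij: "bij_betw \<psi> V W" and ee: "\<And>x y. x \<in> V \<Longrightarrow> y \<in> V \<Longrightarrow> E x y \<longleftrightarrow> E' (\<psi> x) (\<psi> y)"
    using iso by (auto simp: iso_on_def)
  have 1: "x \<in> V \<and> E'\<^sup>*\<^sup>* (\<psi> a) (\<psi> x)" if "E\<^sup>*\<^sup>* a x" for x
    using that
  proof (induction rule: rtranclp_induct)
    case (step y z)
    then show ?case using V[OF step(2)] ee[of y z] by (auto intro: rtranclp.rtrancl_into_rtrancl)
  qed (use a in simp)
  have 2: "\<exists>x. E\<^sup>*\<^sup>* a x \<and> y = \<psi> x" if "E'\<^sup>*\<^sup>* (\<psi> a) y" for y
    using that
  proof (induction rule: rtranclp_induct)
    case (step y z)
    then obtain x where x: "E\<^sup>*\<^sup>* a x" "y = \<psi> x" by blast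
    then have xV: "x \<in> V" using 1 by blast
    then have "z \<in> W" using W[OF step(2)] x bij by (auto dest: bij_betwE)
    then obtain z' where "z' \<in> V" "z = \<psi> z'" using bij by (auto simp: bij_betw_def)
    then show ?case using x xV ee step(2) by (metis rtranclp.rtrancl_into_rtrancl)
  qed auto
  have "component E' (\<psi> a) = \<psi> ` component E a" using 1 2 by (auto simp: component_def)
  moreover have "component E a \<subseteq> V" using 1 by (auto simp: component_def)
  ultimately show ?thesis
    using bij ee by (auto simp: iso_on_def bij_betw_def subset_iff inj_on_def)
qed

text \<open>The vertices in components isomorphic to a given one number its size times the number of
  such components. Dividing by the size gives equal multiplicities for every isomorphism type, so
  components can be matched and their isomorphisms glued.\<close>

lemma iso_from_counts:
  fixes E :: "'v \<Rightarrow> 'v \<Rightarrow> bool"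
  assumes fin: "finite V" "finite W" and sym: "\<And>x y. E x y \<Longrightarrow> E y x"
    and V: "\<And>x y. E x y \<Longrightarrow> x \<in> V \<Longrightarrow> y \<in> V" and W: "\<And>x y. E x y \<Longrightarrow> x \<in> W \<Longrightarrow> y \<in> W"
    and count: "\<And>a. a \<in> V \<union> W \<Longrightarrow> card {b \<in> V. alike E a b} =
        card {b \<in> W. alike E a b}"
  shows "\<exists>\<psi>. iso_on E E V W \<psi>"
proof -
  define I where "I X Y \<longleftrightarrow> (\<exists>\<phi>. iso_on E E X Y \<phi>)" for X Y :: "'v set"
  have I_refl: "I X X" for X unfolding I_def iso_on_def by (intro exI[of _ id]) auto
  have I_sym: "I Y X" if "I X Y" for X Y using that iso_on_sym unfolding I_def by blast
  have I_trans: "I X Z" if "I X Y" "I Y Z" for X Y Z using that iso_on_trans unfolding I_def by blast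
  \<comment> \<open>The isomorphism type of a set, as an equivalence class, so that
    \<open>class_bijection\<close> can be applied to components.\<close>
  define s where "s X = {Y. I X Y}" for X
  have s: "s X = s Y \<longleftrightarrow> I X Y" for X Y
    unfolding s_def using I_refl I_sym I_trans by blast
  have ceq: "component E b = component E a" if "b \<in> component E a" for a b
    using component_eq[of E b a, OF sym that] .
  have self: "a \<in> component E a" for a by (simp add: component_def)
  have sub: "component E a \<subseteq> U" if "a \<in> U" "\<And>x y. E x y \<Longrightarrow> x \<in> U \<Longrightarrow> y \<in> U" for a U
  proof
    fix x assume "x \<in> component E a"
    then have "E\<^sup>*\<^sup>* a x" by (simp add: component_def)
    then show "x \<in> U" by (induction rule: rtranclp_induct) (use that in auto)
  qed
  have subV: "component E a \<subseteq> V" if "a \<in> V" for a by (rule sub[OF that]) (rule V)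
  have subW: "component E a \<subseteq> W" if "a \<in> W" for a by (rule sub[OF that]) (rule W)
  define \<V> where "\<V> = component E ` V"
  define \<W> where "\<W> = component E ` W"
  have blocks: "card {Z \<in> component E ` U. s Z = s X} * card X = card {b \<in> U. I X (component E b)}"
    if U: "finite U" "\<And>x y. E x y \<Longrightarrow> x \<in> U \<Longrightarrow> y \<in> U" for X U
  proof -
    have subU: "component E a \<subseteq> U" if "a \<in> U" for a by (rule sub[OF that]) (rule U(2))
    have "card X * card {Z \<in> component E ` U. s Z = s X} = card (\<Union>{Z \<in> component E ` U. s Z = s X})"
    proof (rule card_partition)
      show "finite {Z \<in> component E ` U. s Z = s X}" using U by simp
      show "finite (\<Union>{Z \<in> component E ` U. s Z = s X})" using subU by (intro finite_subset[OF _ U(1)]) blast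
      show "card Z = card X" if "Z \<in> {Z \<in> component E ` U. s Z = s X}" for Z
        using that s bij_betw_same_card unfolding I_def iso_on_def by blast
      fix Z Z' assume Z: "Z \<in> {Z \<in> component E ` U. s Z = s X}" "Z' \<in> {Z \<in> component E ` U. s Z = s X}" "Z \<noteq> Z'"
      then obtain u u' where u: "Z = component E u" "Z' = component E u'" by blast
      show "Z \<inter> Z' = {}" using ceq[of _ u] ceq[of _ u'] Z(3) unfolding u by blast
    qed
    moreover have "\<Union>{Z \<in> component E ` U. s Z = s X} = {b \<in> U. I X (component E b)}"
    proof (intro equalityI subsetI)
      fix b assume "b \<in> \<Union>{Z \<in> component E ` U. s Z = s X}"
      then obtain u where u: "u \<in> U" "b \<in> component E u" "s (component E u) = s X" by blast
      then have "I X (component E b)" using ceq[OF u(2)] s I_sym by simp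
      then show "b \<in> {b \<in> U. I X (component E b)}" using u subU[OF u(1)] by blast
    next
      fix b assume "b \<in> {b \<in> U. I X (component E b)}"
      then have "b \<in> U" "s (component E b) = s X" using s I_sym by auto
      then show "b \<in> \<Union>{Z \<in> component E ` U. s Z = s X}" using self by blast
    qed
    ultimately show ?thesis by (simp add: mult.commute)
  qed
  have count': "card {Z \<in> \<V>. s Z = s X} = card {Z \<in> \<W>. s Z = s X}" if X: "X \<in> \<V> \<union> \<W>" for X
  proof -
    obtain a where a: "a \<in> V \<union> W" "X = component E a" using X unfolding \<V>_def \<W>_def by blast
    have "X \<subseteq> V \<or> X \<subseteq> W" using a subV[of a] subW[of a] by blast
    then have "finite X" using fin finite_subset by blast
    then have "card X \<noteq> 0" using self[of a] a by auto
    moreover have "card {Z \<in> \<V>. s Z = s X} * card X = card {Z \<in> \<W>. s Z = s X} * card X"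
      using count[OF a(1)] blocks[OF fin(1) V] blocks[OF fin(2) W]
      unfolding \<V>_def \<W>_def a(2) I_def by simp
    ultimately show ?thesis by simp
  qed
  have fin': "finite \<V>" "finite \<W>" using fin by (simp_all add: \<V>_def \<W>_def)
  have ex: "\<exists>Y\<in>\<W>. s Y = s X" if "X \<in> \<V>" for X
  proof -
    have "card {Z \<in> \<V>. s Z = s X} \<noteq> 0" using that fin' by auto
    then have "card {Z \<in> \<W>. s Z = s X} \<noteq> 0" using count'[of X] that by simp
    then show ?thesis by (metis (mono_tags, lifting) card.empty empty_Collect_eq)
  qed
  have ex': "\<exists>X\<in>\<V>. s X = s Y" if "Y \<in> \<W>" for Y
  proof -
    have "card {Z \<in> \<W>. s Z = s Y} \<noteq> 0" using that fin' by auto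
    then have "card {Z \<in> \<V>. s Z = s Y} \<noteq> 0" using count'[of Y] that by simp
    then show ?thesis by (metis (mono_tags, lifting) card.empty empty_Collect_eq)
  qed
  obtain \<beta> where \<beta>: "bij_betw \<beta> \<V> \<W>" "\<And>X. X \<in> \<V> \<Longrightarrow> s (\<beta> X) = s X"
    using class_bijection[OF fin' ex ex' count'] by blast
  have "\<exists>\<eta>. iso_on E E X (\<beta> X) \<eta>" if "X \<in> \<V>" for X
    using \<beta>(2)[OF that] s I_sym unfolding I_def by blast
  then obtain \<eta> where \<eta>: "\<And>X. X \<in> \<V> \<Longrightarrow> iso_on E E X (\<beta> X) (\<eta> X)" by metis
  define \<psi> where "\<psi> x = \<eta> (component E x) x" for x
  have VX: "component E x \<in> \<V>" if "x \<in> V" for x using that by (simp add: \<V>_def)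
  have \<psi>: "\<psi> x \<in> \<beta> (component E x)" if "x \<in> V" for x
    using \<eta>[OF VX[OF that]] self[of x] unfolding iso_on_def \<psi>_def by (auto dest: bij_betwE)
  have \<beta>W: "\<beta> (component E x) \<in> \<W>" if "x \<in> V" for x using \<beta>(1) VX[OF that] by (auto dest: bij_betwE)
  have block: "Y = component E y" if Y: "Y \<in> \<W>" and y: "y \<in> Y" for Y y
  proof -
    obtain w where "w \<in> W" "Y = component E w" using Y unfolding \<W>_def by blast
    then show ?thesis using ceq y by simp
  qed
  have \<psi>W: "\<psi> x \<in> W" if x: "x \<in> V" for x
  proof -
    obtain w where "w \<in> W" "\<beta> (component E x) = component E w" using \<beta>W[OF x] unfolding \<W>_def by blast
    then show ?thesis using \<psi>[OF x] subW[of w] by blast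
  qed
  have same_comp: "component E x = component E y" if "x \<in> V" "y \<in> V" "component E (\<psi> x) = component E (\<psi> y)" for x y
  proof -
    have "\<beta> (component E x) = \<beta> (component E y)"
      using block[OF \<beta>W \<psi>, OF that(1,1)] block[OF \<beta>W \<psi>, OF that(2,2)] that(3) by simp
    then show ?thesis using \<beta>(1) VX that(1,2) by (auto simp: bij_betw_def inj_on_def)
  qed
  have "inj_on \<psi> V"
  proof (rule inj_onI)
    fix x y assume xy: "x \<in> V" "y \<in> V" "\<psi> x = \<psi> y"
    then have c: "component E x = component E y" using same_comp[of x y] by simp
    have "inj_on (\<eta> (component E x)) (component E x)" using \<eta>[OF VX[OF xy(1)]] by (simp add: iso_on_def bij_betw_def)
    then show "x = y" using xy(3) self[of x] self[of y] c unfolding \<psi>_def by (auto dest: inj_onD)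
  qed
  moreover have "y \<in> \<psi> ` V" if "y \<in> W" for y
  proof -
    have "component E y \<in> \<W>" using that by (simp add: \<W>_def)
    then obtain X where X: "X \<in> \<V>" "\<beta> X = component E y" using \<beta>(1) by (auto simp: bij_betw_def)
    then obtain x where x: "x \<in> X" "\<eta> X x = y"
      using \<eta>[OF X(1)] self[of y] unfolding iso_on_def bij_betw_def by (metis imageE)
    obtain v where v: "v \<in> V" "X = component E v" using X(1) unfolding \<V>_def by blast
    then have "component E x = X" "x \<in> V" using x(1) ceq[of x v] subV[of v] by auto
    then show ?thesis using x(2) unfolding \<psi>_def by blast
  qed
  ultimately have "bij_betw \<psi> V W" using \<psi>W by (auto simp: bij_betw_def)
  moreover have "E x y \<longleftrightarrow> E (\<psi> x) (\<psi> y)" if xy: "x \<in> V" "y \<in> V" for x y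
  proof (cases "component E x = component E y")
    case True
    then have "y \<in> component E x" using self[of y] by simp
    then show ?thesis using \<eta>[OF VX[OF xy(1)]] self[of x] True unfolding iso_on_def \<psi>_def by simp
  next
    \<comment> \<open>Vertices of different components are not adjacent, and \<open>\<psi>\<close>
      keeps them in different components.\<close>
    case False
    have "component E u = component E v" if "E u v" for u v
      using ceq[of v u] r_into_rtranclp[of E, OF that] by (simp add: component_def)
    then show ?thesis using False same_comp[OF xy] by blast
  qed
  ultimately show ?thesis unfolding iso_on_def by blast
qed

text \<open>An isomorphism of the library maps vertices and arcs separately and also renames heads
  and tails. Between pair graphs heads and tails are projections, so the vertex map determines the
  arc map.\<close>

lemma digraph_iso_iff:
  fixes G H :: "nat pair_pre_digraph"
  assumes "pair_graph G" "pair_graph H"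
  shows "digraph_iso (with_proj G) (with_proj H) \<longleftrightarrow>
    (\<exists>\<psi>. iso_on (\<lambda>x y. (x, y) \<in> parcs G) (\<lambda>x y. (x, y) \<in> parcs H) (pverts G) (pverts H) \<psi>)"
proof
  interpret G: pair_graph G by fact
  interpret H: pair_graph H by fact
  have GV: "x \<in> pverts G \<and> y \<in> pverts G" if "(x, y) \<in> parcs G" for x y
    using G.arc_fst_in_verts[OF that] G.arc_snd_in_verts[OF that] by simp
  have HV: "x \<in> pverts H \<and> y \<in> pverts H" if "(x, y) \<in> parcs H" for x y
    using H.arc_fst_in_verts[OF that] H.arc_snd_in_verts[OF that] by simp
  {
    assume "digraph_iso (with_proj G) (with_proj H)"
    then obtain f where f: "pre_digraph.digraph_isomorphism (with_proj G) f" "with_proj H = app_iso f (with_proj G)"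
      unfolding digraph_iso_def by blast
    have ff: "iso_tail f = fst" "iso_head f = snd" "pverts H = iso_verts f ` pverts G" "parcs H = iso_arcs f ` parcs G"
      using f(2) by (auto simp: with_proj_def app_iso_def)
    have arc: "iso_arcs f (x, y) = (iso_verts f x, iso_verts f y)" if "(x, y) \<in> parcs G" for x y
      using f(1) that ff(1,2) unfolding pre_digraph.digraph_isomorphism_def by (auto simp: prod_eq_iff)
    have inj: "inj_on (iso_verts f) (pverts G)"
      using f(1) unfolding pre_digraph.digraph_isomorphism_def by simp
    have "(x, y) \<in> parcs G \<longleftrightarrow> (iso_verts f x, iso_verts f y) \<in> parcs H" if xy: "x \<in> pverts G" "y \<in> pverts G" for x y
    proof
      assume "(x, y) \<in> parcs G"
      then show "(iso_verts f x, iso_verts f y) \<in> parcs H" unfolding ff(4) using arc by force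
    next
      assume "(iso_verts f x, iso_verts f y) \<in> parcs H"
      then obtain u v where uv: "(u, v) \<in> parcs G" "iso_arcs f (u, v) = (iso_verts f x, iso_verts f y)"
        unfolding ff(4) by force
      then have "u = x" "v = y" using arc[OF uv(1)] GV[OF uv(1)] xy inj by (auto dest: inj_onD)
      then show "(x, y) \<in> parcs G" using uv(1) by simp
    qed
    then show "\<exists>\<psi>. iso_on (\<lambda>x y. (x, y) \<in> parcs G) (\<lambda>x y. (x, y) \<in> parcs H) (pverts G) (pverts H) \<psi>"
      using inj ff(3) unfolding iso_on_def bij_betw_def by blast
  next
    assume "\<exists>\<psi>. iso_on (\<lambda>x y. (x, y) \<in> parcs G) (\<lambda>x y. (x, y) \<in> parcs H) (pverts G) (pverts H) \<psi>"
    then obtain \<psi> where \<psi>: "bij_betw \<psi> (pverts G) (pverts H)"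
      "\<And>x y. x \<in> pverts G \<Longrightarrow> y \<in> pverts G \<Longrightarrow> (x, y) \<in> parcs G \<longleftrightarrow> (\<psi> x, \<psi> y) \<in> parcs H"
      unfolding iso_on_def by blast
    have inj: "inj_on \<psi> (pverts G)" and img: "\<psi> ` pverts G = pverts H" using \<psi>(1) by (auto simp: bij_betw_def)
    define f where "f = \<lparr>iso_verts = \<psi>, iso_arcs = map_prod \<psi> \<psi>, iso_head = snd, iso_tail = fst\<rparr>"
    have "inj_on (map_prod \<psi> \<psi>) (parcs G)"
      using inj GV by (fastforce simp: inj_on_def)
    then have "pre_digraph.digraph_isomorphism (with_proj G) f"
      unfolding pre_digraph.digraph_isomorphism_def f_def using inj G.wf_digraph_axioms by simp
    moreover have "map_prod \<psi> \<psi> ` parcs G = parcs H"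
    proof (intro equalityI subrelI)
      fix x y assume "(x, y) \<in> map_prod \<psi> \<psi> ` parcs G"
      then show "(x, y) \<in> parcs H" using \<psi>(2) GV by auto
    next
      fix x y assume xy: "(x, y) \<in> parcs H"
      then obtain u v where "u \<in> pverts G" "v \<in> pverts G" "x = \<psi> u" "y = \<psi> v"
        using HV[OF xy] img by blast
      then show "(x, y) \<in> map_prod \<psi> \<psi> ` parcs G" using \<psi>(2) xy by force
    qed
    then have "with_proj H = app_iso f (with_proj G)"
      using img by (simp add: with_proj_def app_iso_def f_def)
    ultimately show "digraph_iso (with_proj G) (with_proj H)" unfolding digraph_iso_def by blast
  }
qed

section \<open>Correctness of the answer\<close>

lemma answer_correct:
  fixes G H :: "nat pair_pre_digraph"
  assumes d: "1 \<le> d" and V: "pverts G = {0..<n}" "pverts H = {0..<n}"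
    and G: "proper_H_graph (star d) G" and H: "proper_H_graph (star d) H"
  defines "B \<equiv> bnd d n" and "E \<equiv> union_adj n G H"
  defines "C \<equiv> cand E B (n + n)"
  shows "answer B d n E (lev E B C B) (lead E B C B) \<longleftrightarrow> digraph_iso (with_proj G) (with_proj H)"
proof -
  have pg: "pair_graph G" "pair_graph H" using G H by (simp_all add: proper_H_graph_def)
  interpret G: pair_graph G by (rule pg)
  interpret H: pair_graph H by (rule pg)
  have arcs: "(x, y) \<in> parcs G \<Longrightarrow> (y, x) \<in> parcs G" "(x, y) \<in> parcs H \<Longrightarrow> (y, x) \<in> parcs H"
    "(x, x) \<notin> parcs G" "(x, x) \<notin> parcs H" for x y
    using G.pair_sym_arcs H.pair_sym_arcs G.pair_no_loops[of "(x, x)"] H.pair_no_loops[of "(x, x)"]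
    by (auto simp: symmetric_def elim: symE)
  interpret ugraph E "n + n" B
  proof
    show "x < n + n \<and> y < n + n" if "E x y" for x y using that by (auto simp: E_def union_adj_def)
    show "E y x" if "E x y" for x y using that arcs(1,2) by (auto simp: E_def union_adj_def)
    show "\<not> E x x" for x using arcs(3,4) by (auto simp: E_def union_adj_def)
    show "n + n \<le> B" by (simp add: B_def bnd_def)
  qed
  let ?V = "{0..<n}" and ?W = "{n..<n + n}"
  have VW: "x \<in> ?V \<Longrightarrow> y \<in> ?V" "x \<in> ?W \<Longrightarrow> y \<in> ?W" if "E x y" for x y
    using that by (auto simp: E_def union_adj_def)
  have isoG: "iso_on (\<lambda>x y. (x, y) \<in> parcs G) E (pverts G) ?V id"
    by (auto simp: iso_on_def V E_def union_adj_def)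
  have isoH: "iso_on (\<lambda>x y. (x, y) \<in> parcs H) E (pverts H) ?W (\<lambda>x. x + n)"
    unfolding iso_on_def bij_betw_def V
    by (auto simp: E_def union_adj_def inj_on_def image_iff Bex_def intro: le_add_diff_inverse2[symmetric] exI[of _ "_ - n"])
  have model: "\<exists>K ray a b e. ray_model E U K {1..d} ray a b e" if U: "U = ?V \<or> U = ?W" for U
  proof -
    have "\<exists>(F :: nat pair_pre_digraph) \<phi>. proper_H_graph (star d) F \<and> iso_on (\<lambda>x y. (x, y) \<in> parcs F) E (pverts F) U \<phi>"
      using U
    proof
      assume "U = ?V"
      then show ?thesis using G isoG by (intro exI[of _ G] exI[of _ id]) simp
    next
      assume "U = ?W"
      then show ?thesis using H isoH by (intro exI[of _ H] exI[of _ "\<lambda>x. x + n"]) simp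
    qed
    then obtain F :: "nat pair_pre_digraph" and \<phi> where F: "proper_H_graph (star d) F"
      "iso_on (\<lambda>x y. (x, y) \<in> parcs F) E (pverts F) U \<phi>" by blast
    obtain K ray a b e where M: "ray_model (\<lambda>x y. (x, y) \<in> parcs F) (pverts F) K {1..d} ray a b e"
      using proper_star_ray_model[OF F(1)] by blast
    have \<phi>: "inj_on \<phi> (pverts F)" "\<phi> ` pverts F = U"
      "\<And>x y. x \<in> pverts F \<Longrightarrow> y \<in> pverts F \<Longrightarrow> E (\<phi> x) (\<phi> y) \<longleftrightarrow> (x, y) \<in> parcs F"
      using F(2) by (auto simp: iso_on_def bij_betw_def)
    from ray_model_image[OF M \<phi>(1,3)] show ?thesis unfolding \<phi>(2) by blast
  qed
  have simplicial: "\<exists>x\<in>S. \<forall>p\<in>S. \<forall>q\<in>S. p \<noteq> x \<and> q \<noteq> x \<and> E x p \<and> E x q \<and> p \<noteq> q \<longrightarrow> E p q"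
    if S: "S \<subseteq> {..<n + n}" "S \<noteq> {}" for S
  proof -
    obtain y where y: "y \<in> S" "y < n + n" using S by blast
    \<comment> \<open>Each half of the disjoint union has its own model. A vertex that is simplicial
      within its half remains simplicial in \<open>S\<close>, since no edge leaves the half.\<close>
    define U where "U = (if y < n then ?V else ?W)"
    have U: "U = ?V \<or> U = ?W" "S \<inter> U \<noteq> {}" using y by (auto simp: U_def)
    obtain K ray a b e where M: "ray_model E U K {1..d} ray a b e" using model[OF U(1)] by blast
    have "finite (S \<inter> U)" using U(1) by auto
    then obtain x where x: "x \<in> S \<inter> U"
      "\<forall>p\<in>S \<inter> U. \<forall>q\<in>S \<inter> U. p \<noteq> x \<and> q \<noteq> x \<and> E x p \<and> E x q \<and> p \<noteq> q \<longrightarrow> E p q"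
      using simplicial_exists[OF M sym _ U(2) Int_lower2] by blast
    have "p \<in> U" if "E x p" for p using VW[OF that] x(1) U(1) by auto
    then show ?thesis using x by blast
  qed
  have linked: "linked B d E lv ld a b" if ab: "a < n + n" "b < n + n"
    and iso: "iso_on E E (component E a) (component E b) \<phi>" for a b \<phi>
  proof -
    define X where "X = component E a"
    have aX: "a \<in> X" by (simp add: X_def component_def)
    have closed: "y \<in> X" if "x \<in> X" "E x y" for x y
      using that unfolding X_def component_def by (auto intro: rtranclp.rtrancl_into_rtrancl)
    define U where "U = (if a < n then ?V else ?W)"
    have U: "U = ?V \<or> U = ?W" "a \<in> U" using ab(1) by (auto simp: U_def)
    have XU: "X \<subseteq> U"
    proof
      fix x assume "x \<in> X"
      then have "E\<^sup>*\<^sup>* a x" by (simp add: X_def component_def)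
      then show "x \<in> U" by (induction rule: rtranclp_induct) (use U VW in blast)+
    qed
    obtain K\<^sub>0 ray la ra e\<^sub>0 where "ray_model E U K\<^sub>0 {1..d} ray la ra e\<^sub>0" using model[OF U(1)] by blast
    \<comment> \<open>The part of the center clique in this component may be empty;
      \<open>maximal_center\<close> deals with that.\<close>
    then have M\<^sub>0: "ray_model E X (K\<^sub>0 \<inter> X) {1..d} ray la ra e\<^sub>0"
      by (rule ray_model_restrict[OF _ XU])
    have finX: "finite X" using finite_component[OF ab(1)] by (simp add: X_def)
    have reach: "E\<^sup>*\<^sup>* a x" if "x \<in> X" for x using that by (simp add: X_def component_def)
    have "\<exists>K e'. ray_model E X K {1..d} ray la ra e' \<and> K \<noteq> {} \<and>
        (\<forall>x\<in>X. (\<forall>v\<in>K. v = x \<or> E v x) \<longrightarrow> x \<in> K)"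
      by (rule maximal_center[OF M\<^sub>0 _ finX aX]) (fact sym reach closed)+
    then obtain K e where M: "ray_model E X K {1..d} ray la ra e" and ne: "K \<noteq> {}"
      and max': "\<forall>x\<in>X. (\<forall>v\<in>K. v = x \<or> E v x) \<longrightarrow> x \<in> K"
      by blast
    have max: "x \<in> K" if "x \<in> X" "\<And>v. v \<in> K \<Longrightarrow> v = x \<or> E v x" for x
      using max' that by blast
    have KX: "K \<subseteq> X" using ray_modelD(1)[OF M] .
    have "\<exists>v\<in>K. {x. C v x} = K"
      unfolding C_def
    proof (rule maximal_clique_cand[OF simplicial ne])
      show "K \<subseteq> {..<n + n}" using KX component_N[OF ab(1)] by (auto simp: X_def)
      show "E x y" if "x \<in> K" "y \<in> K" "x \<noteq> y" for x y using ray_modelD(2)[OF M that] .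
      show "x \<in> K" if x: "\<And>v. v \<in> K \<Longrightarrow> v = x \<or> E v x" for x
      proof (rule max[OF _ x])
        obtain v where "v \<in> K" using ne by blast
        then show "x \<in> X" using x[of v] KX closed[of v x] by auto
      qed
    qed
    then obtain v where v: "v \<in> K" "{x. C v x} = K" by blast
    define Y where "Y = component E b"
    have \<phi>: "bij_betw \<phi> X Y" "\<And>x y. x \<in> X \<Longrightarrow> y \<in> X \<Longrightarrow> E x y \<longleftrightarrow> E (\<phi> x) (\<phi> y)"
      using iso by (simp_all add: iso_on_def X_def Y_def)
    have closedY: "y \<in> Y" if "x \<in> Y" "E x y" for x y
      using that unfolding Y_def component_def by (auto intro: rtranclp.rtrancl_into_rtrancl)
    have img: "\<phi> ` K \<subseteq> Y" using \<phi>(1) KX by (auto simp: bij_betw_def)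
    \<comment> \<open>Being a maximal clique is invariant, so the image of \<open>K\<close> is found
      among the candidates of the other component, whatever its vertex numbers are.\<close>
    have "\<exists>w\<in>\<phi> ` K. {x. C w x} = \<phi> ` K"
      unfolding C_def
    proof (rule maximal_clique_cand[OF simplicial])
      show "\<phi> ` K \<noteq> {}" using ne by simp
      show "\<phi> ` K \<subseteq> {..<n + n}" using img component_N[OF ab(2)] by (auto simp: Y_def)
      show "E x y" if "x \<in> \<phi> ` K" "y \<in> \<phi> ` K" "x \<noteq> y" for x y
        using that ray_modelD(2)[OF M] \<phi>(2) KX by blast
      show "x \<in> \<phi> ` K" if x: "\<And>v. v \<in> \<phi> ` K \<Longrightarrow> v = x \<or> E v x" for x
      proof -
        obtain u where "u \<in> K" using ne by blast
        then have "x \<in> Y" using x[of "\<phi> u"] img closedY[of "\<phi> u" x] by auto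
        then obtain z where z: "z \<in> X" "x = \<phi> z" using \<phi>(1) by (auto simp: bij_betw_def)
        have "u = z \<or> E u z" if u: "u \<in> K" for u
          using x[of "\<phi> u"] u z \<phi>(2)[of u z] KX \<phi>(1) by (auto simp: bij_betw_def dest: inj_onD)
        then show ?thesis using max[OF z(1)] z(2) by blast
      qed
    qed
    then obtain w where w: "w \<in> \<phi> ` K" "{x. C w x} = \<phi> ` K" by blast
    show ?thesis
      using iso_imp_linked[OF ab iso M[unfolded X_def] v[unfolded C_def] w[unfolded C_def]]
        digit_bound[of d n] d unfolding B_def by simp
  qed
  have linked_iff: "linked B d E lv ld a b \<longleftrightarrow> (alike E a b)"
    if "a < n + n" "b < n + n" for a b
    using linked[OF that] linked_imp_iso by blast
  have nB: "n + n \<le> B" by (rule NB)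
  have "{b. b < B \<and> (b < n \<and> linked B d E lv ld a b)} =
      {b \<in> ?V. alike E a b}"
    "{b. b < B \<and> (n \<le> b \<and> b < n + n \<and> linked B d E lv ld a b)} =
      {b \<in> ?W. alike E a b}" if "a < n + n" for a
    using linked_iff[OF that] nB by auto
  then have ans: "answer B d n E lv ld \<longleftrightarrow> (\<forall>a \<in> ?V \<union> ?W.
      card {b \<in> ?V. alike E a b} =
      card {b \<in> ?W. alike E a b})"
    unfolding answer_def using nB by (auto simp: not_less)
  also have "\<dots> \<longleftrightarrow> (\<exists>\<psi>. iso_on E E ?V ?W \<psi>)"
  proof
    assume "\<exists>\<psi>. iso_on E E ?V ?W \<psi>"
    then obtain \<psi> where \<psi>: "iso_on E E ?V ?W \<psi>" by blast
    have inj: "inj_on \<psi> ?V" and img: "\<psi> ` ?V = ?W" using \<psi> by (auto simp: iso_on_def bij_betw_def)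
    have c: "iso_on E E (component E b) (component E (\<psi> b)) \<psi>" if "b \<in> ?V" for b
      by (rule iso_on_component[OF \<psi> _ _ that]) (use VW in blast)+
    show "\<forall>a \<in> ?V \<union> ?W. card {b \<in> ?V. alike E a b} =
      card {b \<in> ?W. alike E a b}"
    proof
      fix a
      let ?P = "alike E a"
      have P: "?P b \<longleftrightarrow> ?P (\<psi> b)" if "b \<in> ?V" for b
        using iso_on_trans c[OF that] iso_on_sym[OF c[OF that]] by blast
      \<comment> \<open>An isomorphism of the halves maps each component to an isomorphic one, so it
        carries the vertices counted on one side to those counted on the other.\<close>
      have "{b \<in> ?W. ?P b} = \<psi> ` {b \<in> ?V. ?P b}" using P unfolding img[symmetric] by blast
      moreover have "inj_on \<psi> {b \<in> ?V. ?P b}" using inj by (auto intro: inj_on_subset)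
      ultimately show "card {b \<in> ?V. ?P b} = card {b \<in> ?W. ?P b}" by (simp add: card_image)
    qed
  next
    assume count: "\<forall>a \<in> ?V \<union> ?W. card {b \<in> ?V. alike E a b} =
      card {b \<in> ?W. alike E a b}"
    show "\<exists>\<psi>. iso_on E E ?V ?W \<psi>"
      by (rule iso_from_counts[OF _ _ sym]) (use VW count in \<open>auto simp del: atLeastLessThan_iff\<close>)
  qed
  also have "\<dots> \<longleftrightarrow> (\<exists>\<psi>. iso_on (\<lambda>x y. (x, y) \<in> parcs G) (\<lambda>x y. (x, y) \<in> parcs H) (pverts G) (pverts H) \<psi>)"
    using iso_on_trans[OF iso_on_trans[OF isoG] iso_on_sym[OF isoH]]
      iso_on_trans[OF iso_on_trans[OF iso_on_sym[OF isoG]] isoH] by blast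
  also have "\<dots> \<longleftrightarrow> digraph_iso (with_proj G) (with_proj H)"
    using digraph_iso_iff[OF pg] by simp
  finally show ?thesis by (simp add: C_def)
qed

theorem theorem7:
  shows "\<exists>(alg :: com) (f :: nat \<Rightarrow> nat) (c :: nat). computable f \<and>
    (\<forall>d \<ge> 1. \<forall>(n :: nat) (G :: nat pair_pre_digraph) (H :: nat pair_pre_digraph).
       pverts G = {0..<n} \<longrightarrow> pverts H = {0..<n} \<longrightarrow>
       proper_H_graph (star d) G \<longrightarrow> proper_H_graph (star d) H \<longrightarrow>
       decides_within alg (graph_pair_input d n G H) (f d * (max 1 n) ^ c)
         (digraph_iso (with_proj G) (with_proj H)))"
proof -
  obtain alg f c where "computable f" and alg: "\<And>d n G H.
    decides_within alg (graph_pair_input d n G H) (f d * max 1 n ^ c)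
      (let B = bnd d n; E = union_adj n G H; C = cand E B (n + n) in
        answer B d n E (lev E B C B) (lead E B C B))"
    using decides_within_answer by blast
  moreover have "decides_within alg (graph_pair_input d n G H) (f d * max 1 n ^ c)
      (digraph_iso (with_proj G) (with_proj H))"
    if "1 \<le> d" "pverts G = {0..<n}" "pverts H = {0..<n}"
      "proper_H_graph (star d) G" "proper_H_graph (star d) H" for d n G H
    using alg[of d n G H] unfolding Let_def answer_correct[OF that] .
  ultimately show ?thesis by blast
qed

end
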